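(* Consider equations of the class $u_t=u_{xx}+k(x)u^2(1-u)$ with $k\neq 0$. Up to equivalence with respect to the group $G^{\sim}$, all pairs $(k,Q)$, where $Q=\partial_t+\xi(t,x,u)\partial_x+\eta(t,x,u)\partial_u$ is a nonclassical symmetry (reduction operator with $\tau=1$) of the equation with coefficient $k$ that is not equivalent to a Lie symmetry of that equation, are exhausted by the following list. That is, every pair in the list is such a pair, and every such pair is $G^{\sim}$-equivalent to a pair in the list: 1. $k=c\tan^2 x$, $\quad Q=\partial_t-\cot x\,\partial_x$; 2. $k=c\tanh^2 x$, $\quad Q=\partial_t-\coth x\,\partial_x$; 3. $k=c\coth^2 x$, $\quad Q=\partial_t-\tanh x\,\partial_x$; 4. $k=cx^{2}$, $\quad Q=\partial_t-\frac1x\,\partial_x$; 5. $k=\frac{c^2}{2}$ with $c>0$, $\quad Q=\partial_t\pm\frac c2(3u-1)\,\partial_x-\frac{3c^2}{4}u^2(u-1)\,\partial_u$ (either choice of sign); 6. $k=2x^{-2}$, $\quad Q=\partial_t+\frac3x(u-1)\,\partial_x-\frac3{x^2}u(u-1)^2\,\partial_u$. Here $c$ is an arbitrary nonzero real constant in cases 1--4 and an arbitrary positive constant in case 5.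
   Context: All functions are real-valued and smooth. Considerations are local: $x$ ranges over an open interval on which $k$ is defined and nowhere zero, and $(t,x,u)$ ranges over a product of open intervals on which the coefficients of $Q$ are defined. In particular, each pair in the list is considered on an $x$-interval where its expressions are defined and $k\neq0$. **Nonclassical symmetry.** Let $\mathcal L$ be the equation $L:=u_t-u_{xx}-k(x)u^2(1-u)=0$ (order $r=2$). Let $Q=\tau\partial_t+\xi\partial_x+\eta\partial_u$, where $\tau,\xi,\eta$ are functions of $(t,x,u)$ and $(\tau,\xi)\ne(0,0)$. Its characteristic is $Q[u]:=\eta-\tau u_t-\xi u_x$. Let $\mathcal Q^{(2)}$ be the manifold in the jet space $J^{(2)}$ defined by the equation $Q[u]=0$ together with all its differential consequences of order at most $2$, that is, $Q[u]=0$, $D_tQ[u]=0$, $D_xQ[u]=0$, where $D_t,D_x$ are total derivatives. Let $Q_{(2)}$ be the standard second prolongation of $Q$. Then $Q$ is called a nonclassical symmetry (also conditional symmetry, $Q$-conditional symmetry, reduction operator) of $\mathcal L$ if $$Q_{(2)}L\,\big|_{\mathcal L\cap\mathcal Q^{(2)}}=0 .$$ This property is preserved when $Q$ is multiplied by a nowhere vanishing function $\lambda(t,x,u)$. Operators differing by such a factor are regarded as equivalent, so the case $\tau\neq0$ is normalized to $\tau=1$. **Equivalence to Lie symmetries.** A nonclassical symmetry $Q$ of $\mathcal L$ is equivalent to a Lie symmetry if $Q=\lambda X$ for some nowhere vanishing function $\lambda(t,x,u)$ and some Lie (classical) symmetry generator $X$ of $\mathcal L$, that is, a vector field $X$ with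 $X_{(2)}L|_{\mathcal L}=0$. **The group $G^{\sim}$.** The equivalence group $G^{\sim}$ of the class consists of the transformations $$\tilde t=\varepsilon_1^2t+\varepsilon_2,\quad \tilde x=\varepsilon_1x+\varepsilon_3,\quad \tilde u=u,\quad \tilde k=\varepsilon_1^{-2}k,$$ with real constants $\varepsilon_1\neq0,\varepsilon_2,\varepsilon_3$. Such a transformation maps the equation with coefficient $k$ to the equation with coefficient $\tilde k$. Two pairs $(k,Q)$ and $(\tilde k,\tilde Q)$ are $G^{\sim}$-equivalent if some transformation from $G^{\sim}$ maps $k$ to $\tilde k$ and its pushforward maps $Q$ to $\tilde Q$ up to multiplication by a nowhere vanishing function. *)

theory Defs
  imports "HOL-Analysis.Analysis"
begin

section \<open>Smooth functions and open intervals\<close>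

text \<open>
  For an open subset \<open>S\<close> of a Euclidean space, \<open>Ck_on n S f\<close> says that \<open>f\<close> is \<open>n\<close> times continuously
  differentiable on \<open>S\<close>; values of \<open>f\<close> outside \<open>S\<close> are irrelevant.
\<close>

primrec Ck_on :: "nat \<Rightarrow> 'a::real_normed_vector set \<Rightarrow> ('a \<Rightarrow> 'b::real_normed_vector) \<Rightarrow> bool" where
  "Ck_on 0 S f \<longleftrightarrow> continuous_on S f"
| "Ck_on (Suc n) S f \<longleftrightarrow>
     (\<forall>x\<in>S. f differentiable (at x)) \<and> (\<forall>v. Ck_on n S (\<lambda>x. frechet_derivative f (at x) v))"

definition smooth_on :: "'a::real_normed_vector set \<Rightarrow> ('a \<Rightarrow> 'b::real_normed_vector) \<Rightarrow> bool" where
  "smooth_on S f \<longleftrightarrow> (\<forall>n. Ck_on n S f)"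

definition open_interval :: "real set \<Rightarrow> bool" where
  "open_interval S \<longleftrightarrow> open S \<and> is_interval S \<and> S \<noteq> {}"


section \<open>The jet space of order two and prolongation of vector fields\<close>

record jet =
  jt :: real
  jx :: real
  ju :: real
  jut :: real
  jux :: real
  jutt :: real
  jutx :: real
  juxx :: real

definition base :: "jet \<Rightarrow> real \<times> real \<times> real" where
  "base j = (jt j, jx j, ju j)"

definition pd_t :: "(jet \<Rightarrow> real) \<Rightarrow> jet \<Rightarrow> real" where
  "pd_t F j = deriv (\<lambda>s. F (j\<lparr>jt := s\<rparr>)) (jt j)"

definition pd_x :: "(jet \<Rightarrow> real) \<Rightarrow> jet \<Rightarrow> real" where
  "pd_x F j = deriv (\<lambda>s. F (j\<lparr>jx := s\<rparr>)) (jx j)"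

definition pd_u :: "(jet \<Rightarrow> real) \<Rightarrow> jet \<Rightarrow> real" where
  "pd_u F j = deriv (\<lambda>s. F (j\<lparr>ju := s\<rparr>)) (ju j)"

definition pd_ut :: "(jet \<Rightarrow> real) \<Rightarrow> jet \<Rightarrow> real" where
  "pd_ut F j = deriv (\<lambda>s. F (j\<lparr>jut := s\<rparr>)) (jut j)"

definition pd_ux :: "(jet \<Rightarrow> real) \<Rightarrow> jet \<Rightarrow> real" where
  "pd_ux F j = deriv (\<lambda>s. F (j\<lparr>jux := s\<rparr>)) (jux j)"

definition pd_utt :: "(jet \<Rightarrow> real) \<Rightarrow> jet \<Rightarrow> real" where
  "pd_utt F j = deriv (\<lambda>s. F (j\<lparr>jutt := s\<rparr>)) (jutt j)"

definition pd_utx :: "(jet \<Rightarrow> real) \<Rightarrow> jet \<Rightarrow> real" where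
  "pd_utx F j = deriv (\<lambda>s. F (j\<lparr>jutx := s\<rparr>)) (jutx j)"

definition pd_uxx :: "(jet \<Rightarrow> real) \<Rightarrow> jet \<Rightarrow> real" where
  "pd_uxx F j = deriv (\<lambda>s. F (j\<lparr>juxx := s\<rparr>)) (juxx j)"

text \<open>
  The total derivatives are only correct for \<open>F\<close> of order at most one, that is, \<open>F\<close> not depending on
  \<open>jutt\<close>, \<open>jutx\<close>, \<open>juxx\<close>.  They are applied to no other functions below.
\<close>

definition D_t :: "(jet \<Rightarrow> real) \<Rightarrow> jet \<Rightarrow> real" where
  "D_t F j = pd_t F j + jut j * pd_u F j + jutt j * pd_ut F j + jutx j * pd_ux F j"

definition D_x :: "(jet \<Rightarrow> real) \<Rightarrow> jet \<Rightarrow> real" where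
  "D_x F j = pd_x F j + jux j * pd_u F j + jutx j * pd_ut F j + juxx j * pd_ux F j"

text \<open>A vector field \<open>\<tau> \<partial>\<^sub>t + \<xi> \<partial>\<^sub>x + \<eta> \<partial>\<^sub>u\<close> is the map \<open>p \<mapsto> (\<tau> p, \<xi> p, \<eta> p)\<close> with \<open>p = (t, x, u)\<close>.\<close>

type_synonym vfield = "real \<times> real \<times> real \<Rightarrow> real \<times> real \<times> real"

definition vtau :: "vfield \<Rightarrow> jet \<Rightarrow> real" where
  "vtau Q j = fst (Q (base j))"

definition vxi :: "vfield \<Rightarrow> jet \<Rightarrow> real" where
  "vxi Q j = fst (snd (Q (base j)))"

definition veta :: "vfield \<Rightarrow> jet \<Rightarrow> real" where
  "veta Q j = snd (snd (Q (base j)))"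

definition characteristic :: "vfield \<Rightarrow> jet \<Rightarrow> real" where
  "characteristic Q j = veta Q j - vtau Q j * jut j - vxi Q j * jux j"

definition pr_t :: "vfield \<Rightarrow> jet \<Rightarrow> real" where
  "pr_t Q j = D_t (veta Q) j - jut j * D_t (vtau Q) j - jux j * D_t (vxi Q) j"

definition pr_x :: "vfield \<Rightarrow> jet \<Rightarrow> real" where
  "pr_x Q j = D_x (veta Q) j - jut j * D_x (vtau Q) j - jux j * D_x (vxi Q) j"

definition pr_tt :: "vfield \<Rightarrow> jet \<Rightarrow> real" where
  "pr_tt Q j = D_t (pr_t Q) j - jutt j * D_t (vtau Q) j - jutx j * D_t (vxi Q) j"

definition pr_tx :: "vfield \<Rightarrow> jet \<Rightarrow> real" where
  "pr_tx Q j = D_x (pr_t Q) j - jutt j * D_x (vtau Q) j - jutx j * D_x (vxi Q) j"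

definition pr_xx :: "vfield \<Rightarrow> jet \<Rightarrow> real" where
  "pr_xx Q j = D_x (pr_x Q) j - jutx j * D_x (vtau Q) j - juxx j * D_x (vxi Q) j"

text \<open>The derivative of \<open>F\<close> along the second prolongation of \<open>Q\<close>.\<close>

definition prolong2 :: "vfield \<Rightarrow> (jet \<Rightarrow> real) \<Rightarrow> jet \<Rightarrow> real" where
  "prolong2 Q F j =
     vtau Q j * pd_t F j + vxi Q j * pd_x F j + veta Q j * pd_u F j
     + pr_t Q j * pd_ut F j + pr_x Q j * pd_ux F j
     + pr_tt Q j * pd_utt F j + pr_tx Q j * pd_utx F j + pr_xx Q j * pd_uxx F j"


section \<open>The class of equations and its symmetries\<close>

definition L :: "(real \<Rightarrow> real) \<Rightarrow> jet \<Rightarrow> real" where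
  "L k j = jut j - juxx j - k (jx j) * (ju j)\<^sup>2 * (1 - ju j)"

definition lie_symmetry :: "(real \<Rightarrow> real) \<Rightarrow> (real \<times> real \<times> real) set \<Rightarrow> vfield \<Rightarrow> bool" where
  "lie_symmetry k \<Omega> V \<longleftrightarrow>
     smooth_on \<Omega> V \<and> (\<forall>j. base j \<in> \<Omega> \<and> L k j = 0 \<longrightarrow> prolong2 V (L k) j = 0)"

definition nonclassical_symmetry ::
    "(real \<Rightarrow> real) \<Rightarrow> (real \<times> real \<times> real) set \<Rightarrow> vfield \<Rightarrow> bool" where
  "nonclassical_symmetry k \<Omega> Q \<longleftrightarrow>
     smooth_on \<Omega> Q \<and>
     (\<forall>p\<in>\<Omega>. (fst (Q p), fst (snd (Q p))) \<noteq> (0, 0)) \<and>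
     (\<forall>j. base j \<in> \<Omega> \<and> L k j = 0 \<and>
          characteristic Q j = 0 \<and> D_t (characteristic Q) j = 0 \<and> D_x (characteristic Q) j = 0 \<longrightarrow>
          prolong2 Q (L k) j = 0)"

definition equivalent_to_lie ::
    "(real \<Rightarrow> real) \<Rightarrow> (real \<times> real \<times> real) set \<Rightarrow> vfield \<Rightarrow> bool" where
  "equivalent_to_lie k \<Omega> Q \<longleftrightarrow>
     (\<exists>\<mu> V. smooth_on \<Omega> \<mu> \<and> (\<forall>p\<in>\<Omega>. \<mu> p \<noteq> 0) \<and>
            lie_symmetry k \<Omega> V \<and> (\<forall>p\<in>\<Omega>. Q p = (\<mu> p :: real) *\<^sub>R V p))"


section \<open>Pairs and their equivalence\<close>

text \<open>
  A pair of a coefficient and a vector field, together with the intervals for \<open>t\<close>, \<open>x\<close>, \<open>u\<close> on which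
  it is considered.  Both functions are total in the logic; only their values on these intervals matter.
\<close>

record kq_pair =
  t_dom :: "real set"
  x_dom :: "real set"
  u_dom :: "real set"
  coef :: "real \<Rightarrow> real"
  oper :: vfield

definition dom3 :: "kq_pair \<Rightarrow> (real \<times> real \<times> real) set" where
  "dom3 P = t_dom P \<times> x_dom P \<times> u_dom P"

definition interval_domains :: "kq_pair \<Rightarrow> bool" where
  "interval_domains P \<longleftrightarrow>
     open_interval (t_dom P) \<and> open_interval (x_dom P) \<and> open_interval (u_dom P)"

definition non_lie_pair :: "kq_pair \<Rightarrow> bool" where
  "non_lie_pair P \<longleftrightarrow>
     interval_domains P \<and>
     smooth_on (x_dom P) (coef P) \<and> (\<forall>x\<in>x_dom P. coef P x \<noteq> 0) \<and>
     (\<forall>p\<in>dom3 P. fst (oper P p) = 1) \<and>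
     nonclassical_symmetry (coef P) (dom3 P) (oper P) \<and>
     \<not> equivalent_to_lie (coef P) (dom3 P) (oper P)"

definition G_map :: "real \<Rightarrow> real \<Rightarrow> real \<Rightarrow> real \<times> real \<times> real \<Rightarrow> real \<times> real \<times> real" where
  "G_map \<epsilon>1 \<epsilon>2 \<epsilon>3 = (\<lambda>(t, x, u). (\<epsilon>1\<^sup>2 * t + \<epsilon>2, \<epsilon>1 * x + \<epsilon>3, u))"

definition G_equivalent :: "kq_pair \<Rightarrow> kq_pair \<Rightarrow> bool" where
  "G_equivalent P P' \<longleftrightarrow>
     (\<exists>\<epsilon>1 \<epsilon>2 \<epsilon>3 \<mu>. \<epsilon>1 \<noteq> 0 \<and>
        t_dom P' = (\<lambda>t. \<epsilon>1\<^sup>2 * t + \<epsilon>2) ` t_dom P \<and>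
        x_dom P' = (\<lambda>x. \<epsilon>1 * x + \<epsilon>3) ` x_dom P \<and>
        u_dom P' = u_dom P \<and>
        (\<forall>x\<in>x_dom P. coef P' (\<epsilon>1 * x + \<epsilon>3) = coef P x / \<epsilon>1\<^sup>2) \<and>
        smooth_on (dom3 P) \<mu> \<and> (\<forall>p\<in>dom3 P. \<mu> p \<noteq> 0) \<and>
        (\<forall>p\<in>dom3 P. oper P' (G_map \<epsilon>1 \<epsilon>2 \<epsilon>3 p) =
           (\<mu> p :: real) *\<^sub>R frechet_derivative (G_map \<epsilon>1 \<epsilon>2 \<epsilon>3) (at p) (oper P p)))"


section \<open>The list\<close>

definition coth :: "real \<Rightarrow> real" where
  "coth x = cosh x / sinh x"

text \<open>
  \<open>agrees P k \<xi> \<eta>\<close>: on its domain, \<open>P\<close> is the pair \<open>(k, \<partial>\<^sub>t + \<xi> \<partial>\<^sub>x + \<eta> \<partial>\<^sub>u)\<close>.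
\<close>

definition agrees ::
    "kq_pair \<Rightarrow> (real \<Rightarrow> real) \<Rightarrow> (real \<Rightarrow> real \<Rightarrow> real) \<Rightarrow> (real \<Rightarrow> real \<Rightarrow> real) \<Rightarrow> bool" where
  "agrees P k \<xi> \<eta> \<longleftrightarrow>
     (\<forall>x\<in>x_dom P. coef P x = k x) \<and>
     (\<forall>(t, x, u)\<in>dom3 P. oper P (t, x, u) = (1, \<xi> x u, \<eta> x u))"

text \<open>
  Division by zero is total in the logic, so the conditions that the expressions are defined and that
  the coefficient does not vanish are stated explicitly.
\<close>

definition listed :: "kq_pair \<Rightarrow> bool" where
  "listed P \<longleftrightarrow> interval_domains P \<and>
    ((\<exists>c. c \<noteq> 0 \<and> (\<forall>x\<in>x_dom P. sin x \<noteq> 0 \<and> cos x \<noteq> 0) \<and>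
        agrees P (\<lambda>x. c * (tan x)\<^sup>2) (\<lambda>x u. - cot x) (\<lambda>x u. 0)) \<or>
     (\<exists>c. c \<noteq> 0 \<and> 0 \<notin> x_dom P \<and>
        agrees P (\<lambda>x. c * (tanh x)\<^sup>2) (\<lambda>x u. - coth x) (\<lambda>x u. 0)) \<or>
     (\<exists>c. c \<noteq> 0 \<and> 0 \<notin> x_dom P \<and>
        agrees P (\<lambda>x. c * (coth x)\<^sup>2) (\<lambda>x u. - tanh x) (\<lambda>x u. 0)) \<or>
     (\<exists>c. c \<noteq> 0 \<and> 0 \<notin> x_dom P \<and>
        agrees P (\<lambda>x. c * x\<^sup>2) (\<lambda>x u. - (1 / x)) (\<lambda>x u. 0)) \<or>
     (\<exists>c s. c > 0 \<and> s \<in> {1, - 1} \<and>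
        agrees P (\<lambda>x. c\<^sup>2 / 2) (\<lambda>x u. s * (c / 2) * (3 * u - 1))
          (\<lambda>x u. - (3 * c\<^sup>2 / 4) * u\<^sup>2 * (u - 1))) \<or>
     (0 \<notin> x_dom P \<and>
        agrees P (\<lambda>x. 2 / x\<^sup>2) (\<lambda>x u. 3 / x * (u - 1)) (\<lambda>x u. - (3 / x\<^sup>2) * u * (u - 1)\<^sup>2)))"

end

theory Submission
  imports Defs
begin

text \<open>
  The determining equations of \<open>\<partial>\<^sub>t + \<xi> \<partial>\<^sub>x + \<eta> \<partial>\<^sub>u\<close> force \<open>\<xi> = a u + b\<close> and
  \<open>\<eta> = - a\<^sup>2 u\<^sup>3 / 3 + (a\<^sub>x - a b) u\<^sup>2 + m u + n\<close> with \<open>a (9 k - 2 a\<^sup>2) = 0\<close>, so \<open>a\<close> vanishes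
  identically or nowhere.

  If \<open>a = 0\<close>, then \<open>m = n = 0\<close>, \<open>b\<^sup>2 k\<close> does not depend on \<open>x\<close> and \<open>b\<^sub>t = b\<^sub>x\<^sub>x - 2 b b\<^sub>x\<close>. Hence
  \<open>b = s(t) \<phi>(x)\<close>; either \<open>\<phi>\<close> and \<open>1 / s\<close> are affine and the operator is a Lie symmetry up to the
  factor \<open>s\<close>, or \<open>s = 1\<close> and \<open>\<phi>' = \<phi>\<^sup>2 + \<kappa>\<close>, whose solutions give the cases 1--4.

  If \<open>a \<noteq> 0\<close>, then \<open>a\<close>, \<open>b\<close>, \<open>m\<close>, \<open>n\<close> are functions of \<open>x\<close> expressed by \<open>h = 3 / a\<close> and its
  derivatives, and two ordinary differential equations for \<open>h\<close> remain. They yield a polynomial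
  relation between \<open>h'\<close>, \<open>h h''\<close> and \<open>h\<^sup>2 h'''\<close>; a combination of this relation with its first five
  derivatives is \<open>h' (h' - 1)\<^sup>3 = 0\<close>, so \<open>h\<close> is constant or a translate of \<open>x\<close>, which are the cases
  5 and 6.

  Conversely, a Lie symmetry has \<open>\<tau> = \<tau>(t)\<close>, \<open>\<xi>\<^sub>u = 0\<close> and \<open>\<tau>\<^sub>t = 2 \<xi>\<^sub>x\<close>, so for an operator with
  \<open>\<tau> = 1\<close> equivalent to it \<open>\<xi>\<^sub>x\<close> would depend on \<open>t\<close> alone; this fails for every listed operator.
\<close>

section \<open>Calculus of smooth functions\<close>

text \<open>\<open>G_equivalent\<close> carries the three intervals onto those of the listed pair,
  so no argument may shrink the domain to a place where some function is nonzero. Each alternative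
  is decided on the whole interval or box: a continuous function with finitely many values is
  constant on a connected set (this settles \<open>a\<close>, the factor \<open>s\<close> and h'),
  and a solution of a homogeneous linear equation that has one zero vanishes identically (this
  settles \<phi>^2 + \<kappa> and again \<open>s\<close>). The equations for h are never solved.
  Scaling of x belongs to the equivalence group, so they can be expressed by the weight-zero
  quantities p = h', g = h h'', l = h^2 h''', on which D = h d/dx acts polynomially. Every
  derivative of the final relation is again a polynomial relation between three numbers, and the
  classification becomes an ideal membership, checked by expanding one identity. The factors p and p
  - 1 of the result are the two admissible profiles.\<close>

lemma Ck_on_cong:
  assumes "open S" "\<And>x. x \<in> S \<Longrightarrow> f x = g x"
  shows "Ck_on n S f \<longleftrightarrow> Ck_on n S g"
  using assms(2)
proof (induction n arbitrary: f g)
  case 0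
  then show ?case using continuous_on_cong[OF refl, of S f g] by simp
next
  case (Suc n)
  have d: "(f has_derivative D) (at x) \<longleftrightarrow> (g has_derivative D) (at x)" if "x \<in> S" for x D
    using has_derivative_transform_within_open[OF _ assms(1) that, of f D UNIV g]
      has_derivative_transform_within_open[OF _ assms(1) that, of g D UNIV f] Suc.prems by auto
  then have "frechet_derivative f (at x) = frechet_derivative g (at x)" if "x \<in> S" for x
    unfolding frechet_derivative_def using that by simp
  then have "Ck_on n S (\<lambda>x. frechet_derivative f (at x) v) \<longleftrightarrow>
      Ck_on n S (\<lambda>x. frechet_derivative g (at x) v)" for v
    by (intro Suc.IH) simp
  moreover have "f differentiable at x \<longleftrightarrow> g differentiable at x" if "x \<in> S" for x
    unfolding differentiable_def using d[OF that] by blast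
  ultimately show ?case by simp
qed

text \<open>\<open>Ck_on\<close> is phrased with the chosen \<open>frechet_derivative\<close>; on an
  open set any explicit family of derivatives may stand in for it. Most closure properties below are
  inductions on the order whose step is this rule.\<close>

lemma Ck_on_SucI:
  assumes "open S" "\<And>x. x \<in> S \<Longrightarrow> (f has_derivative D x) (at x)"
    and "\<And>v. Ck_on n S (\<lambda>x. D x v)"
  shows "Ck_on (Suc n) S f"
proof -
  have "frechet_derivative f (at x) = D x" if "x \<in> S" for x
    using frechet_derivative_at[OF assms(2)[OF that]] by simp
  then have "Ck_on n S (\<lambda>x. frechet_derivative f (at x) v)" for v
    using Ck_on_cong[OF assms(1), of "\<lambda>x. frechet_derivative f (at x) v" "\<lambda>x. D x v" n] assms(3)
    by simp
  then show ?thesis using assms(2) by (auto simp: differentiable_def)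
qed

lemma Ck_on_SucD: "Ck_on (Suc n) S f \<Longrightarrow> Ck_on n S f"
proof (induction n arbitrary: f)
  case 0
  then show ?case
    by (simp add: continuous_at_imp_continuous_on differentiable_imp_continuous_within)
next
  case (Suc n)
  show ?case using Suc.prems Suc.IH by (metis Ck_on.simps(2))
qed

lemma Ck_on_has_derivative:
  assumes "Ck_on (Suc n) S f" "x \<in> S"
  shows "(f has_derivative frechet_derivative f (at x)) (at x)"
  using assms by (simp flip: frechet_derivative_works)

lemma Ck_on_const: "Ck_on n S (\<lambda>x. c)"
proof (induction n arbitrary: c)
  case (Suc n)
  then show ?case by (simp add: frechet_derivative_const)
qed simp

lemma Ck_on_bounded_linear:
  assumes "open S" "bounded_linear f"
  shows "Ck_on n S f"
proof (cases n)
  case 0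
  then show ?thesis
    using assms(2) by (simp add: linear_continuous_on)
next
  case (Suc m)
  show ?thesis unfolding Suc
    by (rule Ck_on_SucI[OF assms(1) bounded_linear_imp_has_derivative[OF assms(2)] Ck_on_const])
qed

lemma Ck_on_linear_comp:
  assumes "open S" "bounded_linear h" "Ck_on n S f"
  shows "Ck_on n S (\<lambda>x. h (f x))"
  using assms(3)
proof (induction n arbitrary: f)
  case 0
  then show ?case
    using bounded_linear.continuous_on[OF assms(2)] by simp
next
  case (Suc n)
  have "Ck_on n S (\<lambda>x. h (frechet_derivative f (at x) v))" for v
    using Suc by simp
  with bounded_linear.has_derivative[OF assms(2) Ck_on_has_derivative[OF Suc.prems]]
  show ?case by (rule Ck_on_SucI[OF assms(1)])
qed

text \<open>For an affine inner map the directional derivative of the composite along v is that of f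
  along B v, composed with the same map, so the induction closes. Slices and sections of functions
  on the box are compositions of this kind.\<close>

lemma Ck_on_affine_comp:
  assumes "open S" "bounded_linear B" "\<And>x. x \<in> S \<Longrightarrow> B x + c \<in> S'" "Ck_on n S' f"
  shows "Ck_on n S (\<lambda>x. f (B x + c))"
  using assms(4)
proof (induction n arbitrary: f)
  case 0
  have "continuous_on S (\<lambda>x. B x + c)"
    using assms(2) by (intro continuous_intros linear_continuous_on)
  with 0 show ?case
    using assms(3) by (auto intro!: continuous_on_compose2[of S' f S])
next
  case (Suc n)
  have "Ck_on n S (\<lambda>x. frechet_derivative f (at (B x + c)) (B v))" for v
    using Suc.IH[of "\<lambda>y. frechet_derivative f (at y) (B v)"] Suc.prems by simp
  moreover have "((\<lambda>x. f (B x + c)) has_derivative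
      (\<lambda>v. frechet_derivative f (at (B x + c)) (B v))) (at x)" if "x \<in> S" for x
    using has_derivative_compose[OF has_derivative_add_const[OF
        bounded_linear_imp_has_derivative[OF assms(2)]] Ck_on_has_derivative[OF Suc.prems assms(3)[OF that]]] .
  ultimately show ?case by (intro Ck_on_SucI[OF assms(1)])
qed

lemma Ck_on_add:
  assumes "open S" "Ck_on n S f" "Ck_on n S g"
  shows "Ck_on n S (\<lambda>x. f x + g x)"
  using assms(2,3)
proof (induction n arbitrary: f g)
  case 0
  then show ?case by (simp add: continuous_on_add)
next
  case (Suc n)
  have "Ck_on n S (\<lambda>x. frechet_derivative f (at x) v + frechet_derivative g (at x) v)" for v
    using Suc by simp
  with has_derivative_add[OF Ck_on_has_derivative[OF Suc.prems(1)] Ck_on_has_derivative[OF Suc.prems(2)]]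
  show ?case by (rule Ck_on_SucI[OF assms(1)])
qed

lemma Ck_on_mult:
  fixes f g :: "'a::real_normed_vector \<Rightarrow> 'b::real_normed_algebra"
  assumes "open S" "Ck_on n S f" "Ck_on n S g"
  shows "Ck_on n S (\<lambda>x. f x * g x)"
  using assms(2,3)
proof (induction n arbitrary: f g)
  case 0
  then show ?case by (simp add: continuous_on_mult)
next
  case (Suc n)
  have "Ck_on n S (\<lambda>x. f x * frechet_derivative g (at x) v + frechet_derivative f (at x) v * g x)" for v
    using Suc.prems Suc.prems[THEN Ck_on_SucD]
    by (intro Ck_on_add[OF assms(1)] Suc.IH) simp_all
  with has_derivative_mult[OF Ck_on_has_derivative[OF Suc.prems(1)] Ck_on_has_derivative[OF Suc.prems(2)]]
  show ?case by (rule Ck_on_SucI[OF assms(1)])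
qed

lemma Ck_on_minus:
  assumes "open S" "Ck_on n S f"
  shows "Ck_on n S (\<lambda>x. - f x)"
  by (rule Ck_on_linear_comp[OF assms(1) bounded_linear_minus[OF bounded_linear_ident] assms(2)])

lemma Ck_on_inverse:
  fixes f :: "'a::real_normed_vector \<Rightarrow> 'b::real_normed_field"
  assumes "open S" "Ck_on n S f" "\<And>x. x \<in> S \<Longrightarrow> f x \<noteq> 0"
  shows "Ck_on n S (\<lambda>x. inverse (f x))"
  using assms(2)
proof (induction n)
  case 0
  then show ?case using assms(3) by (simp add: continuous_on_inverse)
next
  case (Suc n)
  have "Ck_on n S (\<lambda>x. - (inverse (f x) * frechet_derivative f (at x) v * inverse (f x)))" for v
    using Suc Ck_on_SucD[OF Suc.prems]
    by (intro Ck_on_minus Ck_on_mult assms(1)) simp_all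
  with Deriv.has_derivative_inverse[OF assms(3) Ck_on_has_derivative[OF Suc.prems]]
  show ?case by (rule Ck_on_SucI[OF assms(1)])
qed

lemma Ck_on_Pair:
  assumes "open S" "Ck_on n S f" "Ck_on n S g"
  shows "Ck_on n S (\<lambda>x. (f x, g x))"
  using assms(2,3)
proof (induction n arbitrary: f g)
  case 0
  then show ?case by (simp add: continuous_on_Pair)
next
  case (Suc n)
  have "Ck_on n S (\<lambda>x. (frechet_derivative f (at x) v, frechet_derivative g (at x) v))" for v
    using Suc by simp
  with has_derivative_Pair[OF Ck_on_has_derivative[OF Suc.prems(1)] Ck_on_has_derivative[OF Suc.prems(2)]]
  show ?case by (rule Ck_on_SucI[OF assms(1)])
qed

lemma smooth_on_cong:
  assumes "open S" "\<And>x. x \<in> S \<Longrightarrow> f x = g x"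
  shows "smooth_on S f \<longleftrightarrow> smooth_on S g"
  unfolding smooth_on_def using Ck_on_cong[OF assms] by simp

lemma smooth_on_has_derivative:
  assumes "smooth_on S f" "x \<in> S"
  shows "(f has_derivative frechet_derivative f (at x)) (at x)"
  using assms Ck_on_has_derivative unfolding smooth_on_def by blast

lemma smooth_on_frechet_derivative:
  assumes "smooth_on S f"
  shows "smooth_on S (\<lambda>x. frechet_derivative f (at x) v)"
  using assms unfolding smooth_on_def by (metis Ck_on.simps(2))

lemma smooth_on_continuous: "smooth_on S f \<Longrightarrow> continuous_on S f"
  unfolding smooth_on_def by (metis Ck_on.simps(1))

lemma smooth_on_const: "smooth_on S (\<lambda>x. c)"
  by (simp add: smooth_on_def Ck_on_const)

lemma smooth_on_bounded_linear: "open S \<Longrightarrow> bounded_linear f \<Longrightarrow> smooth_on S f"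
  by (simp add: smooth_on_def Ck_on_bounded_linear)

lemma smooth_on_linear_comp:
  "open S \<Longrightarrow> bounded_linear h \<Longrightarrow> smooth_on S f \<Longrightarrow> smooth_on S (\<lambda>x. h (f x))"
  by (simp add: smooth_on_def Ck_on_linear_comp)

lemma smooth_on_affine_comp:
  assumes "open S" "bounded_linear B" "\<And>x. x \<in> S \<Longrightarrow> B x + c \<in> S'" "smooth_on S' f"
  shows "smooth_on S (\<lambda>x. f (B x + c))"
  using assms Ck_on_affine_comp unfolding smooth_on_def by blast

lemma smooth_on_add:
  "open S \<Longrightarrow> smooth_on S f \<Longrightarrow> smooth_on S g \<Longrightarrow> smooth_on S (\<lambda>x. f x + g x)"
  by (simp add: smooth_on_def Ck_on_add)

lemma smooth_on_minus: "open S \<Longrightarrow> smooth_on S f \<Longrightarrow> smooth_on S (\<lambda>x. - f x)"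
  by (simp add: smooth_on_def Ck_on_minus)

lemma smooth_on_diff:
  "open S \<Longrightarrow> smooth_on S f \<Longrightarrow> smooth_on S g \<Longrightarrow> smooth_on S (\<lambda>x. f x - g x)"
  using smooth_on_add[OF _ _ smooth_on_minus, of S f g] by simp

lemma smooth_on_mult:
  fixes f g :: "'a::real_normed_vector \<Rightarrow> 'b::real_normed_algebra"
  shows "open S \<Longrightarrow> smooth_on S f \<Longrightarrow> smooth_on S g \<Longrightarrow> smooth_on S (\<lambda>x. f x * g x)"
  by (simp add: smooth_on_def Ck_on_mult)

lemma smooth_on_power:
  fixes f :: "'a::real_normed_vector \<Rightarrow> 'b::real_normed_algebra_1"
  shows "open S \<Longrightarrow> smooth_on S f \<Longrightarrow> smooth_on S (\<lambda>x. f x ^ n)"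
  by (induction n) (simp_all add: smooth_on_const smooth_on_mult)

lemma smooth_on_divide:
  fixes f g :: "'a::real_normed_vector \<Rightarrow> 'b::real_normed_field"
  shows "open S \<Longrightarrow> smooth_on S f \<Longrightarrow> smooth_on S g \<Longrightarrow> (\<And>x. x \<in> S \<Longrightarrow> g x \<noteq> 0) \<Longrightarrow>
    smooth_on S (\<lambda>x. f x / g x)"
  unfolding divide_inverse by (intro smooth_on_mult) (auto simp: smooth_on_def Ck_on_inverse)

lemma smooth_on_Pair:
  "open S \<Longrightarrow> smooth_on S f \<Longrightarrow> smooth_on S g \<Longrightarrow> smooth_on S (\<lambda>x. (f x, g x))"
  by (simp add: smooth_on_def Ck_on_Pair)

text \<open>Covers \<open>tan\<close>, \<open>cot\<close>, \<open>tanh\<close> and \<open>coth\<close> of a linear form without composition of smooth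
  functions: the derivative is a polynomial in the function itself.\<close>

lemma smooth_on_riccati:
  fixes f :: "'a::real_normed_vector \<Rightarrow> real"
  assumes "open S"
    and D: "\<And>x. x \<in> S \<Longrightarrow> (f has_derivative (\<lambda>v. (\<alpha> + \<beta> * (f x)\<^sup>2) * l v)) (at x)"
  shows "smooth_on S f"
proof -
  have "Ck_on n S f" for n
  proof (induction n)
    case 0
    show ?case using has_derivative_continuous[OF D]
      by (simp add: continuous_at_imp_continuous_on)
  next
    case (Suc n)
    show ?case unfolding power2_eq_square
      by (intro Ck_on_SucI[OF assms(1) D[unfolded power2_eq_square]] Ck_on_mult Ck_on_add Ck_on_const
          assms(1) Suc)
  qed
  then show ?thesis by (simp add: smooth_on_def)
qed

lemmas smooth_intros = smooth_on_const smooth_on_add smooth_on_minus smooth_on_diff smooth_on_mult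
  smooth_on_power smooth_on_divide smooth_on_Pair

section \<open>The prolongation in terms of partial derivatives\<close>

text \<open>Here \<open>fxu\<close> is \<open>\<partial>\<^sub>u \<partial>\<^sub>x f\<close> and \<open>fux\<close> is \<open>\<partial>\<^sub>x \<partial>\<^sub>u f\<close>; keeping both apart avoids appealing to the
  symmetry of second derivatives.\<close>

definition has_partials where
  "has_partials \<Omega> f ft fx fu fxx fxu fux fuu \<longleftrightarrow> (\<forall>t x u. (t, x, u) \<in> \<Omega> \<longrightarrow>
     ((\<lambda>s. f s x u) has_field_derivative (ft t x u :: real)) (at t) \<and>
     ((\<lambda>s. f t s u) has_field_derivative fx t x u) (at x) \<and>
     ((\<lambda>s. f t x s) has_field_derivative fu t x u) (at u) \<and>
     ((\<lambda>s. fx t s u) has_field_derivative fxx t x u) (at x) \<and>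
     ((\<lambda>s. fx t x s) has_field_derivative fxu t x u) (at u) \<and>
     ((\<lambda>s. fu t s u) has_field_derivative fux t x u) (at x) \<and>
     ((\<lambda>s. fu t x s) has_field_derivative fuu t x u) (at u))"

lemma eventually_slice:
  fixes t :: "'a::topological_space" and x :: "'b::topological_space" and u :: "'c::topological_space"
  assumes "open \<Omega>" "(t, x, u) \<in> \<Omega>"
  shows "\<forall>\<^sub>F s in nhds t. (s, x, u) \<in> \<Omega>" "\<forall>\<^sub>F s in nhds x. (t, s, u) \<in> \<Omega>"
    "\<forall>\<^sub>F s in nhds u. (t, x, s) \<in> \<Omega>"
  by (rule topological_tendstoD[OF _ assms], intro tendsto_intros filterlim_ident)+

text \<open>Coefficients are known on \<Omega> only, while \<open>D_t\<close> and \<open>D_x\<close>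
  differentiate functions of all jets. The derivatives in t, x, u see only jets whose base point
  stays in the open set, and those in u_t, u_x do not move the base point.\<close>

lemma total_derivative_cong:
  assumes "open \<Omega>" "base j \<in> \<Omega>" and eq: "\<And>j. base j \<in> \<Omega> \<Longrightarrow> F j = G j"
  shows "D_t F j = D_t G j" "D_x F j = D_x G j"
proof -
  note ev = eventually_slice[OF assms(1) assms(2)[unfolded base_def]]
  have "pd_t F j = pd_t G j" unfolding pd_t_def
    by (rule deriv_cong_ev[OF eventually_mono[OF ev(1)] refl]) (simp add: eq base_def)
  moreover have "pd_x F j = pd_x G j" unfolding pd_x_def
    by (rule deriv_cong_ev[OF eventually_mono[OF ev(2)] refl]) (simp add: eq base_def)
  moreover have "pd_u F j = pd_u G j" unfolding pd_u_def
    by (rule deriv_cong_ev[OF eventually_mono[OF ev(3)] refl]) (simp add: eq base_def)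
  moreover have "base (j\<lparr>jut := s\<rparr>) = base j" "base (j\<lparr>jux := s\<rparr>) = base j" for s
    by (simp_all add: base_def)
  then have "pd_ut F j = pd_ut G j" "pd_ux F j = pd_ux G j"
    using eq assms(2) by (simp_all add: pd_ut_def pd_ux_def)
  ultimately show "D_t F j = D_t G j" "D_x F j = D_x G j" by (simp_all add: D_t_def D_x_def)
qed

lemma total_derivative_base:
  assumes "open \<Omega>" "base j \<in> \<Omega>"
    and F: "\<And>j. base j \<in> \<Omega> \<Longrightarrow> F j = f (jt j) (jx j) (ju j)"
    and f: "has_partials \<Omega> f ft fx fu fxx fxu fux fuu"
  shows "D_t F j = ft (jt j) (jx j) (ju j) + jut j * fu (jt j) (jx j) (ju j)"
    and "D_x F j = fx (jt j) (jx j) (ju j) + jux j * fu (jt j) (jx j) (ju j)"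
proof -
  note d = f[unfolded has_partials_def, rule_format, OF assms(2)[unfolded base_def], THEN conjunct1, THEN DERIV_imp_deriv]
    f[unfolded has_partials_def, rule_format, OF assms(2)[unfolded base_def], THEN conjunct2, THEN conjunct1, THEN DERIV_imp_deriv]
    f[unfolded has_partials_def, rule_format, OF assms(2)[unfolded base_def], THEN conjunct2, THEN conjunct2, THEN conjunct1, THEN DERIV_imp_deriv]
  let ?G = "\<lambda>j. f (jt j) (jx j) (ju j)"
  have "D_t F j = D_t ?G j" "D_x F j = D_x ?G j"
    by (rule total_derivative_cong[OF assms(1,2) F], assumption)+
  then show "D_t F j = ft (jt j) (jx j) (ju j) + jut j * fu (jt j) (jx j) (ju j)"
    and "D_x F j = fx (jt j) (jx j) (ju j) + jux j * fu (jt j) (jx j) (ju j)"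
    by (simp_all add: D_t_def D_x_def pd_t_def pd_x_def pd_u_def pd_ut_def pd_ux_def d)
qed

text \<open>Coefficients and partial derivatives are parameters, tied to V by an equation on
  \<Omega>. One field can thus be interpreted several times with increasingly explicit coefficients,
  which is how the form of \<xi> and \<eta> is uncovered later.\<close>

locale vector_field =
  fixes \<Omega> :: "(real \<times> real \<times> real) set" and V :: vfield and k kx :: "real \<Rightarrow> real"
    and \<tau> \<tau>t \<tau>x \<tau>u \<tau>xx \<tau>xu \<tau>ux \<tau>uu \<xi> \<xi>t \<xi>x \<xi>u \<xi>xx \<xi>xu \<xi>ux \<xi>uu
      \<eta> \<eta>t \<eta>x \<eta>u \<eta>xx \<eta>xu \<eta>ux \<eta>uu :: "real \<Rightarrow> real \<Rightarrow> real \<Rightarrow> real"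
  assumes open_dom: "open \<Omega>"
    and V_eq: "\<And>t x u. (t, x, u) \<in> \<Omega> \<Longrightarrow> V (t, x, u) = (\<tau> t x u, \<xi> t x u, \<eta> t x u)"
    and k_deriv: "\<And>t x u. (t, x, u) \<in> \<Omega> \<Longrightarrow> (k has_field_derivative kx x) (at x)"
    and \<tau>: "has_partials \<Omega> \<tau> \<tau>t \<tau>x \<tau>u \<tau>xx \<tau>xu \<tau>ux \<tau>uu"
    and \<xi>: "has_partials \<Omega> \<xi> \<xi>t \<xi>x \<xi>u \<xi>xx \<xi>xu \<xi>ux \<xi>uu"
    and \<eta>: "has_partials \<Omega> \<eta> \<eta>t \<eta>x \<eta>u \<eta>xx \<eta>xu \<eta>ux \<eta>uu"
begin

lemma components:
  assumes "base j \<in> \<Omega>"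
  shows "vtau V j = \<tau> (jt j) (jx j) (ju j)" "vxi V j = \<xi> (jt j) (jx j) (ju j)"
    "veta V j = \<eta> (jt j) (jx j) (ju j)"
  using V_eq assms by (simp_all add: vtau_def vxi_def veta_def base_def)

lemmas D_components = total_derivative_base[OF open_dom _ components(1) \<tau>]
  total_derivative_base[OF open_dom _ components(2) \<xi>]
  total_derivative_base[OF open_dom _ components(3) \<eta>]


lemma pr_t_pr_x:
  assumes "base j \<in> \<Omega>"
  shows "pr_t V j = (\<lambda>(t, x, u) ut p. \<eta>t t x u + ut * \<eta>u t x u - ut * (\<tau>t t x u + ut * \<tau>u t x u)
      - p * (\<xi>t t x u + ut * \<xi>u t x u)) (base j) (jut j) (jux j)"
    and "pr_x V j = (\<lambda>(t, x, u) ut p. \<eta>x t x u + p * \<eta>u t x u - ut * (\<tau>x t x u + p * \<tau>u t x u)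
      - p * (\<xi>x t x u + p * \<xi>u t x u)) (base j) (jut j) (jux j)"
  unfolding pr_t_def pr_x_def using D_components[OF assms] by (simp_all add: base_def)

text \<open>\<open>pr_x\<close> has order one, so \<open>D_x\<close>, which ignores second-order
  variables in its argument, is the true total derivative here. The jet is an explicit record so
  that updates of its fields simplify.\<close>

lemma D_x_pr_x:
  assumes "(t, x, u) \<in> \<Omega>"
    and "j = \<lparr>jt = t, jx = x, ju = u, jut = ut, jux = p, jutt = utt, jutx = utx, juxx = uxx\<rparr>"
  shows "D_x (pr_x V) j =
      \<eta>xx t x u + p * \<eta>ux t x u - ut * (\<tau>xx t x u + p * \<tau>ux t x u) - p * (\<xi>xx t x u + p * \<xi>ux t x u)
      + p * (\<eta>xu t x u + p * \<eta>uu t x u - ut * (\<tau>xu t x u + p * \<tau>uu t x u)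
        - p * (\<xi>xu t x u + p * \<xi>uu t x u))
      - utx * (\<tau>x t x u + p * \<tau>u t x u)
      + uxx * (\<eta>u t x u - ut * \<tau>u t x u - \<xi>x t x u - 2 * p * \<xi>u t x u)"
proof -
  have j: "base j \<in> \<Omega>" using assms by (simp add: base_def)
  note \<tau>' = \<tau>[unfolded has_partials_def, rule_format, OF assms(1)]
  note \<xi>' = \<xi>[unfolded has_partials_def, rule_format, OF assms(1)]
  note \<eta>' = \<eta>[unfolded has_partials_def, rule_format, OF assms(1)]
  have "((\<lambda>s. \<eta>x t s u + p * \<eta>u t s u - ut * (\<tau>x t s u + p * \<tau>u t s u)
      - p * (\<xi>x t s u + p * \<xi>u t s u)) has_field_derivative
      \<eta>xx t x u + p * \<eta>ux t x u - ut * (\<tau>xx t x u + p * \<tau>ux t x u) - p * (\<xi>xx t x u + p * \<xi>ux t x u)) (at x)"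
    using \<tau>' \<xi>' \<eta>' by (auto intro!: derivative_eq_intros simp: algebra_simps)
  note dx = this[THEN DERIV_imp_deriv]
  have "((\<lambda>s. \<eta>x t x s + p * \<eta>u t x s - ut * (\<tau>x t x s + p * \<tau>u t x s)
      - p * (\<xi>x t x s + p * \<xi>u t x s)) has_field_derivative
      \<eta>xu t x u + p * \<eta>uu t x u - ut * (\<tau>xu t x u + p * \<tau>uu t x u) - p * (\<xi>xu t x u + p * \<xi>uu t x u)) (at u)"
    using \<tau>' \<xi>' \<eta>' by (auto intro!: derivative_eq_intros simp: algebra_simps)
  note du = this[THEN DERIV_imp_deriv]
  have "((\<lambda>s. \<eta>x t x u + p * \<eta>u t x u - s * (\<tau>x t x u + p * \<tau>u t x u)
      - p * (\<xi>x t x u + p * \<xi>u t x u)) has_field_derivative - (\<tau>x t x u + p * \<tau>u t x u)) (at ut)"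
    by (auto intro!: derivative_eq_intros)
  note dut = this[THEN DERIV_imp_deriv]
  have "((\<lambda>s. \<eta>x t x u + s * \<eta>u t x u - ut * (\<tau>x t x u + s * \<tau>u t x u)
      - s * (\<xi>x t x u + s * \<xi>u t x u)) has_field_derivative
      \<eta>u t x u - ut * \<tau>u t x u - \<xi>x t x u - 2 * p * \<xi>u t x u) (at p)"
    by (auto intro!: derivative_eq_intros simp: algebra_simps)
  note dp = this[THEN DERIV_imp_deriv]
  have "D_x (pr_x V) j = D_x (\<lambda>j. (\<lambda>(t, x, u) ut p. \<eta>x t x u + p * \<eta>u t x u
      - ut * (\<tau>x t x u + p * \<tau>u t x u) - p * (\<xi>x t x u + p * \<xi>u t x u)) (base j) (jut j) (jux j)) j"
    by (rule total_derivative_cong(2)[OF open_dom j pr_t_pr_x(2)])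
  then show ?thesis
    by (simp add: D_x_def pd_x_def pd_u_def pd_ut_def pd_ux_def base_def assms(2) dx du dut dp)
      (simp add: algebra_simps)
qed

text \<open>Only \<open>pr_t\<close> and \<open>pr_xx\<close> contribute, since \<open>L\<close>
  contains u_t with factor 1, u_xx with factor -1 and no other derivative of u. The variable u_tt
  drops out, and u_tx occurs only with the total x-derivative of \<tau>.\<close>

lemma prolong2_L:
  assumes "(t, x, u) \<in> \<Omega>"
    and "j = \<lparr>jt = t, jx = x, ju = u, jut = ut, jux = p, jutt = utt, jutx = utx, juxx = uxx\<rparr>"
  shows "prolong2 V (L k) j =
      - \<xi> t x u * kx x * u\<^sup>2 * (1 - u) - \<eta> t x u * k x * (2 * u - 3 * u\<^sup>2)
      + (\<eta>t t x u + ut * \<eta>u t x u - ut * (\<tau>t t x u + ut * \<tau>u t x u) - p * (\<xi>t t x u + ut * \<xi>u t x u))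
      - (\<eta>xx t x u + p * \<eta>ux t x u - ut * (\<tau>xx t x u + p * \<tau>ux t x u) - p * (\<xi>xx t x u + p * \<xi>ux t x u)
        + p * (\<eta>xu t x u + p * \<eta>uu t x u - ut * (\<tau>xu t x u + p * \<tau>uu t x u)
          - p * (\<xi>xu t x u + p * \<xi>uu t x u))
        - 2 * utx * (\<tau>x t x u + p * \<tau>u t x u)
        + uxx * (\<eta>u t x u - ut * \<tau>u t x u - 2 * \<xi>x t x u - 3 * p * \<xi>u t x u))"
proof -
  have j: "base j \<in> \<Omega>" using assms by (simp add: base_def)
  have "((\<lambda>s. ut - uxx - k s * u\<^sup>2 * (1 - u)) has_field_derivative - (kx x * u\<^sup>2 * (1 - u))) (at x)"
    using k_deriv[OF assms(1)] by (auto intro!: derivative_eq_intros)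
  note dx = this[THEN DERIV_imp_deriv]
  have "((\<lambda>s. ut - uxx - k x * s\<^sup>2 * (1 - s)) has_field_derivative - (k x * (2 * u - 3 * u\<^sup>2))) (at u)"
    by (auto intro!: derivative_eq_intros simp: algebra_simps power2_eq_square)
  note du = this[THEN DERIV_imp_deriv]
  have "((\<lambda>s. s - uxx - k x * u\<^sup>2 * (1 - u)) has_field_derivative 1) (at ut)"
    by (auto intro!: derivative_eq_intros)
  note dut = this[THEN DERIV_imp_deriv]
  have "((\<lambda>s. ut - s - k x * u\<^sup>2 * (1 - u)) has_field_derivative - 1) (at uxx)"
    by (auto intro!: derivative_eq_intros)
  note duxx = this[THEN DERIV_imp_deriv]
  have D: "D_x (vtau V) j = \<tau>x t x u + p * \<tau>u t x u" "D_x (vxi V) j = \<xi>x t x u + p * \<xi>u t x u"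
    using D_components[OF j] by (simp_all add: assms(2))
  have "pd_t (L k) j = 0" "pd_x (L k) j = - (kx x * u\<^sup>2 * (1 - u))"
    "pd_u (L k) j = - (k x * (2 * u - 3 * u\<^sup>2))" "pd_ut (L k) j = 1" "pd_ux (L k) j = 0"
    "pd_utt (L k) j = 0" "pd_utx (L k) j = 0" "pd_uxx (L k) j = - 1"
    by (simp_all add: assms(2) L_def pd_t_def pd_x_def pd_u_def pd_ut_def pd_ux_def pd_utt_def
        pd_utx_def pd_uxx_def dx du dut duxx)
  note pd = this
  show ?thesis
    unfolding prolong2_def pr_xx_def D_x_pr_x[OF assms] D components[OF j] pr_t_pr_x[OF j] pd
    by (simp add: assms(2) base_def) (simp add: algebra_simps)
qed

end

section \<open>Necessary conditions on a Lie symmetry\<close>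

lemma cubic_eq_zeroD:
  fixes a b c d :: real
  assumes "\<And>q. a + q * b + q * q * c + q * q * q * d = 0"
  shows "a = 0 \<and> b = 0 \<and> c = 0 \<and> d = 0"
  using assms[of 0] assms[of 1] assms[of "-1"] assms[of 2] by auto

lemma has_partials_const: "has_partials \<Omega> (\<lambda>t x u. c) (\<lambda>t x u. 0) (\<lambda>t x u. 0) (\<lambda>t x u. 0)
    (\<lambda>t x u. 0) (\<lambda>t x u. 0) (\<lambda>t x u. 0) (\<lambda>t x u. 0)"
  by (simp add: has_partials_def)

lemma DERIV_locally_const:
  assumes "(f has_field_derivative d) (at x)" "\<forall>\<^sub>F s in nhds x. f s = c"
  shows "d = 0"
  using DERIV_imp_deriv[OF assms(1)] deriv_cong_ev[OF assms(2) refl] by simp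

lemma has_partials_second_zero:
  assumes "open \<Omega>" "has_partials \<Omega> f ft fx fu fxx fxu fux fuu" "(t, x, u) \<in> \<Omega>"
    and "\<And>t x u. (t, x, u) \<in> \<Omega> \<Longrightarrow> fx t x u = 0" "\<And>t x u. (t, x, u) \<in> \<Omega> \<Longrightarrow> fu t x u = 0"
  shows "fxx t x u = 0" "fxu t x u = 0" "fux t x u = 0" "fuu t x u = 0"
proof -
  note d = assms(2)[unfolded has_partials_def, rule_format, OF assms(3)]
  note ev = eventually_slice[OF assms(1,3)]
  show "fxx t x u = 0"
    by (rule DERIV_locally_const[where f = "\<lambda>s. fx t s u" and x = x and c = 0])
      (use d eventually_mono[OF ev(2)] assms(4) in auto)
  show "fxu t x u = 0"
    by (rule DERIV_locally_const[where f = "\<lambda>s. fx t x s" and x = u and c = 0])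
      (use d eventually_mono[OF ev(3)] assms(4) in auto)
  show "fux t x u = 0"
    by (rule DERIV_locally_const[where f = "\<lambda>s. fu t s u" and x = x and c = 0])
      (use d eventually_mono[OF ev(2)] assms(5) in auto)
  show "fuu t x u = 0"
    by (rule DERIV_locally_const[where f = "\<lambda>s. fu t x s" and x = u and c = 0])
      (use d eventually_mono[OF ev(3)] assms(5) in auto)
qed

context vector_field
begin

text \<open>On L = 0 only u_xx is determined, so t, x, u, u_t, u_x, u_tx remain free. The
  coefficient of u_tx makes \<tau> independent of x and u; after that the coefficient of u_t is 2
  \<xi>_x - \<tau>_t + 2 u_x \<xi>_u, and its two parts vanish separately.\<close>

lemma lie_necessary:
  assumes lie: "\<forall>j. base j \<in> \<Omega> \<and> L k j = 0 \<longrightarrow> prolong2 V (L k) j = 0"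
    and p: "(t, x, u) \<in> \<Omega>"
  shows "\<tau>x t x u = 0" "\<tau>u t x u = 0" "\<xi>u t x u = 0" "\<tau>t t x u = 2 * \<xi>x t x u"
proof -
  have E: "prolong2 V (L k) \<lparr>jt = t, jx = x, ju = u, jut = ut, jux = p, jutt = 0, jutx = utx,
      juxx = ut - k x * u\<^sup>2 * (1 - u)\<rparr> = 0" if "(t, x, u) \<in> \<Omega>" for t x u ut p utx
    using lie[rule_format, of "\<lparr>jt = t, jx = x, ju = u, jut = ut, jux = p, jutt = 0, jutx = utx,
      juxx = ut - k x * u\<^sup>2 * (1 - u)\<rparr>"] that by (simp add: base_def L_def)
  note E = trans[OF prolong2_L[OF _ refl, symmetric] E]
  \<comment> \<open>Two jets that differ only in u_tx isolate its coefficient; u_x = 0 gives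
    \<tau>_x, and u_x = 1 below gives \<tau>_u.\<close>
  have \<tau>x: "\<tau>x t x u = 0" if "(t, x, u) \<in> \<Omega>" for t x u
    using E[OF that that, of 0 0 0] E[OF that that, of 0 0 1] by simp
  have \<tau>u: "\<tau>u t x u = 0" if "(t, x, u) \<in> \<Omega>" for t x u
    using E[OF that that, of 0 1 0] E[OF that that, of 0 1 1] \<tau>x[OF that] by simp
  note second = has_partials_second_zero[OF open_dom \<tau> p \<tau>x \<tau>u]
  have "ut * (2 * \<xi>x t x u - \<tau>t t x u + 2 * p * \<xi>u t x u) = 0" for ut p
    using E[OF p p, of ut p 0] E[OF p p, of 0 p 0]
    by (simp add: second \<tau>x[OF p] \<tau>u[OF p] algebra_simps)
  from this[of 1 0] this[of 1 1]
  show "\<tau>x t x u = 0" "\<tau>u t x u = 0" "\<xi>u t x u = 0" "\<tau>t t x u = 2 * \<xi>x t x u"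
    using \<tau>x[OF p] \<tau>u[OF p] by simp_all
qed

end

text \<open>The determining equations are the coefficients, as a polynomial in \<open>u\<^sub>x\<close>, of the invariance
  condition after elimination of \<open>u\<^sub>t\<close> and \<open>u\<^sub>x\<^sub>x\<close>.\<close>

locale unit_vector_field =
  fixes \<Omega> :: "(real \<times> real \<times> real) set" and Q :: vfield and k kx :: "real \<Rightarrow> real"
    and \<xi> \<xi>t \<xi>x \<xi>u \<xi>xx \<xi>xu \<xi>ux \<xi>uu \<eta> \<eta>t \<eta>x \<eta>u \<eta>xx \<eta>xu \<eta>ux \<eta>uu :: "real \<Rightarrow> real \<Rightarrow> real \<Rightarrow> real"
  assumes open_dom: "open \<Omega>"
    and Q_eq: "\<And>t x u. (t, x, u) \<in> \<Omega> \<Longrightarrow> Q (t, x, u) = (1, \<xi> t x u, \<eta> t x u)"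
    and k_deriv: "\<And>t x u. (t, x, u) \<in> \<Omega> \<Longrightarrow> (k has_field_derivative kx x) (at x)"
    and \<xi>: "has_partials \<Omega> \<xi> \<xi>t \<xi>x \<xi>u \<xi>xx \<xi>xu \<xi>ux \<xi>uu"
    and \<eta>: "has_partials \<Omega> \<eta> \<eta>t \<eta>x \<eta>u \<eta>xx \<eta>xu \<eta>ux \<eta>uu"

sublocale unit_vector_field \<subseteq> vector_field \<Omega> Q k kx "\<lambda>t x u. 1" "\<lambda>t x u. 0" "\<lambda>t x u. 0"
    "\<lambda>t x u. 0" "\<lambda>t x u. 0" "\<lambda>t x u. 0" "\<lambda>t x u. 0" "\<lambda>t x u. 0" \<xi> \<xi>t \<xi>x \<xi>u \<xi>xx \<xi>xu \<xi>ux \<xi>uu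
    \<eta> \<eta>t \<eta>x \<eta>u \<eta>xx \<eta>xu \<eta>ux \<eta>uu
  using open_dom Q_eq k_deriv \<xi> \<eta> by unfold_locales (auto simp: has_partials_const)

context unit_vector_field
begin

text \<open>The conjuncts belong to the powers 3, 2, 1, 0 of u_x, in this order.\<close>

definition determining where
  "determining \<longleftrightarrow> (\<forall>t x u. (t, x, u) \<in> \<Omega> \<longrightarrow>
     \<xi>uu t x u = 0 \<and>
     \<eta>uu t x u = \<xi>ux t x u + \<xi>xu t x u - 2 * \<xi> t x u * \<xi>u t x u \<and>
     \<xi>xx t x u - \<xi>t t x u - \<eta>ux t x u - \<eta>xu t x u - 2 * \<xi> t x u * \<xi>x t x u + 2 * \<eta> t x u * \<xi>u t x u
       - 3 * \<xi>u t x u * (k x * u\<^sup>2 * (1 - u)) = 0 \<and>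
     \<eta>t t x u - \<eta>xx t x u + 2 * \<xi>x t x u * \<eta> t x u
       + (\<eta>u t x u - 2 * \<xi>x t x u) * (k x * u\<^sup>2 * (1 - u))
       - \<xi> t x u * kx x * u\<^sup>2 * (1 - u) - \<eta> t x u * k x * (2 * u - 3 * u\<^sup>2) = 0)"

lemma characteristic_eq:
  assumes "base j \<in> \<Omega>"
  shows "characteristic Q j = (\<lambda>(t, x, u). \<eta> t x u - jut j - \<xi> t x u * jux j) (base j)"
  using components[OF assms] by (simp add: characteristic_def base_def)

lemma D_characteristic:
  assumes "(t, x, u) \<in> \<Omega>"
    and "j = \<lparr>jt = t, jx = x, ju = u, jut = ut, jux = p, jutt = utt, jutx = utx, juxx = uxx\<rparr>"
  shows "D_t (characteristic Q) j =
      \<eta>t t x u + ut * \<eta>u t x u - p * (\<xi>t t x u + ut * \<xi>u t x u) - utt - utx * \<xi> t x u"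
    and "D_x (characteristic Q) j =
      \<eta>x t x u + p * \<eta>u t x u - p * (\<xi>x t x u + p * \<xi>u t x u) - utx - uxx * \<xi> t x u"
proof -
  have j: "base j \<in> \<Omega>" using assms by (simp add: base_def)
  note \<xi>' = \<xi>[unfolded has_partials_def, rule_format, OF assms(1)]
  note \<eta>' = \<eta>[unfolded has_partials_def, rule_format, OF assms(1)]
  have "((\<lambda>s. \<eta> s x u - ut - \<xi> s x u * p) has_field_derivative \<eta>t t x u - \<xi>t t x u * p) (at t)"
    "((\<lambda>s. \<eta> t s u - ut - \<xi> t s u * p) has_field_derivative \<eta>x t x u - \<xi>x t x u * p) (at x)"
    "((\<lambda>s. \<eta> t x s - ut - \<xi> t x s * p) has_field_derivative \<eta>u t x u - \<xi>u t x u * p) (at u)"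
    "((\<lambda>s. \<eta> t x u - s - \<xi> t x u * p) has_field_derivative - 1) (at ut)"
    "((\<lambda>s. \<eta> t x u - ut - \<xi> t x u * s) has_field_derivative - \<xi> t x u) (at p)"
    using \<xi>' \<eta>' by (auto intro!: derivative_eq_intros)
  note d = this[THEN DERIV_imp_deriv]
  let ?G = "\<lambda>j. (\<lambda>(t, x, u). \<eta> t x u - jut j - \<xi> t x u * jux j) (base j)"
  have "D_t (characteristic Q) j = D_t ?G j" "D_x (characteristic Q) j = D_x ?G j"
    by (rule total_derivative_cong[OF open_dom j characteristic_eq], assumption)+
  then show "D_t (characteristic Q) j =
      \<eta>t t x u + ut * \<eta>u t x u - p * (\<xi>t t x u + ut * \<xi>u t x u) - utt - utx * \<xi> t x u"
    "D_x (characteristic Q) j =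
      \<eta>x t x u + p * \<eta>u t x u - p * (\<xi>x t x u + p * \<xi>u t x u) - utx - uxx * \<xi> t x u"
    by (simp_all add: D_t_def D_x_def pd_t_def pd_x_def pd_u_def pd_ut_def pd_ux_def base_def assms(2) d)
      (simp_all add: algebra_simps)
qed

text \<open>Over \<Omega> the manifold on which invariance is required is a graph over (t, x, u,
  u_x): \<open>characteristic\<close> gives u_t, \<open>L\<close> gives u_xx, and the two total
  derivatives give u_tx and u_tt. Hence the condition is a cubic polynomial in a free variable u_x.
  As \<tau> = 1, neither u_tt nor u_tx enters it.\<close>

lemma nonclassical_iff_determining:
  "(\<forall>j. base j \<in> \<Omega> \<and> L k j = 0 \<and> characteristic Q j = 0 \<and> D_t (characteristic Q) j = 0 \<and>
      D_x (characteristic Q) j = 0 \<longrightarrow> prolong2 Q (L k) j = 0) \<longleftrightarrow> determining"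
    (is "?L \<longleftrightarrow> _")
proof
  assume inv: ?L
  show determining unfolding determining_def
  proof (intro allI impI)
    fix t x u assume p: "(t, x, u) \<in> \<Omega>"
    let ?d0 = "\<eta>t t x u - \<eta>xx t x u + 2 * \<xi>x t x u * \<eta> t x u
      + (\<eta>u t x u - 2 * \<xi>x t x u) * (k x * u\<^sup>2 * (1 - u))
      - \<xi> t x u * kx x * u\<^sup>2 * (1 - u) - \<eta> t x u * k x * (2 * u - 3 * u\<^sup>2)"
    let ?d1 = "\<xi>xx t x u - \<xi>t t x u - \<eta>ux t x u - \<eta>xu t x u - 2 * \<xi> t x u * \<xi>x t x u
      + 2 * \<eta> t x u * \<xi>u t x u - 3 * \<xi>u t x u * (k x * u\<^sup>2 * (1 - u))"
    let ?d2 = "\<xi>ux t x u + \<xi>xu t x u - 2 * \<xi> t x u * \<xi>u t x u - \<eta>uu t x u"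
    have E: "?d0 + q * ?d1 + q * q * ?d2 + q * q * q * \<xi>uu t x u = 0" for q
    proof -
      \<comment> \<open>The jet over u_x = q: each coordinate is read off from one of the four
        constraints, in the order in which they become solvable.\<close>
      define ut where "ut = \<eta> t x u - \<xi> t x u * q"
      define uxx where "uxx = ut - k x * u\<^sup>2 * (1 - u)"
      define utx where "utx = \<eta>x t x u + q * \<eta>u t x u - q * (\<xi>x t x u + q * \<xi>u t x u) - uxx * \<xi> t x u"
      define utt where "utt = \<eta>t t x u + ut * \<eta>u t x u - q * (\<xi>t t x u + ut * \<xi>u t x u) - utx * \<xi> t x u"
      let ?j = "\<lparr>jt = t, jx = x, ju = u, jut = ut, jux = q, jutt = utt, jutx = utx, juxx = uxx\<rparr>"
      have "base ?j \<in> \<Omega>" using p by (simp add: base_def)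
      moreover have "L k ?j = 0" by (simp add: L_def uxx_def)
      moreover have "characteristic Q ?j = 0"
        using characteristic_eq[of ?j] p by (simp add: base_def ut_def)
      ultimately have "prolong2 Q (L k) ?j = 0"
        using inv D_characteristic[OF p refl, of ut q utt utx uxx] by (simp add: utt_def utx_def)
      then show ?thesis
        unfolding prolong2_L[OF p refl] uxx_def ut_def by (simp add: algebra_simps)
    qed
    from cubic_eq_zeroD[OF E] show "\<xi>uu t x u = 0 \<and> \<eta>uu t x u = \<xi>ux t x u + \<xi>xu t x u - 2 * \<xi> t x u * \<xi>u t x u \<and>
      ?d1 = 0 \<and> ?d0 = 0" by linarith
  qed
next
  assume det: determining
  show ?L
  proof (intro allI impI)
    fix j assume j: "base j \<in> \<Omega> \<and> L k j = 0 \<and> characteristic Q j = 0 \<and> D_t (characteristic Q) j = 0 \<and>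
      D_x (characteristic Q) j = 0"
    obtain t x u ut p utt utx uxx where [simp]:
      "j = \<lparr>jt = t, jx = x, ju = u, jut = ut, jux = p, jutt = utt, jutx = utx, juxx = uxx\<rparr>"
      by (cases j)
    have p: "(t, x, u) \<in> \<Omega>" using j by (simp add: base_def)
    have ut: "ut = \<eta> t x u - \<xi> t x u * p"
      using j characteristic_eq[of j] by (simp add: base_def)
    have uxx: "uxx = \<eta> t x u - \<xi> t x u * p - k x * u\<^sup>2 * (1 - u)"
      using j ut by (simp add: L_def)
    note d = det[unfolded determining_def, rule_format, OF p]
    have "prolong2 Q (L k) j =
        (\<eta>t t x u - \<eta>xx t x u + 2 * \<xi>x t x u * \<eta> t x u
          + (\<eta>u t x u - 2 * \<xi>x t x u) * (k x * u\<^sup>2 * (1 - u))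
          - \<xi> t x u * kx x * u\<^sup>2 * (1 - u) - \<eta> t x u * k x * (2 * u - 3 * u\<^sup>2))
        + p * (\<xi>xx t x u - \<xi>t t x u - \<eta>ux t x u - \<eta>xu t x u - 2 * \<xi> t x u * \<xi>x t x u
          + 2 * \<eta> t x u * \<xi>u t x u - 3 * \<xi>u t x u * (k x * u\<^sup>2 * (1 - u)))
        + p * p * (\<xi>ux t x u + \<xi>xu t x u - 2 * \<xi> t x u * \<xi>u t x u - \<eta>uu t x u)
        + p * p * p * \<xi>uu t x u"
      unfolding prolong2_L[OF p \<open>j = _\<close>] ut uxx by (simp add: algebra_simps)
    then show "prolong2 Q (L k) j = 0" using d by simp
  qed
qed

end

section \<open>Smooth fields and equivalence to Lie symmetries\<close>

lemma smooth_has_partials: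
  fixes f :: "real \<times> real \<times> real \<Rightarrow> real"
  assumes "smooth_on \<Omega> f"
  defines "d \<equiv> \<lambda>v (g :: real \<times> real \<times> real \<Rightarrow> real) p. frechet_derivative g (at p) v"
  shows "has_partials \<Omega> (\<lambda>t x u. f (t, x, u)) (\<lambda>t x u. d (1, 0, 0) f (t, x, u))
    (\<lambda>t x u. d (0, 1, 0) f (t, x, u)) (\<lambda>t x u. d (0, 0, 1) f (t, x, u))
    (\<lambda>t x u. d (0, 1, 0) (d (0, 1, 0) f) (t, x, u)) (\<lambda>t x u. d (0, 0, 1) (d (0, 1, 0) f) (t, x, u))
    (\<lambda>t x u. d (0, 1, 0) (d (0, 0, 1) f) (t, x, u)) (\<lambda>t x u. d (0, 0, 1) (d (0, 0, 1) f) (t, x, u))"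
proof -
  have s: "((\<lambda>s. g (s, x, u)) has_field_derivative d (1, 0, 0) g (t, x, u)) (at t)"
    "((\<lambda>s. g (t, s, u)) has_field_derivative d (0, 1, 0) g (t, x, u)) (at x)"
    "((\<lambda>s. g (t, x, s)) has_field_derivative d (0, 0, 1) g (t, x, u)) (at u)"
    if g: "smooth_on \<Omega> g" and p: "(t, x, u) \<in> \<Omega>" for g t x u
  proof -
    note G = smooth_on_has_derivative[OF g p]
    have lin: "frechet_derivative g (at (t, x, u)) (h * a, h * b, h * c) = h * d (a, b, c) g (t, x, u)"
      for h a b c
      using linear_cmul[OF has_derivative_linear[OF G], of h "(a, b, c)"] by (simp add: d_def)
    have "((\<lambda>s. (s, x, u)) has_derivative (\<lambda>h. (h, 0, 0))) (at t)"
      by (intro has_derivative_Pair has_derivative_const has_derivative_ident)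
    from has_derivative_compose[OF this G]
    show "((\<lambda>s. g (s, x, u)) has_field_derivative d (1, 0, 0) g (t, x, u)) (at t)"
      using lin[of _ 1 0 0] by (simp add: has_field_derivative_def mult_commute_abs)
    have "((\<lambda>s. (t, s, u)) has_derivative (\<lambda>h. (0, h, 0))) (at x)"
      by (intro has_derivative_Pair has_derivative_const has_derivative_ident)
    from has_derivative_compose[OF this G]
    show "((\<lambda>s. g (t, s, u)) has_field_derivative d (0, 1, 0) g (t, x, u)) (at x)"
      using lin[of _ 0 1 0] by (simp add: has_field_derivative_def mult_commute_abs)
    have "((\<lambda>s. (t, x, s)) has_derivative (\<lambda>h. (0, 0, h))) (at u)"
      by (intro has_derivative_Pair has_derivative_const has_derivative_ident)
    from has_derivative_compose[OF this G]
    show "((\<lambda>s. g (t, x, s)) has_field_derivative d (0, 0, 1) g (t, x, u)) (at u)"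
      using lin[of _ 0 0 1] by (simp add: has_field_derivative_def mult_commute_abs)
  qed
  have "smooth_on \<Omega> (d v f)" for v
    unfolding d_def by (rule smooth_on_frechet_derivative[OF assms(1)])
  then show ?thesis unfolding has_partials_def using s assms(1) by simp
qed

lemma open_box: "open T \<Longrightarrow> open X \<Longrightarrow> open U \<Longrightarrow> open (T \<times> X \<times> U)"
  by (intro open_Times)

lemma smooth_on_real_deriv:
  fixes f :: "real \<Rightarrow> real"
  assumes "open X" "smooth_on X f"
  shows "\<And>x. x \<in> X \<Longrightarrow> (f has_field_derivative deriv f x) (at x)" "smooth_on X (deriv f)"
proof -
  show d: "(f has_field_derivative deriv f x) (at x)" if "x \<in> X" for x
    using smooth_on_has_derivative[OF assms(2) that]
    by (metis DERIV_deriv_iff_real_differentiable differentiableI)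
  have "frechet_derivative f (at x) 1 = deriv f x" if "x \<in> X" for x
    using frechet_derivative_at[OF d[OF that, unfolded has_field_derivative_def]] by (metis mult_1_right)
  then show "smooth_on X (deriv f)"
    using smooth_on_cong[OF assms(1), of "\<lambda>x. frechet_derivative f (at x) 1" "deriv f"]
      smooth_on_frechet_derivative[OF assms(2), of 1] by simp
qed

lemma DERIV_zero_interval:
  fixes f :: "real \<Rightarrow> real"
  assumes "is_interval S" "\<And>x. x \<in> S \<Longrightarrow> (f has_field_derivative 0) (at x)" "x \<in> S" "y \<in> S"
  shows "f x = f y"
proof -
  have "\<exists>c. \<forall>x\<in>S. f x = c"
    by (rule has_field_derivative_zero_constant)
      (use assms in \<open>auto simp: is_interval_convex intro: has_field_derivative_at_within\<close>)
  then show ?thesis using assms by auto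
qed

text \<open>Let \<tau>, \<sigma>, \<zeta> be the components of the Lie symmetry V. Since the first
  component of Q is 1, \<mu> \<tau> = 1 and \<sigma> = \<xi> \<tau>. With \<tau>_x = \<tau>_u = 0
  this turns \<sigma>_u = 0 into \<xi>_u = 0 and \<tau>_t = 2 \<sigma>_x into \<xi>_x = \<tau>_t /
  (2 \<tau>), which is the same at all x.\<close>

lemma lie_equivalent_necessary:
  assumes I: "open_interval T" "open_interval X" "open_interval U" and \<Omega>: "\<Omega> = T \<times> X \<times> U"
    and Q: "\<And>t x u. (t, x, u) \<in> \<Omega> \<Longrightarrow> Q (t, x, u) = (1, \<xi> t x u, \<eta> t x u)"
    and k: "\<And>x. x \<in> X \<Longrightarrow> (k has_field_derivative kx x) (at x)"
    and \<xi>: "\<And>t x u. (t, x, u) \<in> \<Omega> \<Longrightarrow> ((\<lambda>s. \<xi> t s u) has_field_derivative \<xi>x t x u) (at x)"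
      "\<And>t x u. (t, x, u) \<in> \<Omega> \<Longrightarrow> ((\<lambda>s. \<xi> t x s) has_field_derivative \<xi>u t x u) (at u)"
    and eq: "equivalent_to_lie k \<Omega> Q"
    and p: "(t, x, u) \<in> \<Omega>"
  shows "\<xi>u t x u = 0" "x' \<in> X \<Longrightarrow> \<xi>x t x u = \<xi>x t x' u"
proof -
  obtain \<mu> V where \<mu>: "\<forall>p\<in>\<Omega>. \<mu> p \<noteq> 0" "\<forall>p\<in>\<Omega>. Q p = (\<mu> p :: real) *\<^sub>R V p"
    and lie: "lie_symmetry k \<Omega> V"
    using eq unfolding equivalent_to_lie_def by blast
  have V: "smooth_on \<Omega> V" "\<forall>j. base j \<in> \<Omega> \<and> L k j = 0 \<longrightarrow> prolong2 V (L k) j = 0"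
    using lie by (auto simp: lie_symmetry_def)
  have op: "open \<Omega>" using I by (simp add: \<Omega> open_box open_interval_def)
  have s: "smooth_on \<Omega> (\<lambda>p. fst (V p))" "smooth_on \<Omega> (\<lambda>p. fst (snd (V p)))" "smooth_on \<Omega> (\<lambda>p. snd (snd (V p)))"
    by (rule smooth_on_linear_comp[OF op _ V(1)],
        intro bounded_linear_compose[OF bounded_linear_fst] bounded_linear_compose[OF bounded_linear_snd]
          bounded_linear_fst bounded_linear_snd)+
  define \<tau> where "\<tau> t x u = fst (V (t, x, u))" for t x u
  define \<sigma> where "\<sigma> t x u = fst (snd (V (t, x, u)))" for t x u
  define \<zeta> where "\<zeta> t x u = snd (snd (V (t, x, u)))" for t x u
  obtain \<tau>t \<tau>x \<tau>u \<tau>xx \<tau>xu \<tau>ux \<tau>uu where \<tau>: "has_partials \<Omega> \<tau> \<tau>t \<tau>x \<tau>u \<tau>xx \<tau>xu \<tau>ux \<tau>uu"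
    using smooth_has_partials[OF s(1)] unfolding \<tau>_def[abs_def] by blast
  obtain \<sigma>t \<sigma>x \<sigma>u \<sigma>xx \<sigma>xu \<sigma>ux \<sigma>uu where \<sigma>: "has_partials \<Omega> \<sigma> \<sigma>t \<sigma>x \<sigma>u \<sigma>xx \<sigma>xu \<sigma>ux \<sigma>uu"
    using smooth_has_partials[OF s(2)] unfolding \<sigma>_def[abs_def] by blast
  obtain \<zeta>t \<zeta>x \<zeta>u \<zeta>xx \<zeta>xu \<zeta>ux \<zeta>uu where \<zeta>: "has_partials \<Omega> \<zeta> \<zeta>t \<zeta>x \<zeta>u \<zeta>xx \<zeta>xu \<zeta>ux \<zeta>uu"
    using smooth_has_partials[OF s(3)] unfolding \<zeta>_def[abs_def] by blast
  have loc: "vector_field \<Omega> V k kx \<tau> \<tau>t \<tau>x \<tau>u \<tau>xx \<tau>xu \<tau>ux \<tau>uu \<sigma> \<sigma>t \<sigma>x \<sigma>u \<sigma>xx \<sigma>xu \<sigma>ux \<sigma>uu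
      \<zeta> \<zeta>t \<zeta>x \<zeta>u \<zeta>xx \<zeta>xu \<zeta>ux \<zeta>uu"
    using op k \<tau> \<sigma> \<zeta> by unfold_locales (auto simp: \<Omega> \<tau>_def \<sigma>_def \<zeta>_def)
  note d = \<tau>[unfolded has_partials_def, rule_format, THEN conjunct1]
    \<tau>[unfolded has_partials_def, rule_format, THEN conjunct2, THEN conjunct1]
    \<tau>[unfolded has_partials_def, rule_format, THEN conjunct2, THEN conjunct2, THEN conjunct1]
    \<sigma>[unfolded has_partials_def, rule_format, THEN conjunct2, THEN conjunct1]
    \<sigma>[unfolded has_partials_def, rule_format, THEN conjunct2, THEN conjunct2, THEN conjunct1]
  note z = vector_field.lie_necessary[OF loc V(2)]
  have \<mu>\<tau>: "\<mu> (t, x, u) * \<tau> t x u = 1" "\<xi> t x u = \<mu> (t, x, u) * \<sigma> t x u" if "(t, x, u) \<in> \<Omega>" for t x u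
    using Q[OF that] \<mu>(2)[rule_format, OF that] by (simp_all add: \<tau>_def \<sigma>_def prod_eq_iff)
  have \<sigma>\<xi>: "\<sigma> t x u = \<xi> t x u * \<tau> t x u" and \<tau>0: "\<tau> t x u \<noteq> 0" if "(t, x, u) \<in> \<Omega>" for t x u
    using \<mu>\<tau>[OF that] by (auto simp: algebra_simps)
  have su: "\<sigma>u t x u = \<xi>u t x u * \<tau> t x u" and sx: "\<sigma>x t x u = \<xi>x t x u * \<tau> t x u"
    if p: "(t, x, u) \<in> \<Omega>" for t x u
  proof -
    have "((\<lambda>s. \<xi> t x s * \<tau> t x s - \<sigma> t x s) has_field_derivative
        \<xi>u t x u * \<tau> t x u + \<tau>u t x u * \<xi> t x u - \<sigma>u t x u) (at u)"
      using d p \<xi> by (auto intro!: derivative_eq_intros)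
    from DERIV_locally_const[OF this, of 0] show "\<sigma>u t x u = \<xi>u t x u * \<tau> t x u"
      using eventually_mono[OF eventually_slice(3)[OF op p]] \<sigma>\<xi> z p by simp
    have "((\<lambda>s. \<xi> t s u * \<tau> t s u - \<sigma> t s u) has_field_derivative
        \<xi>x t x u * \<tau> t x u + \<tau>x t x u * \<xi> t x u - \<sigma>x t x u) (at x)"
      using d p \<xi> by (auto intro!: derivative_eq_intros)
    from DERIV_locally_const[OF this, of 0] show "\<sigma>x t x u = \<xi>x t x u * \<tau> t x u"
      using eventually_mono[OF eventually_slice(2)[OF op p]] \<sigma>\<xi> z p by simp
  qed
  show "\<xi>u t x u = 0" using su[OF p] z(3)[OF p] \<tau>0[OF p] by simp
  assume x': "x' \<in> X"
  then have p': "(t, x', u) \<in> \<Omega>" using p by (simp add: \<Omega>)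
  have \<tau>c: "\<tau> s x u = \<tau> s x' u" if "(s, x, u) \<in> \<Omega>" for s
    using that x' I(2) d(2) z(1)
    by (intro DERIV_zero_interval[of X "\<lambda>y. \<tau> s y u"]) (force simp: \<Omega> open_interval_def)+
  have "((\<lambda>s. \<tau> s x u - \<tau> s x' u) has_field_derivative \<tau>t t x u - \<tau>t t x' u) (at t)"
    using d p p' by (auto intro!: derivative_eq_intros)
  from DERIV_locally_const[OF this, of 0] have "\<tau>t t x u = \<tau>t t x' u"
    using eventually_mono[OF eventually_slice(1)[OF op p]] \<tau>c by simp
  then show "\<xi>x t x u = \<xi>x t x' u"
    using z(4)[OF p] z(4)[OF p'] sx[OF p] sx[OF p'] \<tau>c[OF p] \<tau>0[OF p] by simp
qed

text \<open>These fields generate translations and the dilations in which t scales as x^2; the last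
  assumption is the infinitesimal form of k being divided by the square of the dilation factor. The
  lemma serves to recognise the solutions that have to be discarded.\<close>

lemma lie_symmetry_affine:
  fixes \<tau> \<xi> k :: "real \<Rightarrow> real"
  assumes "open \<Omega>" "smooth_on \<Omega> V"
    and V: "\<And>t x u. (t, x, u) \<in> \<Omega> \<Longrightarrow> V (t, x, u) = (\<tau> t, \<xi> x, 0)"
    and k: "\<And>t x u. (t, x, u) \<in> \<Omega> \<Longrightarrow> (k has_field_derivative kx x) (at x)"
    and \<tau>: "\<And>t x u. (t, x, u) \<in> \<Omega> \<Longrightarrow> (\<tau> has_field_derivative 2 * \<alpha>) (at t)"
    and \<xi>: "\<And>t x u. (t, x, u) \<in> \<Omega> \<Longrightarrow> (\<xi> has_field_derivative \<alpha>) (at x)"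
    and eq: "\<And>t x u. (t, x, u) \<in> \<Omega> \<Longrightarrow> \<xi> x * kx x + 2 * \<alpha> * k x = 0"
  shows "lie_symmetry k \<Omega> V"
proof -
  have "has_partials \<Omega> (\<lambda>t x u. \<tau> t) (\<lambda>t x u. 2 * \<alpha>) (\<lambda>t x u. 0) (\<lambda>t x u. 0) (\<lambda>t x u. 0)
      (\<lambda>t x u. 0) (\<lambda>t x u. 0) (\<lambda>t x u. 0)"
    "has_partials \<Omega> (\<lambda>t x u. \<xi> x) (\<lambda>t x u. 0) (\<lambda>t x u. \<alpha>) (\<lambda>t x u. 0) (\<lambda>t x u. 0)
      (\<lambda>t x u. 0) (\<lambda>t x u. 0) (\<lambda>t x u. 0)"
    using \<tau> \<xi> by (auto simp: has_partials_def)
  then have loc: "vector_field \<Omega> V k kx (\<lambda>t x u. \<tau> t) (\<lambda>t x u. 2 * \<alpha>) (\<lambda>t x u. 0) (\<lambda>t x u. 0)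
      (\<lambda>t x u. 0) (\<lambda>t x u. 0) (\<lambda>t x u. 0) (\<lambda>t x u. 0) (\<lambda>t x u. \<xi> x) (\<lambda>t x u. 0) (\<lambda>t x u. \<alpha>)
      (\<lambda>t x u. 0) (\<lambda>t x u. 0) (\<lambda>t x u. 0) (\<lambda>t x u. 0) (\<lambda>t x u. 0) (\<lambda>t x u. 0) (\<lambda>t x u. 0)
      (\<lambda>t x u. 0) (\<lambda>t x u. 0) (\<lambda>t x u. 0) (\<lambda>t x u. 0) (\<lambda>t x u. 0) (\<lambda>t x u. 0)"
    using assms(1) V k by unfold_locales (auto simp: has_partials_const)
  have "prolong2 V (L k) j = 0" if j: "base j \<in> \<Omega>" "L k j = 0" for j
  proof -
    obtain t x u ut p utt utx uxx where jj:
      "j = \<lparr>jt = t, jx = x, ju = u, jut = ut, jux = p, jutt = utt, jutx = utx, juxx = uxx\<rparr>"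
      by (cases j)
    have p: "(t, x, u) \<in> \<Omega>" and uxx: "ut = uxx + k x * u\<^sup>2 * (1 - u)"
      using j by (simp_all add: jj base_def L_def)
    have "prolong2 V (L k) j = - ((\<xi> x * kx x + 2 * \<alpha> * k x) * (u\<^sup>2 * (1 - u)))"
      unfolding vector_field.prolong2_L[OF loc p jj] by (simp add: uxx) (simp add: algebra_simps)
    then show ?thesis using eq[OF p] by simp
  qed
  then show ?thesis using assms(2) by (simp add: lie_symmetry_def)
qed

section \<open>The listed pairs\<close>

lemma interval_domainsD:
  assumes "interval_domains P"
  shows "open (x_dom P)" "open (dom3 P)" "(t, x, u) \<in> dom3 P \<longleftrightarrow> t \<in> t_dom P \<and> x \<in> x_dom P \<and> u \<in> u_dom P"
    "\<exists>t x u. (t, x, u) \<in> dom3 P"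
  using assms open_box by (auto simp: interval_domains_def open_interval_def dom3_def)

text \<open>All listed operators are independent of t, so the t-derivatives drop out of the
  determining equations. The last assumption refutes the conclusion of
  \<open>lie_equivalent_necessary\<close>.\<close>

lemma non_lie_pairI:
  assumes dom: "interval_domains P" and ag: "agrees P k \<xi> \<eta>"
    and k: "smooth_on (x_dom P) k" "\<And>x. x \<in> x_dom P \<Longrightarrow> k x \<noteq> 0"
      "\<And>x. x \<in> x_dom P \<Longrightarrow> (k has_field_derivative kx x) (at x)"
    and smooth: "smooth_on (dom3 P) (\<lambda>p. \<xi> (fst (snd p)) (snd (snd p)))"
      "smooth_on (dom3 P) (\<lambda>p. \<eta> (fst (snd p)) (snd (snd p)))"
    and \<xi>: "has_partials (dom3 P) (\<lambda>t. \<xi>) (\<lambda>t x u. 0) (\<lambda>t. \<xi>x) (\<lambda>t. \<xi>u) (\<lambda>t. \<xi>xx) (\<lambda>t. \<xi>xu) (\<lambda>t. \<xi>ux) (\<lambda>t. \<xi>uu)"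
    and \<eta>: "has_partials (dom3 P) (\<lambda>t. \<eta>) (\<lambda>t x u. 0) (\<lambda>t. \<eta>x) (\<lambda>t. \<eta>u) (\<lambda>t. \<eta>xx) (\<lambda>t. \<eta>xu) (\<lambda>t. \<eta>ux) (\<lambda>t. \<eta>uu)"
    and det: "\<And>x u. x \<in> x_dom P \<Longrightarrow> u \<in> u_dom P \<Longrightarrow> \<xi>uu x u = 0 \<and>
     \<eta>uu x u = \<xi>ux x u + \<xi>xu x u - 2 * \<xi> x u * \<xi>u x u \<and>
     \<xi>xx x u - \<eta>ux x u - \<eta>xu x u - 2 * \<xi> x u * \<xi>x x u + 2 * \<eta> x u * \<xi>u x u
       - 3 * \<xi>u x u * (k x * u\<^sup>2 * (1 - u)) = 0 \<and>
     - \<eta>xx x u + 2 * \<xi>x x u * \<eta> x u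
       + (\<eta>u x u - 2 * \<xi>x x u) * (k x * u\<^sup>2 * (1 - u))
       - \<xi> x u * kx x * u\<^sup>2 * (1 - u) - \<eta> x u * k x * (2 * u - 3 * u\<^sup>2) = 0"
    and non_lie: "\<not> (\<forall>x\<in>x_dom P. \<forall>u\<in>u_dom P. \<xi>u x u = 0 \<and> (\<forall>x'\<in>x_dom P. \<xi>x x u = \<xi>x x' u))"
  shows "non_lie_pair P"
proof -
  note ld = interval_domainsD[OF dom]
  have Q: "oper P (t, x, u) = (1, \<xi> x u, \<eta> x u)" if "(t, x, u) \<in> dom3 P" for t x u
    using ag that by (auto simp: agrees_def)
  have c: "coef P x = k x" if "x \<in> x_dom P" for x using ag that by (simp add: agrees_def)
  have sc: "smooth_on (x_dom P) (coef P)" using smooth_on_cong[OF ld(1) c] k(1) by simp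
  have kd: "(coef P has_field_derivative kx x) (at x)" if x: "x \<in> x_dom P" for x
    by (rule has_field_derivative_transform_within_open[OF k(3)[OF x] ld(1) x]) (simp add: c)
  have so: "smooth_on (dom3 P) (oper P)"
    using smooth_on_cong[OF ld(2), of "oper P" "\<lambda>p. (1, \<xi> (fst (snd p)) (snd (snd p)), \<eta> (fst (snd p)) (snd (snd p)))"]
      smooth_on_Pair[OF ld(2) smooth_on_const[where c = "1::real"] smooth_on_Pair[OF ld(2) smooth]] Q by auto
  have loc: "unit_vector_field (dom3 P) (oper P) (coef P) kx (\<lambda>t. \<xi>) (\<lambda>t x u. 0) (\<lambda>t. \<xi>x) (\<lambda>t. \<xi>u) (\<lambda>t. \<xi>xx)
    (\<lambda>t. \<xi>xu) (\<lambda>t. \<xi>ux) (\<lambda>t. \<xi>uu) (\<lambda>t. \<eta>) (\<lambda>t x u. 0) (\<lambda>t. \<eta>x) (\<lambda>t. \<eta>u) (\<lambda>t. \<eta>xx) (\<lambda>t. \<eta>xu) (\<lambda>t. \<eta>ux) (\<lambda>t. \<eta>uu)"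
    using Q kd ld \<xi> \<eta> by unfold_locales auto
  have "nonclassical_symmetry (coef P) (dom3 P) (oper P)"
    unfolding nonclassical_symmetry_def unit_vector_field.nonclassical_iff_determining[OF loc]
      unit_vector_field.determining_def[OF loc]
    using so Q det c by (auto simp: dom3_def)
  moreover have "\<not> equivalent_to_lie (coef P) (dom3 P) (oper P)"
  proof
    assume "equivalent_to_lie (coef P) (dom3 P) (oper P)"
    note N = lie_equivalent_necessary[OF _ _ _ dom3_def[of P] Q kd _ _ this, where \<xi>x = "\<lambda>t. \<xi>x" and \<xi>u = "\<lambda>t. \<xi>u"]
    obtain t where "t \<in> t_dom P" using ld(3,4) by blast
    then have "\<xi>u x u = 0" "x' \<in> x_dom P \<Longrightarrow> \<xi>x x u = \<xi>x x' u" if "x \<in> x_dom P" "u \<in> u_dom P" for x u x'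
      using N(1)[of t x u] N(2)[of t x u x'] dom \<xi> that by (auto simp: has_partials_def interval_domains_def ld(3))
    then show False using non_lie by blast
  qed
  ultimately show ?thesis
    using dom sc c k(2) Q by (auto simp: non_lie_pair_def)
qed

lemma smooth_on_projections:
  fixes S :: "(real \<times> real \<times> real) set"
  assumes "open S"
  shows "smooth_on S (\<lambda>p. fst (snd p))" "smooth_on S (\<lambda>p. snd (snd p))"
  by (intro smooth_on_bounded_linear assms bounded_linear_compose[OF _ bounded_linear_snd]
      bounded_linear_fst bounded_linear_snd)+

text \<open>Cases 1 to 4 at once, with \<kappa> = 1, -1, -1, 0. For \<eta> = 0 and \<xi> = b the
  determining equations reduce to b'' = 2 b b' and 2 b' k + b k' = 0, which follow from the Riccati
  equation and from b^2 k = c. Since b and b' have no zero, b' cannot be constant: its derivative is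
  2 b b'.\<close>

lemma riccati_pair:
  assumes dom: "interval_domains P" and ag: "agrees P k (\<lambda>x u. b x) (\<lambda>x u. 0)"
    and b: "\<And>x. x \<in> x_dom P \<Longrightarrow> (b has_field_derivative (b x)\<^sup>2 + \<kappa>) (at x)"
      "\<And>x. x \<in> x_dom P \<Longrightarrow> b x \<noteq> 0" "\<And>x. x \<in> x_dom P \<Longrightarrow> (b x)\<^sup>2 + \<kappa> \<noteq> 0"
    and k: "\<And>x. x \<in> x_dom P \<Longrightarrow> k x = c / (b x)\<^sup>2" "c \<noteq> 0"
  shows "non_lie_pair P"
proof -
  note ld = interval_domainsD[OF dom]
  have b1: "smooth_on (x_dom P) b"
    using b(1) by (intro smooth_on_riccati[OF ld(1), where \<alpha> = \<kappa> and \<beta> = 1 and l = "\<lambda>v. v"])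
      (simp add: has_field_derivative_def add.commute)
  have b3: "smooth_on (dom3 P) (\<lambda>p. b (fst (snd p)))"
  proof (rule smooth_on_riccati[OF ld(2), where \<alpha> = \<kappa> and \<beta> = 1 and l = "\<lambda>v. fst (snd v)"])
    fix p assume "p \<in> dom3 P"
    then have "fst (snd p) \<in> x_dom P" by (auto simp: dom3_def)
    from b(1)[OF this, unfolded has_field_derivative_def]
    show "((\<lambda>p. b (fst (snd p))) has_derivative (\<lambda>v. (\<kappa> + 1 * (b (fst (snd p)))\<^sup>2) * fst (snd v))) (at p)"
      using has_derivative_compose[OF has_derivative_fst[OF has_derivative_snd[OF has_derivative_ident]],
        of b _ p UNIV] by (simp add: add.commute)
  qed
  have "smooth_on (x_dom P) (\<lambda>x. c / (b x)\<^sup>2)"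
    using b(2) by (intro smooth_intros ld(1) b1) auto
  then have k1: "smooth_on (x_dom P) k"
    using smooth_on_cong[OF ld(1) k(1)] by simp
  have kd: "(k has_field_derivative - 2 * ((b x)\<^sup>2 + \<kappa>) * k x / b x) (at x)" if x: "x \<in> x_dom P" for x
  proof -
    have "((\<lambda>x. c / (b x)\<^sup>2) has_field_derivative - (c * (2 * b x * ((b x)\<^sup>2 + \<kappa>))) / ((b x)\<^sup>2)\<^sup>2) (at x)"
      using b(1,2)[OF x] by (auto intro!: derivative_eq_intros simp: power2_eq_square)
    moreover have "- (c * (2 * b x * ((b x)\<^sup>2 + \<kappa>))) / ((b x)\<^sup>2)\<^sup>2 = - 2 * ((b x)\<^sup>2 + \<kappa>) * k x / b x"
      unfolding k(1)[OF x] using b(2)[OF x] by (simp add: divide_simps power2_eq_square) (simp add: algebra_simps)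
    ultimately show ?thesis
      using has_field_derivative_transform_within_open[OF _ ld(1) x] k(1) by simp
  qed
  have bd: "((\<lambda>x. (b x)\<^sup>2 + \<kappa>) has_field_derivative 2 * b x * ((b x)\<^sup>2 + \<kappa>)) (at x)" if "x \<in> x_dom P" for x
    using b(1)[OF that] by (auto intro!: derivative_eq_intros)
  show ?thesis
  proof (rule non_lie_pairI[OF dom ag k1 _ kd b3 smooth_on_const])
    show "has_partials (dom3 P) (\<lambda>t x u. b x) (\<lambda>t x u. 0) (\<lambda>t x u. (b x)\<^sup>2 + \<kappa>) (\<lambda>t x u. 0)
        (\<lambda>t x u. 2 * b x * ((b x)\<^sup>2 + \<kappa>)) (\<lambda>t x u. 0) (\<lambda>t x u. 0) (\<lambda>t x u. 0)"
      using b(1) bd by (auto simp: has_partials_def ld(3))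
    show "has_partials (dom3 P) (\<lambda>t x u. 0) (\<lambda>t x u. 0) (\<lambda>t x u. 0) (\<lambda>t x u. 0) (\<lambda>t x u. 0) (\<lambda>t x u. 0)
        (\<lambda>t x u. 0) (\<lambda>t x u. 0)" by (rule has_partials_const)
    obtain t x u where p: "t \<in> t_dom P" "x \<in> x_dom P" "u \<in> u_dom P" using ld(3,4) by blast
    have "(b y)\<^sup>2 + \<kappa> \<noteq> (b x)\<^sup>2 + \<kappa>" if "\<forall>y\<in>x_dom P. (b y)\<^sup>2 + \<kappa> = (b x)\<^sup>2 + \<kappa>" for y
      using DERIV_locally_const[OF bd[OF p(2)], of "(b x)\<^sup>2 + \<kappa>"] b(2,3)[OF p(2)] that
        eventually_mono[OF eventually_nhds_in_open[OF ld(1) p(2)]] by simp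
    then show "\<not> (\<forall>x\<in>x_dom P. \<forall>u\<in>u_dom P. 0 = (0::real) \<and> (\<forall>x'\<in>x_dom P. (b x)\<^sup>2 + \<kappa> = (b x')\<^sup>2 + \<kappa>))"
      using p by metis
    show "k x \<noteq> 0" if "x \<in> x_dom P" for x using k b(2)[OF that] that by simp
  qed (use b k in \<open>auto simp: field_simps\<close>)
qed

text \<open>Both signs are treated together: s enters the determining equations only through s^2 = 1
  or as a common factor. A Lie symmetry is excluded by \<xi>_u = 3 s c / 2.\<close>

lemma quasilinear_const_pair:
  assumes dom: "interval_domains P" and c: "c > 0" and s: "s \<in> {1, - 1}"
    and ag: "agrees P (\<lambda>x. c\<^sup>2 / 2) (\<lambda>x u. s * (c / 2) * (3 * u - 1)) (\<lambda>x u. - (3 * c\<^sup>2 / 4) * u\<^sup>2 * (u - 1))"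
  shows "non_lie_pair P"
proof -
  note ld = interval_domainsD[OF dom]
  have s2: "s * s = 1" using s by auto
  show ?thesis
  proof (rule non_lie_pairI[OF dom ag smooth_on_const])
    show "smooth_on (dom3 P) (\<lambda>p. s * (c / 2) * (3 * snd (snd p) - 1))"
      "smooth_on (dom3 P) (\<lambda>p. - (3 * c\<^sup>2 / 4) * (snd (snd p))\<^sup>2 * (snd (snd p) - 1))"
      by (intro smooth_intros ld(2) smooth_on_projections)+
    show "has_partials (dom3 P) (\<lambda>t x u. s * (c / 2) * (3 * u - 1)) (\<lambda>t x u. 0) (\<lambda>t x u. 0)
        (\<lambda>t x u. s * (c / 2) * 3) (\<lambda>t x u. 0) (\<lambda>t x u. 0) (\<lambda>t x u. 0) (\<lambda>t x u. 0)"
      by (auto simp: has_partials_def intro!: derivative_eq_intros)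
    show "has_partials (dom3 P) (\<lambda>t x u. - (3 * c\<^sup>2 / 4) * u\<^sup>2 * (u - 1)) (\<lambda>t x u. 0) (\<lambda>t x u. 0)
        (\<lambda>t x u. - (3 * c\<^sup>2 / 4) * (3 * u\<^sup>2 - 2 * u)) (\<lambda>t x u. 0) (\<lambda>t x u. 0) (\<lambda>t x u. 0)
        (\<lambda>t x u. - (3 * c\<^sup>2 / 4) * (6 * u - 2))"
      by (auto simp: has_partials_def power2_eq_square field_simps intro!: derivative_eq_intros)
    fix x u :: real
    have "(s * c) * (s * c) = c * c" using s2 by (simp add: algebra_simps)
    then show "(0::real) = 0 \<and>
       - (3 * c\<^sup>2 / 4) * (6 * u - 2) = 0 + 0 - 2 * (s * (c / 2) * (3 * u - 1)) * (s * (c / 2) * 3) \<and>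
       0 - 0 - 0 - 2 * (s * (c / 2) * (3 * u - 1)) * 0 + 2 * (- (3 * c\<^sup>2 / 4) * u\<^sup>2 * (u - 1)) * (s * (c / 2) * 3) -
       3 * (s * (c / 2) * 3) * (c\<^sup>2 / 2 * u\<^sup>2 * (1 - u)) = 0 \<and>
       - 0 + 2 * 0 * (- (3 * c\<^sup>2 / 4) * u\<^sup>2 * (u - 1)) +
       (- (3 * c\<^sup>2 / 4) * (3 * u\<^sup>2 - 2 * u) - 2 * 0) * (c\<^sup>2 / 2 * u\<^sup>2 * (1 - u)) -
       s * (c / 2) * (3 * u - 1) * 0 * u\<^sup>2 * (1 - u) -
       - (3 * c\<^sup>2 / 4) * u\<^sup>2 * (u - 1) * (c\<^sup>2 / 2) * (2 * u - 3 * u\<^sup>2) = 0"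
      using s2 by algebra
    show "\<not> (\<forall>x\<in>x_dom P. \<forall>u\<in>u_dom P. s * (c / 2) * 3 = 0 \<and> (\<forall>x'\<in>x_dom P. (0::real) = 0))"
      using c s ld(3,4) by auto
  qed (use c in auto)
qed

lemma inverse_square_pair:
  assumes dom: "interval_domains P" and z: "0 \<notin> x_dom P"
    and ag: "agrees P (\<lambda>x. 2 / x\<^sup>2) (\<lambda>x u. 3 / x * (u - 1)) (\<lambda>x u. - (3 / x\<^sup>2) * u * (u - 1)\<^sup>2)"
  shows "non_lie_pair P"
proof -
  note ld = interval_domainsD[OF dom]
  have z: "x \<noteq> 0" if "x \<in> x_dom P" for x using z that by blast
  show ?thesis
  proof (rule non_lie_pairI[OF dom ag])
    show "smooth_on (x_dom P) (\<lambda>x::real. 2 / x\<^sup>2)"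
      using z by (intro smooth_intros ld(1) smooth_on_bounded_linear bounded_linear_ident) auto
    show "smooth_on (dom3 P) (\<lambda>p. 3 / fst (snd p) * (snd (snd p) - 1))"
      "smooth_on (dom3 P) (\<lambda>p. - (3 / (fst (snd p))\<^sup>2) * snd (snd p) * (snd (snd p) - 1)\<^sup>2)"
      using z by (intro smooth_intros ld(2) smooth_on_projections; force simp: dom3_def)+
    show "((\<lambda>x. 2 / x\<^sup>2) has_field_derivative - 4 / x ^ 3) (at x)" if "x \<in> x_dom P" for x :: real
      using z[OF that] by (auto intro!: derivative_eq_intros simp: field_simps eval_nat_numeral)
    show "has_partials (dom3 P) (\<lambda>t x u. 3 / x * (u - 1)) (\<lambda>t x u. 0) (\<lambda>t x u. - 3 / x\<^sup>2 * (u - 1))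
        (\<lambda>t x u. 3 / x) (\<lambda>t x u. 6 / x ^ 3 * (u - 1)) (\<lambda>t x u. - 3 / x\<^sup>2) (\<lambda>t x u. - 3 / x\<^sup>2) (\<lambda>t x u. 0)"
      using z by (auto simp: has_partials_def ld(3) field_simps eval_nat_numeral intro!: derivative_eq_intros)
    show "has_partials (dom3 P) (\<lambda>t x u. - (3 / x\<^sup>2) * u * (u - 1)\<^sup>2) (\<lambda>t x u. 0)
        (\<lambda>t x u. 6 / x ^ 3 * u * (u - 1)\<^sup>2) (\<lambda>t x u. - (3 / x\<^sup>2) * (3 * u\<^sup>2 - 4 * u + 1))
        (\<lambda>t x u. - 18 / x ^ 4 * u * (u - 1)\<^sup>2) (\<lambda>t x u. 6 / x ^ 3 * (3 * u\<^sup>2 - 4 * u + 1))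
        (\<lambda>t x u. 6 / x ^ 3 * (3 * u\<^sup>2 - 4 * u + 1)) (\<lambda>t x u. - (3 / x\<^sup>2) * (6 * u - 4))"
      using z by (auto simp: has_partials_def ld(3) field_simps eval_nat_numeral intro!: derivative_eq_intros)
    fix x u :: real
    assume "x \<in> x_dom P"
    then have "x \<noteq> 0" by (rule z)
    then show "0 = (0::real) \<and>
       - (3 / x\<^sup>2) * (6 * u - 4) = - 3 / x\<^sup>2 + - 3 / x\<^sup>2 - 2 * (3 / x * (u - 1)) * (3 / x) \<and>
       6 / x ^ 3 * (u - 1) - 6 / x ^ 3 * (3 * u\<^sup>2 - 4 * u + 1) - 6 / x ^ 3 * (3 * u\<^sup>2 - 4 * u + 1) -
       2 * (3 / x * (u - 1)) * (- 3 / x\<^sup>2 * (u - 1)) + 2 * (- (3 / x\<^sup>2) * u * (u - 1)\<^sup>2) * (3 / x) -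
       3 * (3 / x) * (2 / x\<^sup>2 * u\<^sup>2 * (1 - u)) = 0 \<and>
       - (- 18 / x ^ 4 * u * (u - 1)\<^sup>2) + 2 * (- 3 / x\<^sup>2 * (u - 1)) * (- (3 / x\<^sup>2) * u * (u - 1)\<^sup>2) +
       (- (3 / x\<^sup>2) * (3 * u\<^sup>2 - 4 * u + 1) - 2 * (- 3 / x\<^sup>2 * (u - 1))) * (2 / x\<^sup>2 * u\<^sup>2 * (1 - u)) -
       3 / x * (u - 1) * (- 4 / x ^ 3) * u\<^sup>2 * (1 - u) -
       - (3 / x\<^sup>2) * u * (u - 1)\<^sup>2 * (2 / x\<^sup>2) * (2 * u - 3 * u\<^sup>2) = 0"
      by (simp add: field_simps eval_nat_numeral)
  next
    show "\<not> (\<forall>x\<in>x_dom P. \<forall>u\<in>u_dom P. 3 / x = 0 \<and> (\<forall>x'\<in>x_dom P. - 3 / x\<^sup>2 * (u - 1) = - 3 / x'\<^sup>2 * (u - 1)))"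
      using z ld(3,4) by fastforce
  qed (use z in auto)
qed

lemma listed_non_lie_pair:
  assumes "listed P"
  shows "non_lie_pair P"
proof -
  have dom: "interval_domains P" using assms by (simp add: listed_def)
  from assms consider
      (tan) c where "c \<noteq> 0" "\<forall>x\<in>x_dom P. sin x \<noteq> 0 \<and> cos x \<noteq> 0"
        "agrees P (\<lambda>x. c * (tan x)\<^sup>2) (\<lambda>x u. - cot x) (\<lambda>x u. 0)"
    | (tanh) c where "c \<noteq> 0" "0 \<notin> x_dom P"
        "agrees P (\<lambda>x. c * (tanh x)\<^sup>2) (\<lambda>x u. - coth x) (\<lambda>x u. 0)"
    | (coth) c where "c \<noteq> 0" "0 \<notin> x_dom P"
        "agrees P (\<lambda>x. c * (coth x)\<^sup>2) (\<lambda>x u. - tanh x) (\<lambda>x u. 0)"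
    | (inv) c where "c \<noteq> 0" "0 \<notin> x_dom P"
        "agrees P (\<lambda>x. c * x\<^sup>2) (\<lambda>x u. - (1 / x)) (\<lambda>x u. 0)"
    | (const) c s where "c > 0" "s \<in> {1, - 1}" "agrees P (\<lambda>x. c\<^sup>2 / 2)
        (\<lambda>x u. s * (c / 2) * (3 * u - 1)) (\<lambda>x u. - (3 * c\<^sup>2 / 4) * u\<^sup>2 * (u - 1))"
    | (square) "0 \<notin> x_dom P" "agrees P (\<lambda>x. 2 / x\<^sup>2) (\<lambda>x u. 3 / x * (u - 1))
        (\<lambda>x u. - (3 / x\<^sup>2) * u * (u - 1)\<^sup>2)"
    unfolding listed_def by blast
  then show ?thesis
  proof cases
    case tan
    show ?thesis
    proof (rule riccati_pair[OF dom tan(3), where \<kappa> = 1 and c = c])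
      fix x assume "x \<in> x_dom P"
      then have x: "sin x \<noteq> 0" "cos x \<noteq> 0" using tan(2) by auto
      have "(- cot x)\<^sup>2 + 1 = inverse ((sin x)\<^sup>2)"
        using x sin_cos_squared_add2[of x] by (simp add: cot_def power_divide divide_simps)
      then show "((\<lambda>x. - cot x) has_field_derivative (- cot x)\<^sup>2 + 1) (at x)"
        using DERIV_minus[OF DERIV_cot[OF x(1)]] by simp
      show "- cot x \<noteq> 0" using x by (simp add: cot_def)
      show "(- cot x)\<^sup>2 + 1 \<noteq> 0" by (metis add_nonneg_pos less_irrefl zero_le_power2 zero_less_one)
      show "c * (tan x)\<^sup>2 = c / (- cot x)\<^sup>2"
        using x by (simp add: cot_def tan_def power_divide)
    qed (fact tan(1))
  next
    case tanh
    show ?thesis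
    proof (rule riccati_pair[OF dom tanh(3), where \<kappa> = "-1" and c = c])
      fix x assume "x \<in> x_dom P"
      then have x: "sinh x \<noteq> 0" "cosh x \<noteq> 0" using tanh(2) by auto
      have cs: "(cosh x)\<^sup>2 - (sinh x)\<^sup>2 = 1" using hyperbolic_pythagoras[of x] by simp
      show "((\<lambda>x. - coth x) has_field_derivative (- coth x)\<^sup>2 + - 1) (at x)" unfolding coth_def
        using x by (auto intro!: derivative_eq_intros simp: field_simps power2_eq_square)
      show "- coth x \<noteq> 0" using x by (simp add: coth_def)
      show "(- coth x)\<^sup>2 + - 1 \<noteq> 0" using cs x by (simp add: coth_def field_simps power2_eq_square)
      show "c * (tanh x)\<^sup>2 = c / (- coth x)\<^sup>2"
        using x by (simp add: coth_def tanh_def power_divide)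
    qed (fact tanh(1))
  next
    case coth
    show ?thesis
    proof (rule riccati_pair[OF dom coth(3), where \<kappa> = "-1" and c = c])
      fix x assume "x \<in> x_dom P"
      then have x: "sinh x \<noteq> 0" "cosh x \<noteq> 0" using coth(2) by auto
      have cs: "(cosh x)\<^sup>2 - (sinh x)\<^sup>2 = 1" using hyperbolic_pythagoras[of x] by simp
      show "((\<lambda>x. - tanh x) has_field_derivative (- tanh x)\<^sup>2 + - 1) (at x)"
        using x by (auto intro!: derivative_eq_intros)
      show "- tanh x \<noteq> 0" using x by (simp add: tanh_def)
      show "(- tanh x)\<^sup>2 + - 1 \<noteq> 0" using cs x by (simp add: tanh_def field_simps power2_eq_square)
      show "c * (coth x)\<^sup>2 = c / (- tanh x)\<^sup>2"
        using x by (simp add: coth_def tanh_def power_divide)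
    qed (fact coth(1))
  next
    case inv
    show ?thesis
    proof (rule riccati_pair[OF dom inv(3), where \<kappa> = 0 and c = c])
      fix x assume "x \<in> x_dom P"
      then have x: "x \<noteq> 0" using inv(2) by auto
      then show "((\<lambda>x. - (1 / x)) has_field_derivative (- (1 / x))\<^sup>2 + 0) (at x)"
        by (auto intro!: derivative_eq_intros simp: field_simps power2_eq_square)
      show "c * x\<^sup>2 = c / (- (1 / x))\<^sup>2"
        using x by (simp add: power_divide)
    qed (use inv in auto)
  next
    case const
    then show ?thesis using quasilinear_const_pair[OF dom] by blast
  next
    case square
    then show ?thesis using inverse_square_pair[OF dom] by blast
  qed
qed

section \<open>Rigidity of the coefficient of a quasilinear reduction\<close>

text \<open>Up to a constant, \<open>R1\<close>, \<dots>, \<open>R5\<close> are the successive images of \<open>R0\<close> under the derivation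
  \<open>D p = g\<close>, \<open>D g = p g + l\<close>, \<open>D l = 2 p l + f\<close> with
  \<open>f = 4 p\<^sup>4 - 4 p\<^sup>2 g - 20 p\<^sup>2 / 3 + 8 p / 3 + g\<^sup>2 + 4 g / 3\<close>. The cofactors in \<open>elimination\<close> come from
  solving the linear system for their coefficients and shortening the solution by lattice reduction.\<close>

definition R0 :: "real \<Rightarrow> real \<Rightarrow> real \<Rightarrow> real" where
  "R0 p g l =
     - 144 * p^5 + 270 * p^3 * g - 99 * p * g^2 - 54 * p^2 * l + 27 * g * l + 216 * p^3 - 138 * p * g
     + 6 * l - 64 * p^2 + 20 * g - 8 * p"

definition R1 :: "real \<Rightarrow> real \<Rightarrow> real \<Rightarrow> real" where
  "R1 p g l =
     - 216 * p^6 - 126 * p^4 * g + 450 * p^2 * g^2 - 72 * g^3 + 162 * p^3 * l - 225 * p * g * l + 27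
     * l^2 + 384 * p^4 + 234 * p^2 * g - 96 * g^2 - 126 * p * l - 144 * p^3 - 36 * p * g + 20 * l -
     40 * p^2 + 16 * p"

definition R2 :: "real \<Rightarrow> real \<Rightarrow> real \<Rightarrow> real" where
  "R2 p g l =
     1944 * p^7 - 8910 * p^5 * g + 4374 * p^3 * g^2 + 1377 * p * g^3 + 1242 * p^4 * l + 1485 * p^2 *
     g * l - 1161 * g^2 * l - 351 * p * l^2 - 4752 * p^5 + 11970 * p^3 * g - 450 * p * g^2 - 1134 *
     p^2 * l - 738 * g * l + 1536 * p^4 - 3444 * p^2 * g - 48 * g^2 + 444 * p * l + 2520 * p^3 - 744
     * p * g - 1408 * p^2 + 128 * g + 160 * p"

definition R3 :: "real \<Rightarrow> real \<Rightarrow> real \<Rightarrow> real" where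
  "R3 p g l =
     4968 * p^8 + 5670 * p^6 * g - 45144 * p^4 * g^2 + 23382 * p^2 * g^3 + 216 * g^4 - 9234 * p^5 * l
     + 20979 * p^3 * g * l + 1755 * p * g^2 * l + 81 * p^2 * l^2 - 2673 * g * l^2 - 12816 * p^6 -
     18450 * p^4 * g + 46548 * p^2 * g^2 - 2736 * g^3 + 14382 * p^3 * l - 6318 * p * g * l - 738 *
     l^2 + 5088 * p^5 + 4884 * p^3 * g - 9636 * p * g^2 - 4428 * p^2 * l + 348 * g * l + 7560 * p^4 +
     10224 * p^2 * g - 1728 * g^2 - 744 * p * l - 5984 * p^3 - 4064 * p * g + 128 * l + 1184 * p^2 +
     160 * g"

definition R4 :: "real \<Rightarrow> real \<Rightarrow> real \<Rightarrow> real" where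
  "R4 p g l =
     - 110808 * p^9 + 498798 * p^7 * g - 427194 * p^5 * g^2 - 289413 * p^3 * g^3 + 148149 * p * g^4 -
     36450 * p^6 * l - 286659 * p^4 * g * l + 484947 * p^2 * g^2 * l - 8181 * g^3 * l + 63909 * p^3 *
     l^2 - 29079 * p * g * l^2 - 8019 * l^3 + 357264 * p^7 - 990954 * p^5 * g + 225666 * p^3 * g^2 +
     242730 * p * g^3 + 9990 * p^4 * l + 477144 * p^2 * g * l - 69390 * g^2 * l - 27810 * p * l^2 -
     127008 * p^6 + 316116 * p^4 * g - 17280 * p^2 * g^2 - 27864 * g^3 - 10620 * p^3 * l - 124020 * p
     * g * l + 1044 * l^2 - 296568 * p^5 + 314208 * p^3 * g + 23472 * p * g^2 + 55728 * p^2 * l -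
     18504 * g * l + 205152 * p^4 - 142800 * p^2 * g - 10416 * g^2 - 23232 * p * l - 20544 * p^3 +
     7392 * p * g + 480 * l - 8512 * p^2 + 512 * g + 1024 * p"

definition R5 :: "real \<Rightarrow> real \<Rightarrow> real \<Rightarrow> real" where
  "R5 p g l =
     - 145800 * p^10 - 1499310 * p^8 * g + 5687172 * p^6 * g^2 - 5263380 * p^4 * g^3 + 242028 * p^2 *
     g^4 + 139968 * g^5 + 937170 * p^7 * l - 2676969 * p^5 * g * l + 285363 * p^3 * g^2 * l + 1463427
     * p * g^3 * l - 127251 * p^4 * l^2 + 1112454 * p^2 * g * l^2 - 77679 * g^2 * l^2 - 77193 * p *
     l^3 + 282960 * p^8 + 5240970 * p^6 * g - 10294776 * p^4 * g^2 + 2861028 * p^2 * g^3 + 162432 *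
     g^4 - 2045574 * p^5 * l + 2703348 * p^3 * g * l + 1271754 * p * g^2 * l + 526284 * p^2 * l^2 -
     198666 * g * l^2 - 139680 * p^7 - 1663956 * p^5 * g + 3008556 * p^3 * g^2 - 263988 * p * g^3 +
     644076 * p^4 * l - 601920 * p^2 * g * l - 205524 * g^2 * l - 183996 * p * l^2 + 156312 * p^6 -
     4633200 * p^4 * g + 2218104 * p^2 * g^2 - 87552 * g^3 + 796464 * p^3 * l + 28728 * p * g * l -
     18504 * l^2 + 4512 * p^5 + 2855760 * p^3 * g - 680064 * p * g^2 - 351504 * p^2 * l - 41280 * g *
     l - 397920 * p^4 - 189216 * p^2 * g - 16800 * g^2 + 13920 * p * l + 303488 * p^3 - 96832 * p * g
     + 512 * l - 65152 * p^2 + 1664 * g + 1280 * p"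

lemma elimination:
  "945816092928 * (p * (p - 1) ^ 3) =
      (5872348648152 * p^9 + 1215313451946 * p^7 * g - 3774794656968 * p^5 * g^2 + 5764341667743 * p^3
        * g^3 - 15171570801900 * p * g^4 + 9601272869382 * p^6 * l - 2800566714276 * p^4 * g * l +
        6258083245731 * p^2 * g^2 * l + 571629819384 * g^3 * l - 8399866582332 * p^3 * l^2 +
        321135069285 * p * g * l^2 + 121378535721 * l^3 + 10710569802096 * p^8 + 1507492763676 * p^6 * g
        + 4285756596672 * p^4 * g^2 + 8178178238622 * p^2 * g^3 - 3701572382286 * g^4 + 7618501182960 *
        p^5 * l - 13509925605009 * p^3 * g * l - 2196649105533 * p * g^2 * l + 487645549533 * p^2 * l^2
        - 462855353463 * g * l^2 - 5115891782640 * p^7 - 3304761960744 * p^5 * g - 5040196894329 * p^3 *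
        g^2 - 4415100740271 * p * g^3 - 6451002674352 * p^4 * l + 6708529683963 * p^2 * g * l -
        7751230708707 * g^2 * l - 196732226286 * p * l^2 - 7567555491768 * p^6 - 4518986759370 * p^4 * g
        + 992000387883 * p^2 * g^2 + 2563179545538 * g^3 - 6069492310906 * p^3 * l + 3095342756997 * p *
        g * l + 149368272570 * l^2 + 3457274574176 * p^5 + 1296182035986 * p^3 * g - 15155113050888 * p
        * g^2 - 1212594860878 * p^2 * l - 1475360060856 * g * l - 3599112438840 * p^4 + 4383222416550 *
        p^2 * g + 3999268458432 * g^2 + 5068446886854 * p * l + 2496583320808 * p^3 - 4149838310460 * p
        * g - 560817145716 * l + 1143294545344 * p^2 + 303067940152 * g - 1088703946480 * p +
        79757315712)
        * R0 p g l
      + (486356505012 * p^8 - 8325930567897 * p^6 * g - 10095854104242 * p^4 * g^2 - 7382815521354 * p^2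
        * g^3 + 2517508846530 * g^4 + 2395718760069 * p^5 * l + 6384557294973 * p^3 * g * l +
        9036499218426 * p * g^2 * l - 1673460931257 * p^2 * l^2 - 934174664712 * g * l^2 - 3596504393196
        * p^7 - 10457957568897 * p^5 * g - 8912054128743 * p^3 * g^2 + 1113298705422 * p * g^3 +
        1939078202157 * p^4 * l - 2995349115618 * p^2 * g * l + 3696170250366 * g^2 * l + 724690433637 *
        p * l^2 - 5520890841372 * p^6 - 5111996009856 * p^4 * g - 14146839181566 * p^2 * g^2 +
        4073614323984 * g^3 + 2315761016052 * p^3 * l + 4512525362406 * p * g * l - 227876666742 * l^2 +
        5236639218376 * p^5 + 759923157562 * p^3 * g - 854973151002 * p * g^2 + 1129856935080 * p^2 * l
        + 1079438281092 * g * l + 1731830854416 * p^4 + 5112241750798 * p^2 * g + 4122632044980 * g^2 -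
        766744917654 * p * l - 3666337590500 * p^3 - 3471763822216 * p * g + 93841364388 * l +
        1374906247880 * p^2 + 1119366829132 * g - 91154741080 * p + 17360986416)
        * R1 p g l
      + (418787243208 * p^7 + 98182496763 * p^5 * g + 263030644539 * p^3 * g^2 + 585888274251 * p * g^3 -
        85153022793 * p^4 * l - 793993663170 * p^2 * g * l + 151577730810 * g^2 * l + 57947981580 * p *
        l^2 + 575615189916 * p^6 + 819731245230 * p^4 * g + 1279515078909 * p^2 * g^2 - 325835239599 *
        g^3 + 635625332892 * p^3 * l - 686970039033 * p * g * l + 58526472483 * l^2 + 271842433650 * p^5
        + 1135272484470 * p^3 * g + 2527982538588 * p * g^2 - 12570196326 * p^2 * l + 63144954513 * g *
        l + 60461885164 * p^4 - 189197684630 * p^2 * g - 407457893565 * g^2 - 281578314681 * p * l -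
        436587353668 * p^3 + 672161330238 * p * g + 31217087730 * l - 1341457430 * p^2 - 31984415078 * g
        + 122415518000 * p - 6274406672)
        * R2 p g l
      + (3499245369 * p^6 + 10731619422 * p^4 * g + 212745294711 * p^2 * g^2 - 51066860346 * g^3 +
        125563567473 * p^3 * l + 150274350792 * p * g * l - 9126412965 * l^2 - 58256200521 * p^5 -
        297580080042 * p^3 * g + 21654503073 * p * g^2 + 28018486386 * p^2 * l + 4850971200 * g * l -
        200038502394 * p^4 - 205470292047 * p^2 * g - 197122145724 * g^2 + 50653156062 * p * l +
        35133091006 * p^3 + 138774218407 * p * g - 3238055337 * l + 59344715836 * p^2 - 63515252008 * g
        - 31876021472 * p - 7815990744)
        * R3 p g l
      + (- 1553064192 * p^5 - 17149272129 * p^3 * g - 23008996971 * p * g^2 - 6877787598 * p^2 * l +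
        305450352 * g * l + 464679936 * p^4 + 1351699002 * p^2 * g + 1094919849 * g^2 + 175258323 * p *
        l + 4060247724 * p^3 - 8613950157 * p * g + 163473498 * l - 2338446060 * p^2 - 2581418853 * g -
        1055000838 * p + 104183318)
        * R4 p g l
      + (363013569 * p^4 + 1794364083 * p^2 * g + 1373821722 * g^2 - 228827592 * p * l + 86500467 * p^3 -
        32233707 * p * g - 30851847 * l - 122821596 * p^2 + 1533835764 * g + 39479886 * p + 243506250)
        * R5 p g l"
  unfolding R0_def R1_def R2_def R3_def R4_def R5_def by algebra

text \<open>Vanishing of a polynomial in p, g, l along the solution is inherited by its image under
  D, because the derivative is v times that image and v has no zero. After five steps
  \<open>elimination\<close> leaves p = 0 or p = 1 at every point, and continuity makes the choice
  uniform.\<close>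

lemma p_rigid:
  fixes p g l v :: "real \<Rightarrow> real"
  assumes X: "open_interval X" and v: "\<And>x. x \<in> X \<Longrightarrow> v x \<noteq> 0"
    and p: "\<And>x. x \<in> X \<Longrightarrow> (p has_field_derivative v x * g x) (at x)"
    and g: "\<And>x. x \<in> X \<Longrightarrow> (g has_field_derivative v x * (p x * g x + l x)) (at x)"
    and l: "\<And>x. x \<in> X \<Longrightarrow> (l has_field_derivative v x * (2 * p x * l x
      + (4 * p x ^ 4 - 4 * (p x)\<^sup>2 * g x - 20 / 3 * (p x)\<^sup>2 + 8 / 3 * p x + (g x)\<^sup>2 + 4 / 3 * g x))) (at x)"
    and R0: "\<And>x. x \<in> X \<Longrightarrow> R0 (p x) (g x) (l x) = 0"
  shows "(\<forall>x\<in>X. p x = 0) \<or> (\<forall>x\<in>X. p x = 1)"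
proof -
  have op: "open X" and con: "connected X"
    using X by (auto simp: open_interval_def is_interval_connected)
  \<comment> \<open>The power rule leaves exponents of the form n - Suc 0 and numerals under
    \<open>real\<close>; both are evaluated before the polynomial identity is checked.\<close>
  have num: "2 - Suc 0 = 1" "3 - Suc 0 = 2" "4 - Suc 0 = 3" "5 - Suc 0 = 4" "6 - Suc 0 = 5" "7 - Suc 0 = 6"
      "8 - Suc 0 = 7" "9 - Suc 0 = 8" "10 - Suc 0 = 9" "real (numeral n) = numeral n" for n
    by simp_all
  have step: "R' (p x) (g x) (l x) = 0"
    if R: "\<And>x. x \<in> X \<Longrightarrow> R (p x) (g x) (l x) = 0" and x: "x \<in> X"
      and D: "\<And>x. x \<in> X \<Longrightarrow> ((\<lambda>x. R (p x) (g x) (l x)) has_field_derivative c * (v x * R' (p x) (g x) (l x))) (at x)"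
      and c: "c \<noteq> 0"
    for R R' :: "real \<Rightarrow> real \<Rightarrow> real \<Rightarrow> real" and c x
    using DERIV_locally_const[OF D[OF x], of 0] eventually_mono[OF eventually_nhds_in_open[OF op x]] R x v[OF x] c
    by simp
  have R1: "R1 (p x) (g x) (l x) = 0" if "x \<in> X" for x
  proof (rule step[where R = R0 and R' = R1 and c = "1 / 1", OF R0 that])
    show "((\<lambda>x. R0 (p x) (g x) (l x)) has_field_derivative 1 / 1 * (v x * R1 (p x) (g x) (l x))) (at x)"
      if "x \<in> X" for x
      unfolding R0_def
      by (rule DERIV_cong, (rule derivative_intros p that g l)+)
        (unfold R1_def, simp only: num, algebra)
  qed auto
  have R2: "R2 (p x) (g x) (l x) = 0" if "x \<in> X" for x
  \<comment> \<open>\<open>R2\<close> is 3 D \<open>R1\<close>; the factor clears the thirds that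
    enter through D l. The same happens for \<open>R4\<close>.\<close>
  proof (rule step[where R = R1 and R' = R2 and c = "1 / 3", OF R1 that])
    show "((\<lambda>x. R1 (p x) (g x) (l x)) has_field_derivative 1 / 3 * (v x * R2 (p x) (g x) (l x))) (at x)"
      if "x \<in> X" for x
      unfolding R1_def
      by (rule DERIV_cong, (rule derivative_intros p that g l)+)
        (unfold R2_def, simp only: num, algebra)
  qed auto
  have R3: "R3 (p x) (g x) (l x) = 0" if "x \<in> X" for x
  proof (rule step[where R = R2 and R' = R3 and c = "1 / 1", OF R2 that])
    show "((\<lambda>x. R2 (p x) (g x) (l x)) has_field_derivative 1 / 1 * (v x * R3 (p x) (g x) (l x))) (at x)"
      if "x \<in> X" for x
      unfolding R2_def
      by (rule DERIV_cong, (rule derivative_intros p that g l)+)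
        (unfold R3_def, simp only: num, algebra)
  qed auto
  have R4: "R4 (p x) (g x) (l x) = 0" if "x \<in> X" for x
  proof (rule step[where R = R3 and R' = R4 and c = "1 / 3", OF R3 that])
    show "((\<lambda>x. R3 (p x) (g x) (l x)) has_field_derivative 1 / 3 * (v x * R4 (p x) (g x) (l x))) (at x)"
      if "x \<in> X" for x
      unfolding R3_def
      by (rule DERIV_cong, (rule derivative_intros p that g l)+)
        (unfold R4_def, simp only: num, algebra)
  qed auto
  have R5: "R5 (p x) (g x) (l x) = 0" if "x \<in> X" for x
  proof (rule step[where R = R4 and R' = R5 and c = "1 / 1", OF R4 that])
    show "((\<lambda>x. R4 (p x) (g x) (l x)) has_field_derivative 1 / 1 * (v x * R5 (p x) (g x) (l x))) (at x)"
      if "x \<in> X" for x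
      unfolding R4_def
      by (rule DERIV_cong, (rule derivative_intros p that g l)+)
        (unfold R5_def, simp only: num, algebra)
  qed auto
  have zero: "p x = 0 \<or> p x = 1" if "x \<in> X" for x
    using elimination[of "p x" "g x" "l x"] R0[OF that] R1[OF that] R2[OF that] R3[OF that] R4[OF that]
      R5[OF that] by auto
  have "continuous_on X p"
    using p by (intro continuous_at_imp_continuous_on) (blast intro: DERIV_isCont)
  moreover have "finite (p ` X)"
    by (rule finite_subset[of _ "{0, 1}"]) (use zero in auto)
  ultimately have "p constant_on X"
    using continuous_finite_range_constant[OF con] by blast
  then show ?thesis using zero unfolding constant_on_def by metis
qed

section \<open>Reduction of the equations for a, b, m, n to one relation\<close>

lemma deriv_on_open:
  fixes f F :: "real \<Rightarrow> real"
  assumes "open X" "x \<in> X" "\<And>y. y \<in> X \<Longrightarrow> f y = F y" "(F has_field_derivative d) (at x)"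
  shows "deriv f x = d"
  using has_field_derivative_transform_within_open[OF assms(4,1,2)] assms(3) by (simp add: DERIV_imp_deriv)

text \<open>In terms of \<open>h = 3 / a\<close>, the functions below are \<open>v = 1 / h\<close>, \<open>p = h'\<close>, \<open>g = h h''\<close> and
  \<open>l = h\<^sup>2 h'''\<close>; the system expresses \<open>b\<close>, \<open>m\<close>, \<open>n\<close> and \<open>h\<^sup>3 h''''\<close> as polynomials in them, up to
  powers of \<open>v\<close>, and leaves the single relation \<open>R0 = 0\<close>.\<close>

lemma quasilinear_rigid:
  fixes a b m n k :: "real \<Rightarrow> real"
  assumes X: "open_interval X" and sa: "smooth_on X a"
    and a0: "\<And>x. x \<in> X \<Longrightarrow> a x \<noteq> 0" and k: "\<And>x. x \<in> X \<Longrightarrow> 9 * k x = 2 * (a x)\<^sup>2"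
    and e2: "\<And>x. x \<in> X \<Longrightarrow> 2 * a x * deriv a x + 2 * a x * (deriv a x - a x * b x) - 3 * a x * k x = 0"
    and e1: "\<And>x. x \<in> X \<Longrightarrow> deriv (deriv a) x
      - 4 * (deriv (deriv a) x - (deriv a x * b x + a x * deriv b x))
      - 2 * (a x * deriv b x + b x * deriv a x) + 2 * a x * m x = 0"
    and e0: "\<And>x. x \<in> X \<Longrightarrow> deriv (deriv b) x - 2 * deriv m x - 2 * b x * deriv b x + 2 * a x * n x = 0"
    and u1: "\<And>x. x \<in> X \<Longrightarrow> - deriv (deriv m) x + 2 * deriv a x * n x + 2 * deriv b x * m x - 2 * k x * n x = 0"
    and u0: "\<And>x. x \<in> X \<Longrightarrow> - deriv (deriv n) x + 2 * deriv b x * n x = 0"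
  obtains "\<And>x y. x \<in> X \<Longrightarrow> y \<in> X \<Longrightarrow> a x = a y" "\<And>x. x \<in> X \<Longrightarrow> b x = - a x / 3"
      "\<And>x. x \<in> X \<Longrightarrow> m x = 0" "\<And>x. x \<in> X \<Longrightarrow> n x = 0"
  | \<delta> where "\<And>x. x \<in> X \<Longrightarrow> x + \<delta> \<noteq> 0" "\<And>x. x \<in> X \<Longrightarrow> a x = 3 / (x + \<delta>)"
      "\<And>x. x \<in> X \<Longrightarrow> b x = - 3 / (x + \<delta>)" "\<And>x. x \<in> X \<Longrightarrow> m x = - 3 / (x + \<delta>)\<^sup>2" "\<And>x. x \<in> X \<Longrightarrow> n x = 0"
proof -
  have op: "open X" and iv: "is_interval X" and ne: "X \<noteq> {}" using X by (auto simp: open_interval_def)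
  define v where "v x = a x / 3" for x
  have v0: "v x \<noteq> 0" if "x \<in> X" for x using a0[OF that] by (simp add: v_def)
  have sv: "smooth_on X v" unfolding v_def[abs_def] by (intro smooth_intros op sa) simp
  define p where "p x = - deriv v x / (v x)\<^sup>2" for x
  have sp: "smooth_on X p" unfolding p_def[abs_def]
    using v0 by (intro smooth_intros op sv smooth_on_real_deriv) auto
  define g where "g x = deriv p x / v x" for x
  have sg: "smooth_on X g" unfolding g_def[abs_def]
    using v0 by (intro smooth_intros op sv sp smooth_on_real_deriv) auto
  define l where "l x = deriv g x / v x - p x * g x" for x
  have sl: "smooth_on X l" unfolding l_def[abs_def]
    using v0 by (intro smooth_intros op sv sp sg smooth_on_real_deriv) auto
  \<comment> \<open>This \<open>f\<close> is the whole of D l, that is 2 p l + h^3 h'''', and not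
    just its last term.\<close>
  define f where "f x = deriv l x / v x" for x
  have dv: "(v has_field_derivative - p x * (v x)\<^sup>2) (at x)" if "x \<in> X" for x
    using smooth_on_real_deriv(1)[OF op sv that] v0[OF that] by (simp add: p_def)
  have dp: "(p has_field_derivative v x * g x) (at x)" if "x \<in> X" for x
    using smooth_on_real_deriv(1)[OF op sp that] v0[OF that] by (simp add: g_def)
  have dg: "(g has_field_derivative v x * (p x * g x + l x)) (at x)" if "x \<in> X" for x
    using smooth_on_real_deriv(1)[OF op sg that] v0[OF that] by (simp add: l_def)
  have dl: "(l has_field_derivative v x * f x) (at x)" if "x \<in> X" for x
    using smooth_on_real_deriv(1)[OF op sl that] v0[OF that] by (simp add: f_def)
  have num: "2 - Suc 0 = 1" "3 - Suc 0 = 2" "4 - Suc 0 = 3" "real (numeral n) = numeral n" for n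
    by simp_all
  have a: "a x = 3 * v x" for x by (simp add: v_def)
  have k: "k x = 2 * (v x)\<^sup>2" if "x \<in> X" for x
    using k[OF that] by (simp add: a power2_eq_square)
  have a1: "deriv a x = - 3 * p x * (v x)\<^sup>2" if "x \<in> X" for x
    by (rule deriv_on_open[OF op that a], rule DERIV_cong, (rule derivative_intros dv that)+) simp
  have a2: "deriv (deriv a) x = - 3 * (v x)^3 * (g x - 2 * (p x)\<^sup>2)" if "x \<in> X" for x
    by (rule deriv_on_open[OF op that a1], assumption, rule DERIV_cong, (rule derivative_intros dv dp that)+)
      ((simp only: num)?, algebra)
  \<comment> \<open>The equations are triangular: \<open>e2\<close> is linear in b,
    \<open>e1\<close> in m, \<open>e0\<close> in n and \<open>u1\<close> in \<open>f\<close>, each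
    time with a nonzero multiple of a power of v as coefficient. Only \<open>u0\<close> is left over
    as a relation.\<close>
  have b: "b x = - (2 * p x + 1) * v x" if "x \<in> X" for x
  proof -
    have "18 * (v x)\<^sup>2 * (b x - - (2 * p x + 1) * v x) = 0"
      using e2[OF that] unfolding a a1[OF that] k[OF that] by algebra
    then show ?thesis using v0[OF that] by simp
  qed
  have b1: "deriv b x = (v x)\<^sup>2 * (- 2 * g x + 2 * (p x)\<^sup>2 + p x)" if "x \<in> X" for x
    by (rule deriv_on_open[OF op that b], assumption, rule DERIV_cong, (rule derivative_intros dv dp that)+)
      ((simp only: num)?, algebra)
  have b2: "deriv (deriv b) x = (v x)^3 * (6 * p x * g x - 2 * l x + g x - 4 * (p x)^3 - 2 * (p x)\<^sup>2)" if "x \<in> X" for x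
    by (rule deriv_on_open[OF op that b1], assumption, rule DERIV_cong, (rule derivative_intros dv dp dg that)+)
      ((simp only: num)?, algebra)
  have m: "m x = (v x)\<^sup>2 * (g x * (1 / 2) - (p x)\<^sup>2 - 2 * p x)" if "x \<in> X" for x
  proof -
    have "6 * v x * (m x - (v x)\<^sup>2 * (g x * (1 / 2) - (p x)\<^sup>2 - 2 * p x)) = 0"
      using e1[OF that] unfolding a a1[OF that] a2[OF that] b1[OF that] b[OF that] by algebra
    then show ?thesis using v0[OF that] by simp
  qed
  have m1: "deriv m x = (v x)^3 * (1 / 2 * l x - 5 / 2 * p x * g x - 2 * g x + 2 * (p x)^3 + 4 * (p x)\<^sup>2)" if "x \<in> X" for x
    by (rule deriv_on_open[OF op that m], assumption, rule DERIV_cong, (rule derivative_intros dv dp dg that)+)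
      ((simp only: num)?, algebra)
  have m2: "deriv (deriv m) x = (v x)^4 * (1 / 2 * f x - 5 / 2 * ((g x)\<^sup>2 + p x * (p x * g x + l x))
      - 2 * (p x * g x + l x) + 6 * (p x)\<^sup>2 * g x + 8 * p x * g x
      - 3 * p x * (1 / 2 * l x - 5 / 2 * p x * g x - 2 * g x + 2 * (p x)^3 + 4 * (p x)\<^sup>2))" if "x \<in> X" for x
    by (rule deriv_on_open[OF op that m1], assumption, rule DERIV_cong, (rule derivative_intros dv dp dg dl that)+)
      ((simp only: num)?, algebra)
  have n: "n x = (v x)\<^sup>2 * (1 / 6 * (3 * l x - 3 * p x * g x - g x + 2 * (p x)\<^sup>2 - 2 * p x))" if "x \<in> X" for x
  proof -
    have "6 * v x * (n x - (v x)\<^sup>2 * (1 / 6 * (3 * l x - 3 * p x * g x - g x + 2 * (p x)\<^sup>2 - 2 * p x))) = 0"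
      using e0[OF that] unfolding a b2[OF that] m1[OF that] b1[OF that] b[OF that] by algebra
    then show ?thesis using v0[OF that] by simp
  qed
  have f: "f x = 2 * p x * l x + (4 * p x ^ 4 - 4 * (p x)\<^sup>2 * g x - 20 / 3 * (p x)\<^sup>2 + 8 / 3 * p x
      + (g x)\<^sup>2 + 4 / 3 * g x)" if "x \<in> X" for x
  proof -
    have "(v x)^4 * (f x - (2 * p x * l x + (4 * p x ^ 4 - 4 * (p x)\<^sup>2 * g x - 20 / 3 * (p x)\<^sup>2 + 8 / 3 * p x
      + (g x)\<^sup>2 + 4 / 3 * g x))) = 0"
      using u1[OF that] unfolding a1[OF that] m2[OF that] b1[OF that] n[OF that] m[OF that] k[OF that] by algebra
    then show ?thesis using v0[OF that] by simp
  qed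
  \<comment> \<open>With \<open>f\<close> replaced by its polynomial, the two derivatives of n
    introduce no new unknown.\<close>
  have dl': "(l has_field_derivative v x * (2 * p x * l x + (4 * p x ^ 4 - 4 * (p x)\<^sup>2 * g x
      - 20 / 3 * (p x)\<^sup>2 + 8 / 3 * p x + (g x)\<^sup>2 + 4 / 3 * g x))) (at x)" if "x \<in> X" for x
    using dl[OF that] f[OF that] by simp
  have n1: "deriv n x = (v x)^3 * (1 / 6 * (12 * p x ^ 4 - 9 * (p x)\<^sup>2 * g x - 3 * p x * l x + 5 * p x * g x
      - l x - 4 * (p x)^3 + 2 * g x - 16 * (p x)\<^sup>2 + 8 * p x))" if "x \<in> X" for x
    by (rule deriv_on_open[OF op that n], assumption, rule DERIV_cong, (rule derivative_intros dv dp dg dl' that)+)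
      ((simp only: num)?, algebra)
  have n2: "deriv (deriv n) x = (v x)^4 * (1 / 6 * (- 21 * p x * (g x)\<^sup>2 - 3 * g x * l x + 78 * (p x)^3 * g x
      - 6 * (p x)\<^sup>2 * l x - 48 * p x ^ 5 + 4 * (g x)\<^sup>2 - 18 * (p x)\<^sup>2 * g x + 6 * p x * l x + 8 * p x ^ 4
      - 40 * p x * g x + 2 * l x + 68 * (p x)^3 + 20 / 3 * g x - 76 / 3 * (p x)\<^sup>2 - 8 / 3 * p x))" if "x \<in> X" for x
    by (rule deriv_on_open[OF op that n1], assumption, rule DERIV_cong, (rule derivative_intros dv dp dg dl' that)+)
      ((simp only: num)?, algebra)
  have R0: "R0 (p x) (g x) (l x) = 0" if "x \<in> X" for x
  proof -
    \<comment> \<open>\<open>R0\<close> is the left side of \<open>u0\<close> times -18 / v^4, a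
      factor that makes the coefficients integers.\<close>
    have "v x ^ 4 * R0 (p x) (g x) (l x) = 0"
      using u0[OF that] unfolding n2[OF that] b1[OF that] n[OF that] R0_def by algebra
    then show ?thesis using v0[OF that] by simp
  qed
  have const: "g x = 0 \<and> l x = 0" if c: "\<And>x. x \<in> X \<Longrightarrow> p x = c" and x: "x \<in> X" for c x
  proof -
    have "g x = 0" if "x \<in> X" for x
      using DERIV_locally_const[OF dp[OF that], of c] eventually_mono[OF eventually_nhds_in_open[OF op that] c]
        v0[OF that] by simp
    moreover from this have "l x = 0"
      using DERIV_locally_const[OF dg[OF x], of 0] eventually_mono[OF eventually_nhds_in_open[OF op x]] v0[OF x] x
      by simp
    ultimately show ?thesis using x by simp
  qed
  from p_rigid[OF X v0 dp dg dl' R0] consider "\<And>x. x \<in> X \<Longrightarrow> p x = 0" | "\<And>x. x \<in> X \<Longrightarrow> p x = 1" by blast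
  then show thesis
  proof cases
    case 1
    have "(v has_field_derivative 0) (at z)" if "z \<in> X" for z
      using dv[OF that] 1[OF that] by simp
    from DERIV_zero_interval[OF iv this] have ac: "a x = a y" if "x \<in> X" "y \<in> X" for x y
      unfolding a using that by (intro arg_cong[where f = "\<lambda>z. 3 * z"])
    show thesis
    proof (rule that(1))
      fix x assume x: "x \<in> X"
      show "b x = - a x / 3" "m x = 0" "n x = 0"
        unfolding b[OF x] m[OF x] n[OF x] using const[OF 1 x] 1[OF x] by (simp_all add: a)
    qed (fact ac)
  next
    case 2
    obtain x0 where x0: "x0 \<in> X" using ne by blast
    \<comment> \<open>Here p = 1 means that h = 1 / v has derivative 1, hence h = x +
      \<delta>.\<close>
    define \<delta> where "\<delta> = 1 / v x0 - x0"
    have v: "1 / v x = x + \<delta>" if "x \<in> X" for x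
    proof -
      have "((\<lambda>x. 1 / v x - x) has_field_derivative 0) (at x)" if "x \<in> X" for x
        using dv[OF that] v0[OF that] 2[OF that] by (auto intro!: derivative_eq_intros simp: power2_eq_square)
      from DERIV_zero_interval[OF iv this that x0] show ?thesis by (simp add: \<delta>_def)
    qed
    have v': "x + \<delta> \<noteq> 0" "v x = 1 / (x + \<delta>)" if "x \<in> X" for x
      using v[OF that, symmetric] v0[OF that] by simp_all
    show thesis
    proof (rule that(2)[of \<delta>])
      fix x assume x: "x \<in> X"
      show "a x = 3 / (x + \<delta>)" "b x = - 3 / (x + \<delta>)" "m x = - 3 / (x + \<delta>)\<^sup>2" "n x = 0"
        unfolding a b[OF x] m[OF x] n[OF x] v'(2)[OF x] using const[OF 2 x] 2[OF x]
        by (simp_all add: power_divide)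
    qed (fact v'(1))
  qed
qed

section \<open>The form of a reduction operator\<close>

definition smooth2 :: "real set \<Rightarrow> real set \<Rightarrow> (real \<Rightarrow> real \<Rightarrow> real) \<Rightarrow> bool" where
  "smooth2 T X g \<longleftrightarrow> smooth_on (T \<times> X) (\<lambda>p. g (fst p) (snd p))"

definition Dt :: "(real \<Rightarrow> real \<Rightarrow> real) \<Rightarrow> real \<Rightarrow> real \<Rightarrow> real" where
  "Dt g t x = deriv (\<lambda>s. g s x) t"

definition Dx :: "(real \<Rightarrow> real \<Rightarrow> real) \<Rightarrow> real \<Rightarrow> real \<Rightarrow> real" where
  "Dx g t x = deriv (g t) x"

lemma smooth2_deriv:
  assumes "open T" "open X" "smooth2 T X g"
  shows "\<And>t x. t \<in> T \<Longrightarrow> x \<in> X \<Longrightarrow> ((\<lambda>s. g s x) has_field_derivative Dt g t x) (at t)"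
    and "\<And>t x. t \<in> T \<Longrightarrow> x \<in> X \<Longrightarrow> (g t has_field_derivative Dx g t x) (at x)"
    and "smooth2 T X (Dt g)" "smooth2 T X (Dx g)"
proof -
  let ?f = "\<lambda>p. g (fst p) (snd p)"
  note s = assms(3)[unfolded smooth2_def]
  have lin: "frechet_derivative ?f (at (t, x)) (h, 0) = frechet_derivative ?f (at (t, x)) (1, 0) * h"
    "frechet_derivative ?f (at (t, x)) (0, h) = frechet_derivative ?f (at (t, x)) (0, 1) * h"
    if "t \<in> T" "x \<in> X" for t x h
  proof -
    have "linear (frechet_derivative ?f (at (t, x)))"
      using smooth_on_has_derivative[OF s, of "(t, x)"] that by (auto intro: has_derivative_linear)
    note linear_cmul[OF this, of h]
    from this[of "(1, 0)"] this[of "(0, 1)"]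
    show "frechet_derivative ?f (at (t, x)) (h, 0) = frechet_derivative ?f (at (t, x)) (1, 0) * h"
      "frechet_derivative ?f (at (t, x)) (0, h) = frechet_derivative ?f (at (t, x)) (0, 1) * h"
      by (simp_all only: scaleR_Pair real_scaleR_def mult_1_right mult_zero_right mult_1_left mult_zero_left mult.commute)
  qed
  have dt: "((\<lambda>s. g s x) has_field_derivative frechet_derivative ?f (at (t, x)) (1, 0)) (at t)"
    and dx: "(g t has_field_derivative frechet_derivative ?f (at (t, x)) (0, 1)) (at x)"
    if tx: "t \<in> T" "x \<in> X" for t x
  proof -
    have p: "(t, x) \<in> T \<times> X" using tx by simp
    have "((\<lambda>s. (s, x)) has_derivative (\<lambda>h. (h, 0))) (at t)"
      by (intro has_derivative_Pair has_derivative_const has_derivative_ident)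
    note D = has_derivative_compose[OF this smooth_on_has_derivative[OF s p], simplified fst_conv snd_conv]
    show "((\<lambda>s. g s x) has_field_derivative frechet_derivative ?f (at (t, x)) (1, 0)) (at t)"
    proof -
      have "(\<lambda>h. frechet_derivative ?f (at (t, x)) (h, 0)) = (*) (frechet_derivative ?f (at (t, x)) (1, 0))"
        by (rule ext) (rule lin(1)[OF tx])
      then show ?thesis using D unfolding has_field_derivative_def by metis
    qed
    have "((\<lambda>s. (t, s)) has_derivative (\<lambda>h. (0, h))) (at x)"
      by (intro has_derivative_Pair has_derivative_const has_derivative_ident)
    note D = has_derivative_compose[OF this smooth_on_has_derivative[OF s p], simplified fst_conv snd_conv]
    show "(g t has_field_derivative frechet_derivative ?f (at (t, x)) (0, 1)) (at x)"
    proof -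
      have "(\<lambda>h. frechet_derivative ?f (at (t, x)) (0, h)) = (*) (frechet_derivative ?f (at (t, x)) (0, 1))"
        by (rule ext) (rule lin(2)[OF tx])
      then show ?thesis using D unfolding has_field_derivative_def by metis
    qed
  qed
  have Dt: "Dt g t x = frechet_derivative ?f (at (t, x)) (1, 0)"
    and Dx: "Dx g t x = frechet_derivative ?f (at (t, x)) (0, 1)" if "t \<in> T" "x \<in> X" for t x
    using dt[OF that] dx[OF that] by (simp_all add: Dt_def Dx_def DERIV_imp_deriv)
  show "((\<lambda>s. g s x) has_field_derivative Dt g t x) (at t)"
    "(g t has_field_derivative Dx g t x) (at x)" if "t \<in> T" "x \<in> X" for t x
    unfolding Dt[OF that] Dx[OF that] by (fact dt[OF that], fact dx[OF that])
  have op: "open (T \<times> X)" using assms by (simp add: open_Times)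
  have "smooth_on (T \<times> X) (\<lambda>p. Dt g (fst p) (snd p)) = smooth_on (T \<times> X) (\<lambda>p. frechet_derivative ?f (at p) (1, 0))"
    "smooth_on (T \<times> X) (\<lambda>p. Dx g (fst p) (snd p)) = smooth_on (T \<times> X) (\<lambda>p. frechet_derivative ?f (at p) (0, 1))"
    using Dt Dx by (auto intro!: smooth_on_cong[OF op])
  then show "smooth2 T X (Dt g)" "smooth2 T X (Dx g)"
    unfolding smooth2_def using smooth_on_frechet_derivative[OF s] by simp_all
qed

lemma smooth2_arith:
  assumes "open T" "open X"
  shows "smooth2 T X (\<lambda>t x. c)"
    and "smooth2 T X f \<Longrightarrow> smooth2 T X g \<Longrightarrow> smooth2 T X (\<lambda>t x. f t x + g t x)"
    and "smooth2 T X f \<Longrightarrow> smooth2 T X g \<Longrightarrow> smooth2 T X (\<lambda>t x. f t x - g t x)"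
    and "smooth2 T X f \<Longrightarrow> smooth2 T X g \<Longrightarrow> smooth2 T X (\<lambda>t x. f t x * g t x)"
    and "smooth2 T X f \<Longrightarrow> smooth2 T X (\<lambda>t x. f t x ^ i)"
  using open_Times[OF assms] unfolding smooth2_def by (simp_all add: smooth_intros)

lemma smooth2_slice:
  fixes U :: "real set"
  assumes "open T" "open X" "smooth_on (T \<times> X \<times> U) f" "u \<in> U"
  shows "smooth2 T X (\<lambda>t x. f (t, x, u))"
proof -
  have "bounded_linear (\<lambda>p :: real \<times> real. (fst p, snd p, 0 :: real))"
    by (intro bounded_linear_Pair bounded_linear_fst bounded_linear_snd bounded_linear_zero)
  from smooth_on_affine_comp[OF open_Times[OF assms(1,2)] this _ assms(3), of "(0, 0, u)"] assms(4)
  show ?thesis by (auto simp: smooth2_def)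
qed

lemma smooth2_section:
  assumes "open X" "smooth2 T X g" "t \<in> T"
  shows "smooth_on X (g t)"
proof -
  have "bounded_linear (\<lambda>x :: real. (0 :: real, x))"
    by (intro bounded_linear_Pair bounded_linear_zero bounded_linear_ident)
  from smooth_on_affine_comp[OF assms(1) this _ assms(2)[unfolded smooth2_def], of "(t, 0)"] assms(3)
  show ?thesis by simp
qed

text \<open>For a polynomial in u whose coefficients depend on t and x both mixed derivatives are
  given by one formula, so the distinction made in \<open>has_partials\<close> costs nothing once
  \<eta> is known to be a cubic.\<close>

lemma has_partials_cubic:
  assumes "open T" "open X" and s: "smooth2 T X c0" "smooth2 T X c1" "smooth2 T X c2" "smooth2 T X c3"
  shows "has_partials (T \<times> X \<times> U) (\<lambda>t x u. c3 t x * u ^ 3 + c2 t x * u\<^sup>2 + c1 t x * u + c0 t x)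
    (\<lambda>t x u. Dt c3 t x * u ^ 3 + Dt c2 t x * u\<^sup>2 + Dt c1 t x * u + Dt c0 t x)
    (\<lambda>t x u. Dx c3 t x * u ^ 3 + Dx c2 t x * u\<^sup>2 + Dx c1 t x * u + Dx c0 t x)
    (\<lambda>t x u. 3 * c3 t x * u\<^sup>2 + 2 * c2 t x * u + c1 t x)
    (\<lambda>t x u. Dx (Dx c3) t x * u ^ 3 + Dx (Dx c2) t x * u\<^sup>2 + Dx (Dx c1) t x * u + Dx (Dx c0) t x)
    (\<lambda>t x u. 3 * Dx c3 t x * u\<^sup>2 + 2 * Dx c2 t x * u + Dx c1 t x)
    (\<lambda>t x u. 3 * Dx c3 t x * u\<^sup>2 + 2 * Dx c2 t x * u + Dx c1 t x)
    (\<lambda>t x u. 6 * c3 t x * u + 2 * c2 t x)"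
proof -
  note s' = s[THEN smooth2_deriv(4)[OF assms(1,2)]]
  {
    fix t x assume tx: "t \<in> T" "x \<in> X"
    note d = s[THEN smooth2_deriv(1)[OF assms(1,2)], OF tx] s[THEN smooth2_deriv(2)[OF assms(1,2)], OF tx]
      s'[THEN smooth2_deriv(2)[OF assms(1,2)], OF tx]
    note d
  }
  note d = this
  show ?thesis
    unfolding has_partials_def
    by (intro allI impI conjI; (rule DERIV_cong, (rule derivative_intros d | force)+); simp)
qed

lemma has_partials_affine:
  assumes "open T" "open X" and s: "smooth2 T X a" "smooth2 T X b"
  shows "has_partials (T \<times> X \<times> U) (\<lambda>t x u. a t x * u + b t x) (\<lambda>t x u. Dt a t x * u + Dt b t x)
    (\<lambda>t x u. Dx a t x * u + Dx b t x) (\<lambda>t x u. a t x) (\<lambda>t x u. Dx (Dx a) t x * u + Dx (Dx b) t x)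
    (\<lambda>t x u. Dx a t x) (\<lambda>t x u. Dx a t x) (\<lambda>t x u. 0)"
proof -
  note s' = s[THEN smooth2_deriv(4)[OF assms(1,2)]]
  {
    fix t x assume tx: "t \<in> T" "x \<in> X"
    note d = s[THEN smooth2_deriv(1)[OF assms(1,2)], OF tx] s[THEN smooth2_deriv(2)[OF assms(1,2)], OF tx]
      s'[THEN smooth2_deriv(2)[OF assms(1,2)], OF tx]
    note d
  }
  note d = this
  show ?thesis
    unfolding has_partials_def
    by (intro allI impI conjI; (rule DERIV_cong, (rule derivative_intros d | force)+); simp)
qed

text \<open>An open interval has more points than a nonzero polynomial has roots. Degree five is
  what products such as \<eta> k u^2 in the determining equations can reach.\<close>

lemma quintic_zero:
  fixes U :: "real set"
  assumes U: "open_interval U"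
    and eq: "\<And>u. u \<in> U \<Longrightarrow> c0 + c1 * u + c2 * u\<^sup>2 + c3 * u ^ 3 + c4 * u ^ 4 + c5 * u ^ 5 = 0"
  shows "c0 = 0 \<and> c1 = 0 \<and> c2 = 0 \<and> c3 = 0 \<and> c4 = 0 \<and> c5 = 0"
proof -
  let ?p = "[:c0, c1, c2, c3, c4, c5:]"
  have "poly ?p u = 0" if "u \<in> U" for u
    using eq[OF that] by (simp add: algebra_simps eval_nat_numeral)
  then have "U \<subseteq> {u. poly ?p u = 0}" by blast
  moreover have "infinite U"
    using U by (metis open_interval_def finite_imp_not_open)
  ultimately have "infinite {u. poly ?p u = 0}" using infinite_super by blast
  then have "?p = 0" using poly_roots_finite by blast
  then show ?thesis by simp
qed

text \<open>Since \<xi>_uu = 0, \<xi> is affine in u; then \<eta>_uu = 2 a_x - 2 a (a u + b) is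
  affine in u, and two integrations give a cubic. Each gain is fed back by interpreting
  \<open>unit_vector_field\<close> anew: with abstract coefficients, with explicit \<xi>, with
  explicit \<xi> and \<eta>. The remaining two determining equations are then compared power by
  power in u. The last two conclusions are restricted to a = 0 because they are stated without the
  terms that a contributes.\<close>

lemma reduction_structure:
  assumes I: "open_interval T" "open_interval X" "open_interval U" and \<Omega>: "\<Omega> = T \<times> X \<times> U"
    and k: "smooth_on X k" and Q1: "\<And>p. p \<in> \<Omega> \<Longrightarrow> fst (Q p) = 1"
    and Q: "nonclassical_symmetry k \<Omega> Q"
  obtains a b m n where
    "smooth2 T X a" "smooth2 T X b" "smooth2 T X m" "smooth2 T X n"
    "\<And>t x u. (t, x, u) \<in> \<Omega> \<Longrightarrow> Q (t, x, u) = (1, a t x * u + b t x,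
      - (a t x)\<^sup>2 / 3 * u ^ 3 + (Dx a t x - a t x * b t x) * u\<^sup>2 + m t x * u + n t x)"
    "\<And>t x. t \<in> T \<Longrightarrow> x \<in> X \<Longrightarrow> a t x * (9 * k x - 2 * (a t x)\<^sup>2) = 0"
    "\<And>t x. t \<in> T \<Longrightarrow> x \<in> X \<Longrightarrow>
      2 * a t x * Dx a t x + 2 * a t x * (Dx a t x - a t x * b t x) - 3 * a t x * k x = 0"
    "\<And>t x. t \<in> T \<Longrightarrow> x \<in> X \<Longrightarrow> Dx (Dx a) t x - Dt a t x
      - 4 * (Dx (Dx a) t x - (Dx a t x * b t x + a t x * Dx b t x))
      - 2 * (a t x * Dx b t x + b t x * Dx a t x) + 2 * a t x * m t x = 0"
    "\<And>t x. t \<in> T \<Longrightarrow> x \<in> X \<Longrightarrow>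
      Dx (Dx b) t x - Dt b t x - 2 * Dx m t x - 2 * b t x * Dx b t x + 2 * a t x * n t x = 0"
    "\<And>t x. t \<in> T \<Longrightarrow> x \<in> X \<Longrightarrow> Dt n t x - Dx (Dx n) t x + 2 * Dx b t x * n t x = 0"
    "\<And>t x. t \<in> T \<Longrightarrow> x \<in> X \<Longrightarrow> Dt m t x - Dx (Dx m) t x
      + 2 * Dx a t x * n t x + 2 * Dx b t x * m t x - 2 * k x * n t x = 0"
    "\<And>t x. (\<And>t x. t \<in> T \<Longrightarrow> x \<in> X \<Longrightarrow> a t x = 0) \<Longrightarrow> t \<in> T \<Longrightarrow> x \<in> X \<Longrightarrow>
      (m t x - 2 * Dx b t x) * k x - b t x * deriv k x - 2 * k x * m t x + 3 * k x * n t x = 0"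
    "\<And>t x. (\<And>t x. t \<in> T \<Longrightarrow> x \<in> X \<Longrightarrow> a t x = 0) \<Longrightarrow> t \<in> T \<Longrightarrow> x \<in> X \<Longrightarrow>
      - (m t x - 2 * Dx b t x) * k x + b t x * deriv k x + 3 * k x * m t x = 0"
proof -
  have o: "open T" "open X" "open U" and iU: "is_interval U" using I by (auto simp: open_interval_def)
  have op: "open \<Omega>" using o by (simp add: \<Omega> open_box)
  have in\<Omega>: "(t, x, u) \<in> \<Omega> \<longleftrightarrow> t \<in> T \<and> x \<in> X \<and> u \<in> U" for t x u by (simp add: \<Omega>)
  obtain u0 where u0: "u0 \<in> U" using I by (auto simp: open_interval_def)
  note kd = smooth_on_real_deriv(1)[OF o(2) k]
  have sQ: "smooth_on \<Omega> Q" and inv: "\<forall>j. base j \<in> \<Omega> \<and> L k j = 0 \<and> characteristic Q j = 0 \<and>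
      D_t (characteristic Q) j = 0 \<and> D_x (characteristic Q) j = 0 \<longrightarrow> prolong2 Q (L k) j = 0"
    using Q by (auto simp: nonclassical_symmetry_def)
  define X' where "X' p = fst (snd (Q p))" for p
  define E' where "E' p = snd (snd (Q p))" for p
  define \<xi> where "\<xi> t x u = X' (t, x, u)" for t x u
  define \<eta> where "\<eta> t x u = E' (t, x, u)" for t x u
  have sX: "smooth_on \<Omega> X'" and sE: "smooth_on \<Omega> E'" unfolding X'_def[abs_def] E'_def[abs_def]
    by (rule smooth_on_linear_comp[OF op _ sQ],
        intro bounded_linear_compose[OF bounded_linear_fst] bounded_linear_compose[OF bounded_linear_snd]
          bounded_linear_fst bounded_linear_snd)+
  have Q_eq: "Q (t, x, u) = (1, \<xi> t x u, \<eta> t x u)" if "(t, x, u) \<in> \<Omega>" for t x u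
    using Q1[OF that] by (simp add: \<xi>_def \<eta>_def X'_def E'_def prod_eq_iff)
  define \<xi>u where "\<xi>u t x u = frechet_derivative X' (at (t, x, u)) (0, 0, 1)" for t x u
  define \<eta>u where "\<eta>u t x u = frechet_derivative E' (at (t, x, u)) (0, 0, 1)" for t x u
  obtain \<xi>t \<xi>x \<xi>xx \<xi>xu \<xi>ux \<xi>uu where \<xi>: "has_partials \<Omega> \<xi> \<xi>t \<xi>x \<xi>u \<xi>xx \<xi>xu \<xi>ux \<xi>uu"
    using smooth_has_partials[OF sX] unfolding \<xi>_def[abs_def] \<xi>u_def[abs_def] by blast
  obtain \<eta>t \<eta>x \<eta>xx \<eta>xu \<eta>ux \<eta>uu where \<eta>: "has_partials \<Omega> \<eta> \<eta>t \<eta>x \<eta>u \<eta>xx \<eta>xu \<eta>ux \<eta>uu"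
    using smooth_has_partials[OF sE] unfolding \<eta>_def[abs_def] \<eta>u_def[abs_def] by blast
  have s2: "smooth2 T X (\<lambda>t x. \<xi> t x u0)" "smooth2 T X (\<lambda>t x. \<xi>u t x u0)"
    "smooth2 T X (\<lambda>t x. \<eta> t x u0)" "smooth2 T X (\<lambda>t x. \<eta>u t x u0)"
    unfolding \<xi>_def \<xi>u_def \<eta>_def \<eta>u_def
    using sX sE smooth_on_frechet_derivative[OF sX] smooth_on_frechet_derivative[OF sE] unfolding \<Omega>
    by (auto intro: smooth2_slice[OF o(1,2) _ u0]
      smooth2_slice[OF o(1,2) _ u0, where f = "\<lambda>p. frechet_derivative _ (at p) _"])
  have loc1: "unit_vector_field \<Omega> Q k (deriv k) \<xi> \<xi>t \<xi>x \<xi>u \<xi>xx \<xi>xu \<xi>ux \<xi>uu \<eta> \<eta>t \<eta>x \<eta>u \<eta>xx \<eta>xu \<eta>ux \<eta>uu"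
    using op Q_eq kd \<xi> \<eta> by unfold_locales (auto simp: in\<Omega>)
  have \<xi>uu: "\<xi>uu t x u = 0" if "(t, x, u) \<in> \<Omega>" for t x u
    using inv[unfolded unit_vector_field.nonclassical_iff_determining[OF loc1]
        unit_vector_field.determining_def[OF loc1]] that by blast
  have d\<xi>: "(\<xi> t x has_field_derivative \<xi>u t x u) (at u)" "(\<xi>u t x has_field_derivative \<xi>uu t x u) (at u)"
    and d\<eta>: "(\<eta> t x has_field_derivative \<eta>u t x u) (at u)" "(\<eta>u t x has_field_derivative \<eta>uu t x u) (at u)"
    if "t \<in> T" "x \<in> X" "u \<in> U" for t x u
    using \<xi> \<eta> that by (auto simp: has_partials_def in\<Omega>)
  \<comment> \<open>All u-independent coefficients are built from values of \<xi>, \<eta> and their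
    u-derivatives at the fixed point \<open>u0\<close>, from which their smoothness is
    inherited.\<close>
  define a where "a t x = \<xi>u t x u0" for t x
  define b where "b t x = \<xi> t x u0 - a t x * u0" for t x
  have sa: "smooth2 T X a" unfolding a_def[abs_def] by (rule s2)
  have sb: "smooth2 T X b" unfolding b_def[abs_def] by (intro smooth2_arith[OF o(1,2)] s2 sa)
  have \<xi>_eq: "\<xi> t x u = a t x * u + b t x" if tx: "t \<in> T" "x \<in> X" "u \<in> U" for t x u
  proof -
    have au: "\<xi>u t x u = a t x" if "u \<in> U" for u
      unfolding a_def
      by (rule DERIV_zero_interval[OF iU _ that u0]) (use d\<xi>(2)[OF tx(1,2)] \<xi>uu tx in\<Omega> in force)
    have "((\<lambda>u. \<xi> t x u - a t x * u) has_field_derivative 0) (at u)" if "u \<in> U" for u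
      using d\<xi>(1)[OF tx(1,2) that] au[OF that] by (auto intro!: derivative_eq_intros)
    from DERIV_zero_interval[OF iU this tx(3) u0] show ?thesis by (simp add: b_def)
  qed
  note \<xi>p = has_partials_affine[OF o(1,2) sa sb, of U, folded \<Omega>]
  have Q_eq2: "Q (t, x, u) = (1, a t x * u + b t x, \<eta> t x u)" if "(t, x, u) \<in> \<Omega>" for t x u
    using Q_eq[OF that] \<xi>_eq that by (simp add: in\<Omega>)
  have loc2: "unit_vector_field \<Omega> Q k (deriv k) (\<lambda>t x u. a t x * u + b t x) (\<lambda>t x u. Dt a t x * u + Dt b t x)
    (\<lambda>t x u. Dx a t x * u + Dx b t x) (\<lambda>t x u. a t x) (\<lambda>t x u. Dx (Dx a) t x * u + Dx (Dx b) t x)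
    (\<lambda>t x u. Dx a t x) (\<lambda>t x u. Dx a t x) (\<lambda>t x u. 0) \<eta> \<eta>t \<eta>x \<eta>u \<eta>xx \<eta>xu \<eta>ux \<eta>uu"
    using op Q_eq2 kd \<xi>p \<eta> by unfold_locales (auto simp: in\<Omega>)
  have \<eta>uu: "\<eta>uu t x u = 2 * Dx a t x - 2 * (a t x * u + b t x) * a t x" if "(t, x, u) \<in> \<Omega>" for t x u
    using inv[unfolded unit_vector_field.nonclassical_iff_determining[OF loc2]
        unit_vector_field.determining_def[OF loc2]] that by simp
  \<comment> \<open>Obtained by matching 6 \<open>c3\<close> u + 2 \<open>c2\<close> with the
    formula for \<eta>_uu; m and n are the two constants of integration.\<close>
  define c3 where "c3 t x = (- 1 / 3) * (a t x)\<^sup>2" for t x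
  define c2 where "c2 t x = Dx a t x - a t x * b t x" for t x
  define m where "m t x = \<eta>u t x u0 - (3 * c3 t x * u0\<^sup>2 + 2 * c2 t x * u0)" for t x
  define n where "n t x = \<eta> t x u0 - (c3 t x * u0 ^ 3 + c2 t x * u0\<^sup>2 + m t x * u0)" for t x
  note sda = smooth2_deriv(4)[OF o(1,2) sa]
  have sc3: "smooth2 T X c3" unfolding c3_def[abs_def] by (intro smooth2_arith[OF o(1,2)] sa)
  have sc2: "smooth2 T X c2" unfolding c2_def[abs_def] by (intro smooth2_arith[OF o(1,2)] sa sb sda)
  have sm: "smooth2 T X m" unfolding m_def[abs_def] by (intro smooth2_arith[OF o(1,2)] sc2 sc3 s2)
  have sn: "smooth2 T X n" unfolding n_def[abs_def] by (intro smooth2_arith[OF o(1,2)] sc2 sc3 sm s2)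
  have \<eta>_eq: "\<eta> t x u = c3 t x * u ^ 3 + c2 t x * u\<^sup>2 + m t x * u + n t x" if tx: "t \<in> T" "x \<in> X" "u \<in> U" for t x u
  proof -
    have z: "((\<lambda>u. \<eta>u t x u - (3 * c3 t x * u\<^sup>2 + 2 * c2 t x * u)) has_field_derivative 0) (at u)"
      if "u \<in> U" for u
    proof -
      have "((\<lambda>u. \<eta>u t x u - (3 * c3 t x * u\<^sup>2 + 2 * c2 t x * u)) has_field_derivative
          \<eta>uu t x u - (3 * c3 t x * (2 * u) + 2 * c2 t x)) (at u)"
        using d\<eta>(2)[OF tx(1,2) that] by (auto intro!: derivative_eq_intros)
      moreover have "\<eta>uu t x u - (3 * c3 t x * (2 * u) + 2 * c2 t x) = 0"
        using \<eta>uu[of t x u] tx that by (simp add: in\<Omega> c3_def c2_def algebra_simps power2_eq_square)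
      ultimately show ?thesis by simp
    qed
    have \<eta>u: "\<eta>u t x u = 3 * c3 t x * u\<^sup>2 + 2 * c2 t x * u + m t x" if "u \<in> U" for u
      using DERIV_zero_interval[OF iU z that u0] by (simp add: m_def)
    have "((\<lambda>u. \<eta> t x u - (c3 t x * u ^ 3 + c2 t x * u\<^sup>2 + m t x * u)) has_field_derivative 0) (at u)" if "u \<in> U" for u
      using d\<eta>(1)[OF tx(1,2) that] \<eta>u[OF that] by (auto intro!: derivative_eq_intros)
    from DERIV_zero_interval[OF iU this tx(3) u0] show ?thesis by (simp add: n_def)
  qed
  note \<eta>p = has_partials_cubic[OF o(1,2) sn sm sc2 sc3, of U, folded \<Omega>]
  have Q_eq3: "Q (t, x, u) = (1, a t x * u + b t x, c3 t x * u ^ 3 + c2 t x * u\<^sup>2 + m t x * u + n t x)"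
    if "(t, x, u) \<in> \<Omega>" for t x u
    using Q_eq2[OF that] \<eta>_eq that by (simp add: in\<Omega>)
  have loc3: "unit_vector_field \<Omega> Q k (deriv k) (\<lambda>t x u. a t x * u + b t x) (\<lambda>t x u. Dt a t x * u + Dt b t x)
    (\<lambda>t x u. Dx a t x * u + Dx b t x) (\<lambda>t x u. a t x) (\<lambda>t x u. Dx (Dx a) t x * u + Dx (Dx b) t x)
    (\<lambda>t x u. Dx a t x) (\<lambda>t x u. Dx a t x) (\<lambda>t x u. 0)
    (\<lambda>t x u. c3 t x * u ^ 3 + c2 t x * u\<^sup>2 + m t x * u + n t x)
    (\<lambda>t x u. Dt c3 t x * u ^ 3 + Dt c2 t x * u\<^sup>2 + Dt m t x * u + Dt n t x)
    (\<lambda>t x u. Dx c3 t x * u ^ 3 + Dx c2 t x * u\<^sup>2 + Dx m t x * u + Dx n t x)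
    (\<lambda>t x u. 3 * c3 t x * u\<^sup>2 + 2 * c2 t x * u + m t x)
    (\<lambda>t x u. Dx (Dx c3) t x * u ^ 3 + Dx (Dx c2) t x * u\<^sup>2 + Dx (Dx m) t x * u + Dx (Dx n) t x)
    (\<lambda>t x u. 3 * Dx c3 t x * u\<^sup>2 + 2 * Dx c2 t x * u + Dx m t x)
    (\<lambda>t x u. 3 * Dx c3 t x * u\<^sup>2 + 2 * Dx c2 t x * u + Dx m t x)
    (\<lambda>t x u. 6 * c3 t x * u + 2 * c2 t x)"
    using op Q_eq3 kd \<xi>p \<eta>p by unfold_locales (auto simp: in\<Omega>)
  note det = inv[unfolded unit_vector_field.nonclassical_iff_determining[OF loc3]
        unit_vector_field.determining_def[OF loc3], rule_format, THEN conjunct2, THEN conjunct2]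
  have d1: "2 * c3 t x * a t x + 3 * a t x * k x = 0 \<and>
      - 6 * Dx c3 t x - 2 * a t x * Dx a t x + 2 * c2 t x * a t x - 3 * a t x * k x = 0 \<and>
      Dx (Dx a) t x - Dt a t x - 4 * Dx c2 t x - 2 * (a t x * Dx b t x + b t x * Dx a t x) + 2 * a t x * m t x = 0 \<and>
      Dx (Dx b) t x - Dt b t x - 2 * Dx m t x - 2 * b t x * Dx b t x + 2 * a t x * n t x = 0"
    if tx: "t \<in> T" "x \<in> X" for t x
  proof -
    have "(Dx (Dx b) t x - Dt b t x - 2 * Dx m t x - 2 * b t x * Dx b t x + 2 * a t x * n t x)
        + (Dx (Dx a) t x - Dt a t x - 4 * Dx c2 t x - 2 * (a t x * Dx b t x + b t x * Dx a t x) + 2 * a t x * m t x) * u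
        + (- 6 * Dx c3 t x - 2 * a t x * Dx a t x + 2 * c2 t x * a t x - 3 * a t x * k x) * u\<^sup>2
        + (2 * c3 t x * a t x + 3 * a t x * k x) * u ^ 3 + 0 * u ^ 4 + 0 * u ^ 5 = 0" if "u \<in> U" for u
      using det[THEN conjunct1, of t x u, unfolded in\<Omega>, OF conjI[OF tx(1) conjI[OF tx(2) that]]] by algebra
    from quintic_zero[OF I(3) this] show ?thesis by blast
  qed
  have d0: "Dt n t x - Dx (Dx n) t x + 2 * Dx b t x * n t x = 0 \<and>
      Dt m t x - Dx (Dx m) t x + 2 * Dx a t x * n t x + 2 * Dx b t x * m t x - 2 * k x * n t x = 0 \<and>
      Dt c2 t x - Dx (Dx c2) t x + 2 * Dx a t x * m t x + 2 * Dx b t x * c2 t x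
        + (m t x - 2 * Dx b t x) * k x - b t x * deriv k x - 2 * k x * m t x + 3 * k x * n t x = 0 \<and>
      Dt c3 t x - Dx (Dx c3) t x + 2 * Dx a t x * c2 t x + 2 * Dx b t x * c3 t x
        + (2 * c2 t x - 2 * Dx a t x) * k x - (m t x - 2 * Dx b t x) * k x - a t x * deriv k x
        + b t x * deriv k x - 2 * k x * c2 t x + 3 * k x * m t x = 0"
    if tx: "t \<in> T" "x \<in> X" for t x
  proof -
    \<comment> \<open>The contributions -3 \<open>c3\<close> k and 3 \<open>c3\<close> k to u^5,
      from the terms with \<eta>_u and with \<eta>, cancel.\<close>
    have "(Dt n t x - Dx (Dx n) t x + 2 * Dx b t x * n t x)
      + (Dt m t x - Dx (Dx m) t x + 2 * Dx a t x * n t x + 2 * Dx b t x * m t x - 2 * k x * n t x) * u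
      + (Dt c2 t x - Dx (Dx c2) t x + 2 * Dx a t x * m t x + 2 * Dx b t x * c2 t x
        + (m t x - 2 * Dx b t x) * k x - b t x * deriv k x - 2 * k x * m t x + 3 * k x * n t x) * u\<^sup>2
      + (Dt c3 t x - Dx (Dx c3) t x + 2 * Dx a t x * c2 t x + 2 * Dx b t x * c3 t x
        + (2 * c2 t x - 2 * Dx a t x) * k x - (m t x - 2 * Dx b t x) * k x - a t x * deriv k x
        + b t x * deriv k x - 2 * k x * c2 t x + 3 * k x * m t x) * u ^ 3
      + (2 * Dx a t x * c3 t x + 3 * c3 t x * k x - (2 * c2 t x - 2 * Dx a t x) * k x + a t x * deriv k x
        - 2 * k x * c3 t x + 3 * k x * c2 t x) * u ^ 4 + 0 * u ^ 5 = 0" if "u \<in> U" for u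
      using det[THEN conjunct2, of t x u, unfolded in\<Omega>, OF conjI[OF tx(1) conjI[OF tx(2) that]]] by algebra
    from quintic_zero[OF I(3) this] show ?thesis by blast
  qed
  have Dc3: "Dx c3 t x = (- 2 / 3) * a t x * Dx a t x" and Dc2: "Dx c2 t x = Dx (Dx a) t x - (Dx a t x * b t x + a t x * Dx b t x)"
    if tx: "t \<in> T" "x \<in> X" for t x
  proof -
    note d = smooth2_deriv(2)[OF o(1,2) sa tx] smooth2_deriv(2)[OF o(1,2) sb tx] smooth2_deriv(2)[OF o(1,2) sda tx]
    have "(c3 t has_field_derivative (- 2 / 3) * a t x * Dx a t x) (at x)"
      unfolding c3_def[abs_def] using d by (auto intro!: derivative_eq_intros)
    then show "Dx c3 t x = (- 2 / 3) * a t x * Dx a t x" by (simp add: Dx_def DERIV_imp_deriv)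
    have "(c2 t has_field_derivative Dx (Dx a) t x - (Dx a t x * b t x + a t x * Dx b t x)) (at x)"
      unfolding c2_def[abs_def] using d by (auto intro!: derivative_eq_intros)
    then show "Dx c2 t x = Dx (Dx a) t x - (Dx a t x * b t x + a t x * Dx b t x)"
      by (simp add: Dx_def DERIV_imp_deriv)
  qed
  have vanish: "Dx g t x = 0 \<and> Dt g t x = 0" if "\<And>t x. t \<in> T \<Longrightarrow> x \<in> X \<Longrightarrow> g t x = 0" "t \<in> T" "x \<in> X"
    for g t x
    using deriv_on_open[OF o(2) that(3), of "g t" "\<lambda>x. 0" 0] deriv_on_open[OF o(1) that(2), of "\<lambda>s. g s x" "\<lambda>x. 0" 0] that
    by (simp add: Dx_def Dt_def)
  show thesis
  proof (rule that[OF sa sb sm sn])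
    show "Q (t, x, u) = (1, a t x * u + b t x,
      - (a t x)\<^sup>2 / 3 * u ^ 3 + (Dx a t x - a t x * b t x) * u\<^sup>2 + m t x * u + n t x)" if "(t, x, u) \<in> \<Omega>" for t x u
      using Q_eq3[OF that] by (simp add: c3_def c2_def)
    fix t x assume tx: "t \<in> T" "x \<in> X"
    note D = d1[OF tx] d0[OF tx]
    show "a t x * (9 * k x - 2 * (a t x)\<^sup>2) = 0" using D unfolding c3_def by algebra
    show "2 * a t x * Dx a t x + 2 * a t x * (Dx a t x - a t x * b t x) - 3 * a t x * k x = 0"
      using D unfolding c2_def Dc3[OF tx] by algebra
    show "Dx (Dx a) t x - Dt a t x - 4 * (Dx (Dx a) t x - (Dx a t x * b t x + a t x * Dx b t x))
      - 2 * (a t x * Dx b t x + b t x * Dx a t x) + 2 * a t x * m t x = 0"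
      using D unfolding Dc2[OF tx] by blast
    show "Dx (Dx b) t x - Dt b t x - 2 * Dx m t x - 2 * b t x * Dx b t x + 2 * a t x * n t x = 0"
      "Dt n t x - Dx (Dx n) t x + 2 * Dx b t x * n t x = 0"
      "Dt m t x - Dx (Dx m) t x + 2 * Dx a t x * n t x + 2 * Dx b t x * m t x - 2 * k x * n t x = 0"
      using D by blast+
    assume a0: "\<And>t x. t \<in> T \<Longrightarrow> x \<in> X \<Longrightarrow> a t x = 0"
    have va: "Dx a t x = 0 \<and> Dt a t x = 0" if "t \<in> T" "x \<in> X" for t x
      by (rule vanish[OF _ that]) (rule a0)
    have c0: "c2 t x = 0" "c3 t x = 0" if "t \<in> T" "x \<in> X" for t x
      using va[OF that] a0[OF that] by (simp_all add: c2_def c3_def)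
    have vc: "Dx c2 t x = 0 \<and> Dt c2 t x = 0" "Dx c3 t x = 0 \<and> Dt c3 t x = 0" if "t \<in> T" "x \<in> X" for t x
      by (rule vanish[OF _ that], rule c0(1); assumption) (rule vanish[OF _ that], rule c0(2); assumption)
    have "Dx (Dx c2) t x = 0" "Dx (Dx c3) t x = 0"
      using vanish[of "Dx c2"] vanish[of "Dx c3"] vc tx by blast+
    then show "(m t x - 2 * Dx b t x) * k x - b t x * deriv k x - 2 * k x * m t x + 3 * k x * n t x = 0"
      "- (m t x - 2 * Dx b t x) * k x + b t x * deriv k x + 3 * k x * m t x = 0"
      using D va[OF tx] a0[OF tx] vc[OF tx] c0[OF tx] by (simp_all add: algebra_simps)
  qed
qed

section \<open>Reductions with \<open>\<xi>\<close> independent of \<open>u\<close>\<close>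

lemma DERIV_const_on_open:
  assumes "(f has_field_derivative d) (at x)" "open S" "x \<in> S" "\<And>y. y \<in> S \<Longrightarrow> f y = c"
  shows "d = 0"
  by (rule DERIV_locally_const[OF assms(1) eventually_mono[OF eventually_nhds_in_open[OF assms(2,3)] assms(4)]])

text \<open>Integrating factor exp (- G), with G an antiderivative of g on the compact segment
  between t1 and t. The conclusion therefore holds on the whole interval and not only near
  t1.\<close>

lemma linear_ode_zero:
  fixes w g :: "real \<Rightarrow> real"
  assumes "is_interval T" "continuous_on T g"
    and w: "\<And>t. t \<in> T \<Longrightarrow> (w has_field_derivative g t * w t) (at t)"
    and t1: "t1 \<in> T" "w t1 = 0" and t: "t \<in> T"
  shows "w t = 0"
proof -
  define c d where "c = min t1 t" and "d = max t1 t"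
  have cT: "c \<in> T" and dT: "d \<in> T" using t1 t by (auto simp: c_def d_def min_def max_def)
  have cd: "{c..d} \<subseteq> T" "t1 \<in> {c..d}" "t \<in> {c..d}"
  proof
    fix y assume "y \<in> {c..d}"
    then have "c \<le> y" "y \<le> d" by simp_all
    then show "y \<in> T" by (rule mem_is_interval_1_I[OF assms(1) cT dT])
  qed (simp_all add: c_def d_def)
  obtain G where G: "\<And>x. x \<in> {c..d} \<Longrightarrow> (G has_vector_derivative g x) (at x within {c..d})"
    using antiderivative_continuous[OF continuous_on_subset[OF assms(2) cd(1)]] by metis
  have "((\<lambda>x. w x * exp (- G x)) has_field_derivative 0) (at x within {c..d})" if x: "x \<in> {c..d}" for x
  proof -
    have "(G has_field_derivative g x) (at x within {c..d})"
      using G[OF x] by (simp add: has_real_derivative_iff_has_vector_derivative)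
    moreover have "(w has_field_derivative g x * w x) (at x within {c..d})"
      using w[OF subsetD[OF cd(1) x]] by (rule has_field_derivative_at_within)
    ultimately show ?thesis by (auto intro!: derivative_eq_intros)
  qed
  then obtain e where "\<forall>x\<in>{c..d}. w x * exp (- G x) = e"
    using has_field_derivative_zero_constant[of "{c..d}" "\<lambda>x. w x * exp (- G x)"] by auto
  then have "w t * exp (- G t) = w t1 * exp (- G t1)" using cd by metis
  then show ?thesis using t1 by simp
qed

lemma equivalent_to_lie_self:
  "lie_symmetry k \<Omega> Q \<Longrightarrow> equivalent_to_lie k \<Omega> Q"
  unfolding equivalent_to_lie_def by (rule exI[of _ "\<lambda>p. 1"]) (auto simp: smooth_on_const)

text \<open>For each t the first equation is a linear equation of first order in x, so all b(t, .)
  are multiples s(t) \<phi> of one of them; taking \<phi> at a time t1 where b is not zero gives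
  s(t1) = 1. Eliminating \<phi>'' between the times t and t1 leaves s' - s s'(t1) = 2 \<phi>' (s -
  s^2). If \<phi>' is not constant, then s only takes the values 0 and 1, hence s = 1; if it is
  constant, the operator turns out to be a multiple of a Lie symmetry.\<close>

lemma linear_reduction:
  assumes I: "open_interval T" "open_interval X" "open_interval U" and \<Omega>: "\<Omega> = T \<times> X \<times> U"
    and k: "smooth_on X k" "\<And>x. x \<in> X \<Longrightarrow> k x \<noteq> 0" and sQ: "smooth_on \<Omega> Q"
    and sb: "smooth2 T X b" and Q: "\<And>t x u. (t, x, u) \<in> \<Omega> \<Longrightarrow> Q (t, x, u) = (1, b t x, 0)"
    and e: "\<And>t x. t \<in> T \<Longrightarrow> x \<in> X \<Longrightarrow> 2 * Dx b t x * k x + b t x * deriv k x = 0"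
      "\<And>t x. t \<in> T \<Longrightarrow> x \<in> X \<Longrightarrow> Dt b t x = Dx (Dx b) t x - 2 * b t x * Dx b t x"
    and non_lie: "\<not> equivalent_to_lie k \<Omega> Q"
  obtains \<phi> c \<kappa> where "\<And>t x. t \<in> T \<Longrightarrow> x \<in> X \<Longrightarrow> b t x = \<phi> x" "\<And>x. x \<in> X \<Longrightarrow> \<phi> x \<noteq> 0"
    "\<And>x. x \<in> X \<Longrightarrow> (\<phi> has_field_derivative (\<phi> x)\<^sup>2 + \<kappa>) (at x)"
    "\<And>x. x \<in> X \<Longrightarrow> k x = c / (\<phi> x)\<^sup>2" "c \<noteq> 0"
proof -
  have o: "open T" "open X" "open U" and iT: "is_interval T" and iX: "is_interval X" and iU: "is_interval U"
    using I by (auto simp: open_interval_def)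
  have op: "open \<Omega>" using o by (simp add: \<Omega> open_box)
  have in\<Omega>: "(t, x, u) \<in> \<Omega> \<longleftrightarrow> t \<in> T \<and> x \<in> X \<and> u \<in> U" for t x u by (simp add: \<Omega>)
  note kd = smooth_on_real_deriv(1)[OF o(2) k(1)]
  note bt = smooth2_deriv(1)[OF o(1,2) sb] and bx = smooth2_deriv(2)[OF o(1,2) sb]
  \<comment> \<open>Otherwise the operator is the time translation, a Lie symmetry for every
    k.\<close>
  have "\<exists>t\<in>T. \<exists>x\<in>X. b t x \<noteq> 0"
  proof (rule ccontr)
    assume "\<not> (\<exists>t\<in>T. \<exists>x\<in>X. b t x \<noteq> 0)"
    then have Q0: "Q (t, x, u) = (1, 0, 0)" if "(t, x, u) \<in> \<Omega>" for t x u using Q[OF that] that by (simp add: in\<Omega>)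
    have "lie_symmetry k \<Omega> Q"
      by (rule lie_symmetry_affine[OF op sQ, where \<tau> = "\<lambda>t. 1" and \<xi> = "\<lambda>x. 0" and \<alpha> = 0 and kx = "deriv k"])
        (use kd in \<open>auto simp: Q0 in\<Omega>\<close>)
    then show False using non_lie equivalent_to_lie_self by blast
  qed
  then obtain t1 x1 where t1: "t1 \<in> T" and x1: "x1 \<in> X" and b1: "b t1 x1 \<noteq> 0" by blast
  define \<phi> where "\<phi> = b t1"
  define \<phi>' where "\<phi>' = Dx b t1"
  have d\<phi>: "(\<phi> has_field_derivative \<phi>' x) (at x)" if "x \<in> X" for x
    unfolding \<phi>_def \<phi>'_def by (rule bx[OF t1 that])
  have d\<phi>': "(\<phi>' has_field_derivative Dx (Dx b) t1 x) (at x)" if "x \<in> X" for x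
    unfolding \<phi>'_def by (rule smooth2_deriv(2)[OF o(1,2) smooth2_deriv(4)[OF o(1,2) sb] t1 that])
  have e\<phi>: "2 * \<phi>' x * k x + \<phi> x * deriv k x = 0" if "x \<in> X" for x
    using e(1)[OF t1 that] by (simp add: \<phi>_def \<phi>'_def)
  define c where "c = (\<phi> x1)\<^sup>2 * k x1"
  have c0: "c \<noteq> 0" using b1 k(2)[OF x1] by (simp add: c_def \<phi>_def)
  have \<phi>k: "(\<phi> x)\<^sup>2 * k x = c" if "x \<in> X" for x
  proof -
    have "((\<lambda>x. (\<phi> x)\<^sup>2 * k x) has_field_derivative 0) (at x)" if "x \<in> X" for x
    proof -
      have "((\<lambda>x. (\<phi> x)\<^sup>2 * k x) has_field_derivative \<phi> x * (2 * \<phi>' x * k x + \<phi> x * deriv k x)) (at x)"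
        using d\<phi>[OF that] kd[OF that] by (auto intro!: derivative_eq_intros simp: algebra_simps power2_eq_square)
      then show ?thesis using e\<phi>[OF that] by simp
    qed
    from DERIV_zero_interval[OF iX this that x1] show ?thesis by (simp add: c_def)
  qed
  have \<phi>0: "\<phi> x \<noteq> 0" if "x \<in> X" for x using \<phi>k[OF that] c0 by auto
  have kc: "k x = c / (\<phi> x)\<^sup>2" if "x \<in> X" for x using \<phi>k[OF that] \<phi>0[OF that] by (simp add: field_simps)
  define s where "s t = b t x1 / \<phi> x1" for t
  have bs: "b t x = s t * \<phi> x" if t: "t \<in> T" and x: "x \<in> X" for t x
  proof -
    have "((\<lambda>x. b t x / \<phi> x) has_field_derivative 0) (at x)" if "x \<in> X" for x
    proof -
      have "2 * k x * (Dx b t x * \<phi> x - b t x * \<phi>' x) = 0"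
        using e(1)[OF t that] e\<phi>[OF that] by algebra
      then have "Dx b t x * \<phi> x - b t x * \<phi>' x = 0" using k(2)[OF that] by simp
      then show ?thesis
        using bx[OF t that] d\<phi>[OF that] \<phi>0[OF that] by (auto intro!: derivative_eq_intros)
    qed
    from DERIV_zero_interval[OF iX this x x1] show ?thesis
      using \<phi>0[OF x] by (simp add: s_def field_simps)
  qed
  define s' where "s' t = Dt b t x1 / \<phi> x1" for t
  have ds: "(s has_field_derivative s' t) (at t)" if "t \<in> T" for t
    unfolding s_def[abs_def] s'_def using bt[OF that x1] \<phi>0[OF x1] by (auto intro!: derivative_eq_intros)
  have s1: "s t1 = 1" using \<phi>0[OF x1] by (simp add: s_def \<phi>_def)
  define \<phi>'' where "\<phi>'' = Dx (Dx b) t1"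
  have pde: "s' t * \<phi> x = s t * \<phi>'' x - 2 * (s t)\<^sup>2 * \<phi> x * \<phi>' x" if t: "t \<in> T" and x: "x \<in> X" for t x
  proof -
    have "Dt b t x = s' t * \<phi> x"
      unfolding Dt_def
      by (rule deriv_on_open[OF o(1) t, of _ "\<lambda>t. s t * \<phi> x"])
        (use bs x ds[OF t] in \<open>auto intro!: derivative_eq_intros\<close>)
    moreover have Dxb: "Dx b t x = s t * \<phi>' x" if "x \<in> X" for x
      unfolding Dx_def
      by (rule deriv_on_open[OF o(2) that, of _ "\<lambda>x. s t * \<phi> x"])
        (use bs[OF t] d\<phi>[OF that] in \<open>auto intro!: derivative_eq_intros\<close>)
    moreover have "Dx (Dx b) t x = s t * \<phi>'' x"
      unfolding Dx_def[of "Dx b"] \<phi>''_def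
      by (rule deriv_on_open[OF o(2) x, of _ "\<lambda>x. s t * \<phi>' x"])
        (use Dxb d\<phi>'[OF x] in \<open>auto intro!: derivative_eq_intros simp: Dx_def[of "Dx b"]\<close>)
    ultimately show ?thesis using e(2)[OF t x] bs[OF t x] x by (simp add: power2_eq_square algebra_simps)
  qed
  have sep: "s' t - s t * s' t1 = 2 * \<phi>' x * (s t - (s t)\<^sup>2)" if t: "t \<in> T" and x: "x \<in> X" for t x
  proof -
    have "\<phi> x * (s' t - s t * s' t1 - 2 * \<phi>' x * (s t - (s t)\<^sup>2)) = 0"
      using pde[OF t x] pde[OF t1 x] s1 by algebra
    then show ?thesis using \<phi>0[OF x] by simp
  qed
  show thesis
  proof (cases "\<exists>x2\<in>X. \<exists>x3\<in>X. \<phi>' x2 \<noteq> \<phi>' x3")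
    case True
    then obtain x2 x3 where x23: "x2 \<in> X" "x3 \<in> X" "\<phi>' x2 \<noteq> \<phi>' x3" by blast
    have s01: "s t = 0 \<or> s t = 1" if "t \<in> T" for t
    proof -
      have "(\<phi>' x2 - \<phi>' x3) * (s t * (1 - s t)) = 0"
        using sep[OF that x23(1)] sep[OF that x23(2)] by algebra
      then show ?thesis using x23(3) by simp
    qed
    have "continuous_on T s"
      using ds by (intro continuous_at_imp_continuous_on) (blast intro: DERIV_isCont)
    moreover have "finite (s ` T)" by (rule finite_subset[of _ "{0, 1}"]) (use s01 in auto)
    ultimately have "s constant_on T"
      using continuous_finite_range_constant[of T s] iT is_interval_connected by blast
    then have sc: "s t = 1" if "t \<in> T" for t using that t1 s1 unfolding constant_on_def by metis
    have "s' t1 = 0"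
      by (rule DERIV_const_on_open[OF ds[OF t1] o(1) t1 sc])
    then have \<phi>'': "\<phi>'' x = 2 * \<phi> x * \<phi>' x" if "x \<in> X" for x
      using pde[OF t1 that] s1 by simp
    \<comment> \<open>The constant of the first integral \<phi>' - \<phi>^2 of \<phi>'' = 2 \<phi>
      \<phi>'.\<close>
    define \<kappa> where "\<kappa> = \<phi>' x1 - (\<phi> x1)\<^sup>2"
    have \<phi>': "\<phi>' x = (\<phi> x)\<^sup>2 + \<kappa>" if "x \<in> X" for x
    proof -
      have "((\<lambda>x. \<phi>' x - (\<phi> x)\<^sup>2) has_field_derivative 0) (at x)" if "x \<in> X" for x
        using d\<phi>[OF that] d\<phi>'[OF that] \<phi>''[OF that]
        by (auto intro!: derivative_eq_intros simp: \<phi>''_def)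
      from DERIV_zero_interval[OF iX this that x1] show ?thesis by (simp add: \<kappa>_def)
    qed
    show thesis
    proof (rule that[of \<phi> \<kappa> c])
      show "(\<phi> has_field_derivative (\<phi> x)\<^sup>2 + \<kappa>) (at x)" if "x \<in> X" for x
        using d\<phi>[OF that] \<phi>'[OF that] by simp
    qed (use bs sc \<phi>0 kc c0 in auto)
  next
    case False
    define \<alpha> where "\<alpha> = \<phi>' x1"
    have \<alpha>: "\<phi>' x = \<alpha>" if "x \<in> X" for x using False that x1 unfolding \<alpha>_def by blast
    have "\<phi>'' x1 = 0"
      unfolding \<phi>''_def by (rule DERIV_const_on_open[OF d\<phi>'[OF x1] o(2) x1 \<alpha>])
    then have s': "s' t = - 2 * \<alpha> * (s t)\<^sup>2" if "t \<in> T" for t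
    proof -
      have "\<phi> x1 * (s' t + 2 * \<alpha> * (s t)\<^sup>2) = 0"
        using pde[OF that x1] \<open>\<phi>'' x1 = 0\<close> \<alpha>[OF x1] by algebra
      then show ?thesis using \<phi>0[OF x1] by simp
    qed
    \<comment> \<open>The solution of s' = -2 \<alpha> s^2 with s(t1) = 1 is 1 / r. Instead of
      dividing by s, which might vanish, one uses that w = s r - 1 satisfies w' = -2 \<alpha> s w
      and w(t1) = 0.\<close>
    define r where "r t = 1 + 2 * \<alpha> * (t - t1)" for t
    have sr: "s t * r t - 1 = 0" if "t \<in> T" for t
    proof (rule linear_ode_zero[OF iT, where g = "\<lambda>t. - 2 * \<alpha> * s t"
          and w = "\<lambda>t. s t * r t - 1" and ?t1.0 = t1])
      show "continuous_on T (\<lambda>t. - 2 * \<alpha> * s t)"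
        using ds by (intro continuous_intros continuous_at_imp_continuous_on) (blast intro: DERIV_isCont)
      show "((\<lambda>t. s t * r t - 1) has_field_derivative - 2 * \<alpha> * s t * (s t * r t - 1)) (at t)" if "t \<in> T" for t
        unfolding r_def using ds[OF that] s'[OF that]
        by (auto intro!: derivative_eq_intros simp: algebra_simps power2_eq_square)
      show "s t1 * r t1 - 1 = 0" by (simp add: s1 r_def)
    qed (fact t1 that)+
    have r0: "r t \<noteq> 0" if "t \<in> T" for t using sr[OF that] by auto
    then have s: "s t = 1 / r t" if "t \<in> T" for t using sr[OF that] that by (simp add: eq_divide_eq)
    \<comment> \<open>Both components are affine, with slopes 2 \<alpha> and \<alpha>, as
      \<open>lie_symmetry_affine\<close> demands; Q is V divided by r.\<close>
    define V where "V = (\<lambda>(t :: real, x :: real, u :: real). (r t, \<phi> x, 0 :: real))"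
    have sr: "smooth_on \<Omega> (\<lambda>p. r (fst p))" unfolding r_def
      by (intro smooth_intros op smooth_on_bounded_linear bounded_linear_fst)
    have s\<phi>: "smooth_on \<Omega> (\<lambda>p. \<phi> (fst (snd p)))"
      using smooth_on_affine_comp[OF op bounded_linear_compose[OF bounded_linear_fst bounded_linear_snd] _
        smooth2_section[OF o(2) sb t1], of 0] by (auto simp: \<Omega> \<phi>_def)
    have sV: "smooth_on \<Omega> V"
      using smooth_on_Pair[OF op sr smooth_on_Pair[OF op s\<phi> smooth_on_const[of _ "0 :: real"]]]
      by (simp add: V_def case_prod_beta')
    have "lie_symmetry k \<Omega> V"
    proof (rule lie_symmetry_affine[OF op sV, where \<tau> = r and \<xi> = \<phi> and \<alpha> = \<alpha> and kx = "deriv k"])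
      show "(r has_field_derivative 2 * \<alpha>) (at t)" for t
        unfolding r_def by (auto intro!: derivative_eq_intros)
    qed (use kd d\<phi> \<alpha> e\<phi> in \<open>auto simp: in\<Omega> V_def algebra_simps\<close>)
    moreover have "smooth_on \<Omega> (\<lambda>p. 1 / r (fst p))"
      using r0 by (intro smooth_intros op sr) (auto simp: \<Omega>)
    moreover have "Q p = (1 / r (fst p)) *\<^sub>R V p" if "p \<in> \<Omega>" for p
      using that Q bs s r0 by (auto simp: \<Omega> V_def)
    moreover have "1 / r (fst p) \<noteq> 0" if "p \<in> \<Omega>" for p using that r0 by (auto simp: \<Omega>)
    ultimately have "equivalent_to_lie k \<Omega> Q" unfolding equivalent_to_lie_def by blast
    then show thesis using non_lie by blast
  qed
qed

section \<open>Normalisation by the equivalence group\<close>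

lemma open_interval_affine:
  assumes "open_interval S" "m \<noteq> 0"
  shows "open_interval ((\<lambda>x. m * x + c) ` S)"
proof -
  have "open ((\<lambda>x. c + m *\<^sub>R x) ` S)"
    using assms by (intro open_affinity) (auto simp: open_interval_def)
  moreover have "connected ((\<lambda>x. m * x + c) ` S)"
    using assms by (intro connected_continuous_image continuous_intros)
      (auto simp: open_interval_def is_interval_connected)
  ultimately show ?thesis
    using assms(1) by (simp add: open_interval_def is_interval_connected_1 add.commute)
qed

text \<open>The pushforward multiplies \<tau>, \<xi>, \<eta> by \<epsilon>1^2, \<epsilon>1, 1; the
  multiplier 1 / \<epsilon>1^2 restores \<tau> = 1, whence the divisions in the conditions on \<xi>'
  and \<eta>'. As the data do not depend on t, \<epsilon>2 = 0 suffices.\<close>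

lemma G_equivalentI:
  assumes dom: "interval_domains P" and \<epsilon>: "\<epsilon>1 \<noteq> 0"
    and Q: "\<And>t x u. (t, x, u) \<in> dom3 P \<Longrightarrow> oper P (t, x, u) = (1, \<xi> x u, \<eta> x u)"
    and k': "\<And>x. x \<in> x_dom P \<Longrightarrow> k' (\<epsilon>1 * x + \<epsilon>3) = coef P x / \<epsilon>1\<^sup>2"
    and \<xi>': "\<And>x u. x \<in> x_dom P \<Longrightarrow> u \<in> u_dom P \<Longrightarrow> \<xi>' (\<epsilon>1 * x + \<epsilon>3) u = \<xi> x u / \<epsilon>1"
    and \<eta>': "\<And>x u. x \<in> x_dom P \<Longrightarrow> u \<in> u_dom P \<Longrightarrow> \<eta>' (\<epsilon>1 * x + \<epsilon>3) u = \<eta> x u / \<epsilon>1\<^sup>2"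
  obtains P' where "interval_domains P'" "agrees P' k' \<xi>' \<eta>'" "G_equivalent P P'"
    "x_dom P' = (\<lambda>x. \<epsilon>1 * x + \<epsilon>3) ` x_dom P"
proof -
  define P' where "P' = \<lparr>t_dom = (\<lambda>t. \<epsilon>1\<^sup>2 * t + 0) ` t_dom P, x_dom = (\<lambda>x. \<epsilon>1 * x + \<epsilon>3) ` x_dom P,
    u_dom = u_dom P, coef = k', oper = (\<lambda>(t, x, u). (1, \<xi>' x u, \<eta>' x u))\<rparr>"
  have "(G_map \<epsilon>1 0 \<epsilon>3 has_derivative (\<lambda>v. (\<epsilon>1\<^sup>2 * fst v, \<epsilon>1 * fst (snd v), snd (snd v)))) (at p)" for p
    unfolding G_map_def case_prod_beta' by (auto intro!: derivative_eq_intros)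
  then have D: "frechet_derivative (G_map \<epsilon>1 0 \<epsilon>3) (at p) = (\<lambda>v. (\<epsilon>1\<^sup>2 * fst v, \<epsilon>1 * fst (snd v), snd (snd v)))" for p
    by (rule frechet_derivative_at[symmetric])
  have "oper P' (G_map \<epsilon>1 0 \<epsilon>3 p) = (1 / \<epsilon>1\<^sup>2) *\<^sub>R frechet_derivative (G_map \<epsilon>1 0 \<epsilon>3) (at p) (oper P p)"
    if p: "p \<in> dom3 P" for p
  proof -
    obtain t x u where [simp]: "p = (t, x, u)" by (cases p)
    have "x \<in> x_dom P" "u \<in> u_dom P" using p by (auto simp: dom3_def)
    then show ?thesis
      unfolding D using Q[of t x u] p \<xi>' \<eta>' \<epsilon> by (simp add: P'_def G_map_def power2_eq_square)
  qed
  then have "G_equivalent P P'"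
    unfolding G_equivalent_def
    by (intro exI[of _ \<epsilon>1] exI[of _ "0::real"] exI[of _ \<epsilon>3] exI[of _ "\<lambda>p. 1 / \<epsilon>1\<^sup>2"])
      (use \<epsilon> k' in \<open>auto simp: P'_def smooth_on_const\<close>)
  moreover have "interval_domains P'"
    using dom \<epsilon> open_interval_affine[of "t_dom P" "\<epsilon>1\<^sup>2" 0]
    unfolding interval_domains_def P'_def by (auto intro: open_interval_affine)
  moreover have "agrees P' k' \<xi>' \<eta>'"
    by (auto simp: agrees_def P'_def)
  ultimately show thesis by (intro that[of P']) (auto simp: P'_def)
qed

text \<open>Besides the listed profiles, the Riccati equation for \<open>\<phi>\<close> only has constant solutions, which
  belong to Lie symmetries.\<close>

lemma riccati_normal_form:
  assumes dom: "interval_domains P"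
    and k: "smooth_on (x_dom P) (coef P)" and sQ: "smooth_on (dom3 P) (oper P)"
    and Q: "\<And>t x u. (t, x, u) \<in> dom3 P \<Longrightarrow> oper P (t, x, u) = (1, \<phi> x, 0)"
    and \<phi>0: "\<And>x. x \<in> x_dom P \<Longrightarrow> \<phi> x \<noteq> 0"
    and d\<phi>: "\<And>x. x \<in> x_dom P \<Longrightarrow> (\<phi> has_field_derivative (\<phi> x)\<^sup>2 + \<kappa>) (at x)"
    and kc: "\<And>x. x \<in> x_dom P \<Longrightarrow> coef P x = c / (\<phi> x)\<^sup>2" and c: "c \<noteq> 0"
    and non_lie: "\<not> equivalent_to_lie (coef P) (dom3 P) (oper P)"
  shows "\<exists>P'. listed P' \<and> G_equivalent P P'"
proof -
  let ?X = "x_dom P"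
  have op: "open ?X" and iX: "is_interval ?X" using dom by (auto simp: interval_domains_def open_interval_def)
  obtain x0 where x0: "x0 \<in> ?X" using dom by (auto simp: interval_domains_def open_interval_def)
  consider "\<kappa> = 0" | "\<kappa> > 0" | "\<kappa> < 0" by linarith
  then show ?thesis
  proof cases
    case 1
    define \<delta> where "\<delta> = - 1 / \<phi> x0 - x0"
    have \<delta>: "- 1 / \<phi> x = x + \<delta>" if "x \<in> ?X" for x
    proof -
      have "((\<lambda>x. - 1 / \<phi> x - x) has_field_derivative 0) (at x)" if "x \<in> ?X" for x
        using d\<phi>[OF that] \<phi>0[OF that] 1 by (auto intro!: derivative_eq_intros simp: power2_eq_square)
      from DERIV_zero_interval[OF iX this that x0] show ?thesis by (simp add: \<delta>_def)
    qed
    have \<phi>: "x + \<delta> \<noteq> 0" "\<phi> x = - (1 / (x + \<delta>))" if "x \<in> ?X" for x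
      using \<phi>0[OF that] unfolding \<delta>[OF that, symmetric] by simp_all
    obtain P' where "interval_domains P'" "agrees P' (\<lambda>x. c * x\<^sup>2) (\<lambda>x u. - (1 / x)) (\<lambda>x u. 0)"
      "G_equivalent P P'" "x_dom P' = (\<lambda>x. 1 * x + \<delta>) ` ?X"
      by (rule G_equivalentI[OF dom _ Q, where ?\<epsilon>1.0 = 1 and ?\<epsilon>3.0 = \<delta> and k' = "\<lambda>x. c * x\<^sup>2"
          and \<xi>' = "\<lambda>x u. - (1 / x)" and \<eta>' = "\<lambda>x u. 0"])
        (use \<phi> kc in \<open>simp_all add: power_divide\<close>)
    moreover have "0 \<notin> (\<lambda>x. 1 * x + \<delta>) ` ?X" using \<phi>(1) by force
    ultimately have "listed P'" unfolding listed_def using c by metis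
    then show ?thesis using \<open>G_equivalent P P'\<close> by blast
  next
    case 2
    define \<omega> where "\<omega> = sqrt \<kappa>"
    have \<omega>: "\<omega> > 0" "\<kappa> = \<omega>\<^sup>2" using 2 by (simp_all add: \<omega>_def)
    \<comment> \<open>The arctangent of \<phi> / \<omega> has derivative \<omega>; applying it to
      the given solution avoids choosing a branch of tan. The further shift by pi / 2 below turns
      tan into -cot, the form in the list.\<close>
    define \<delta> where "\<delta> = arctan (\<phi> x0 / \<omega>) - \<omega> * x0"
    have \<delta>: "arctan (\<phi> x / \<omega>) = \<omega> * x + \<delta>" if "x \<in> ?X" for x
    proof -
      have "((\<lambda>x. arctan (\<phi> x / \<omega>) - \<omega> * x) has_field_derivative 0) (at x)" if "x \<in> ?X" for x
      proof -
        have "((\<lambda>x. arctan (\<phi> x / \<omega>) - \<omega> * x) has_field_derivative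
            ((\<phi> x)\<^sup>2 + \<kappa>) / \<omega> * inverse (1 + (\<phi> x / \<omega>)\<^sup>2) - \<omega>) (at x)"
          using d\<phi>[OF that] \<omega>(1) by (auto intro!: derivative_eq_intros simp: divide_inverse)
        moreover have "((\<phi> x)\<^sup>2 + \<kappa>) / \<omega> * inverse (1 + (\<phi> x / \<omega>)\<^sup>2) = \<omega>"
          using \<omega> by (simp add: field_simps power2_eq_square add_nonneg_eq_0_iff)
        ultimately show ?thesis by simp
      qed
      from DERIV_zero_interval[OF iX this that x0] show ?thesis by (simp add: \<delta>_def)
    qed
    have \<phi>: "\<phi> x / \<omega> = tan (\<omega> * x + \<delta>)" "cos (\<omega> * x + \<delta>) \<noteq> 0" if "x \<in> ?X" for x
      unfolding \<delta>[OF that, symmetric] by (simp_all add: tan_arctan)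
    have sc: "sin (\<omega> * x + (\<delta> + pi / 2)) = cos (\<omega> * x + \<delta>)" "cos (\<omega> * x + (\<delta> + pi / 2)) = - sin (\<omega> * x + \<delta>)" for x
      using sin_add[of "\<omega> * x + \<delta>" "pi / 2"] cos_add[of "\<omega> * x + \<delta>" "pi / 2"] by (simp_all add: add.assoc)
    have s0: "sin (\<omega> * x + \<delta>) \<noteq> 0" if "x \<in> ?X" for x
      using \<phi>(1)[OF that] \<phi>0[OF that] \<omega> by (auto simp: tan_def)
    have cot: "- cot (\<omega> * x + (\<delta> + pi / 2)) = \<phi> x / \<omega>" if "x \<in> ?X" for x
      using \<phi>(1)[OF that] by (simp add: cot_def sc tan_def)
    \<comment> \<open>Two of the four powers of \<omega> come from the factor \<omega> in \<phi>,
      the other two from dividing k by \<epsilon>1^2.\<close>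
    have tan: "c / \<omega> ^ 4 * (tan (\<omega> * x + (\<delta> + pi / 2)))\<^sup>2 = coef P x / \<omega>\<^sup>2" if "x \<in> ?X" for x
    proof -
      have "\<phi> x = \<omega> * (sin (\<omega> * x + \<delta>) / cos (\<omega> * x + \<delta>))"
        using \<phi>(1)[OF that] \<omega>(1) by (simp add: tan_def field_simps)
      then have *: "tan (\<omega> * x + (\<delta> + pi / 2)) = - (\<omega> / \<phi> x)"
        unfolding tan_def sc using \<omega>(1) by simp
      show ?thesis unfolding * kc[OF that] using \<omega>(1) \<phi>0[OF that] by (simp add: field_simps eval_nat_numeral)
    qed
    obtain P' where "interval_domains P'" "agrees P' (\<lambda>x. c / \<omega> ^ 4 * (tan x)\<^sup>2) (\<lambda>x u. - cot x) (\<lambda>x u. 0)"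
      "G_equivalent P P'" "x_dom P' = (\<lambda>x. \<omega> * x + (\<delta> + pi / 2)) ` ?X"
      by (rule G_equivalentI[OF dom _ Q, where ?\<epsilon>1.0 = \<omega> and ?\<epsilon>3.0 = "\<delta> + pi / 2" and k' = "\<lambda>x. c / \<omega> ^ 4 * (tan x)\<^sup>2"
          and \<xi>' = "\<lambda>x u. - cot x" and \<eta>' = "\<lambda>x u. 0"])
        (use \<omega> cot tan in simp_all)
    moreover have "\<forall>x\<in>(\<lambda>x. \<omega> * x + (\<delta> + pi / 2)) ` ?X. sin x \<noteq> 0 \<and> cos x \<noteq> 0"
      using \<phi>(2) s0 by (auto simp: sc)
    moreover have "c / \<omega> ^ 4 \<noteq> 0" using c \<omega> by simp
    ultimately have "listed P'" unfolding listed_def by blast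
    then show ?thesis using \<open>G_equivalent P P'\<close> by blast
  next
    case 3
    define \<omega> where "\<omega> = sqrt (- \<kappa>)"
    have \<omega>: "\<omega> > 0" "\<kappa> = - \<omega>\<^sup>2" using 3 by (simp_all add: \<omega>_def)
    have cont: "continuous_on ?X \<phi>"
      using d\<phi> by (intro continuous_at_imp_continuous_on) (blast intro: DERIV_isCont)
    \<comment> \<open>The quantity \<phi>^2 + \<kappa> satisfies the linear equation w' = 2 \<phi>
      w, so a single zero makes \<phi> constant. Then k is constant too and the operator is a
      combination of translations.\<close>
    have ne: "(\<phi> x)\<^sup>2 \<noteq> \<omega>\<^sup>2" if x: "x \<in> ?X" for x
    proof
      assume eq: "(\<phi> x)\<^sup>2 = \<omega>\<^sup>2"
      have z: "(\<phi> y)\<^sup>2 + \<kappa> = 0" if "y \<in> ?X" for y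
      proof (rule linear_ode_zero[OF iX, where g = "\<lambda>y. 2 * \<phi> y" and w = "\<lambda>y. (\<phi> y)\<^sup>2 + \<kappa>" and ?t1.0 = x])
        show "continuous_on ?X (\<lambda>y. 2 * \<phi> y)" by (intro continuous_intros cont)
        show "((\<lambda>y. (\<phi> y)\<^sup>2 + \<kappa>) has_field_derivative 2 * \<phi> y * ((\<phi> y)\<^sup>2 + \<kappa>)) (at y)" if "y \<in> ?X" for y
          using d\<phi>[OF that] by (auto intro!: derivative_eq_intros)
      qed (use eq \<omega> x that in auto)
      have k0: "coef P y = c / \<omega>\<^sup>2" if "y \<in> ?X" for y using kc[OF that] z[OF that] \<omega> by simp
      have kd: "(coef P has_field_derivative 0) (at y)" if "y \<in> ?X" for y
        by (rule has_field_derivative_transform_within_open[OF DERIV_const op that]) (simp add: k0)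
      have "lie_symmetry (coef P) (dom3 P) (oper P)"
        by (rule lie_symmetry_affine[OF interval_domainsD(2)[OF dom] sQ, where \<tau> = "\<lambda>t. 1" and \<xi> = \<phi> and \<alpha> = 0 and kx = "\<lambda>x. 0"])
          (use Q kd d\<phi> z in \<open>auto simp: dom3_def\<close>)
      then show False using non_lie equivalent_to_lie_self by blast
    qed
    \<comment> \<open>First integral obtained by separating variables in \<phi>' = \<phi>^2 -
      \<omega>^2. Its sign tells whether |\<phi>| is below or above \<omega>, that is, whether the
      profile is tanh (case 3) or coth (case 2).\<close>
    define E where "E x = (\<omega> + \<phi> x) / (\<omega> - \<phi> x) * exp (2 * \<omega> * x)" for x
    have m0: "\<omega> - \<phi> x \<noteq> 0" "\<omega> + \<phi> x \<noteq> 0" if "x \<in> ?X" for x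
      using ne[OF that] by (auto simp: eq_neg_iff_add_eq_0[symmetric])
    have dE: "(E has_field_derivative 0) (at x)" if "x \<in> ?X" for x
    proof -
      have "((\<lambda>x. (\<omega> + \<phi> x) / (\<omega> - \<phi> x)) has_field_derivative
          ((0 + ((\<phi> x)\<^sup>2 + \<kappa>)) * (\<omega> - \<phi> x) - (\<omega> + \<phi> x) * (0 - ((\<phi> x)\<^sup>2 + \<kappa>))) / ((\<omega> - \<phi> x) * (\<omega> - \<phi> x))) (at x)"
        by (intro DERIV_divide DERIV_add DERIV_diff DERIV_const d\<phi> that m0)
      moreover have "((0 + ((\<phi> x)\<^sup>2 + \<kappa>)) * (\<omega> - \<phi> x) - (\<omega> + \<phi> x) * (0 - ((\<phi> x)\<^sup>2 + \<kappa>))) / ((\<omega> - \<phi> x) * (\<omega> - \<phi> x))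
          = - 2 * \<omega> * ((\<omega> + \<phi> x) / (\<omega> - \<phi> x))"
        unfolding \<omega>(2) using m0(1)[OF that] by (simp add: divide_simps) (simp add: algebra_simps power2_eq_square)
      ultimately have r: "((\<lambda>x. (\<omega> + \<phi> x) / (\<omega> - \<phi> x)) has_field_derivative
          - 2 * \<omega> * ((\<omega> + \<phi> x) / (\<omega> - \<phi> x))) (at x)" by simp
      have "((\<lambda>x. exp (2 * \<omega> * x)) has_field_derivative exp (2 * \<omega> * x) * (2 * \<omega>)) (at x)"
        by (auto intro!: derivative_eq_intros)
      from DERIV_mult[OF r this] show ?thesis
        unfolding E_def[abs_def] by (rule DERIV_cong) algebra
    qed
    have E: "E x = E x0" if "x \<in> ?X" for x
      by (rule DERIV_zero_interval[OF iX dE that x0])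
    have E0: "E x0 \<noteq> 0" using m0[OF x0] by (simp add: E_def)
    define \<delta> where "\<delta> = - ln \<bar>E x0\<bar> / 2"
    have absE: "\<bar>E x0\<bar> = exp (- 2 * \<delta>)" using E0 by (simp add: \<delta>_def)
    define y where "y x = \<omega> * x + \<delta>" for x
    have ratio: "(\<omega> + \<phi> x) / (\<omega> - \<phi> x) = sgn (E x0) * exp (- 2 * y x)" if "x \<in> ?X" for x
    proof -
      have "(\<omega> + \<phi> x) / (\<omega> - \<phi> x) = E x0 * exp (- 2 * \<omega> * x)"
        by (subst E[OF that, symmetric]) (simp add: E_def mult.assoc flip: exp_add)
      also have "E x0 = sgn (E x0) * exp (- 2 * \<delta>)" using absE by (metis mult_sgn_abs)
      finally show ?thesis by (simp add: y_def mult.assoc algebra_simps flip: exp_add)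
    qed
    have tanh: "tanh (y x) = (1 - exp (- 2 * y x)) / (1 + exp (- 2 * y x))" for x
      by (rule tanh_real_altdef)
    have pos: "1 + exp (- 2 * y x) \<noteq> 0" for x by (metis add_pos_pos exp_gt_zero less_irrefl zero_less_one)
    show ?thesis
    proof (cases "E x0 > 0")
      case True
      have \<phi>: "\<phi> x / \<omega> = - tanh (y x)" if "x \<in> ?X" for x
      proof -
        have "\<omega> + \<phi> x = exp (- 2 * y x) * (\<omega> - \<phi> x)"
          using ratio[OF that] True m0[OF that] by (simp add: field_simps)
        then have "\<phi> x * (1 + exp (- 2 * y x)) = - \<omega> * (1 - exp (- 2 * y x))" by algebra
        then show ?thesis unfolding tanh using \<omega>(1) pos[of x] by (simp add: field_simps)
      qed
      have y0: "y x \<noteq> 0" if "x \<in> ?X" for x using \<phi>[OF that] \<phi>0[OF that] \<omega> by auto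
      have k': "c / \<omega> ^ 4 * (coth (y x))\<^sup>2 = coef P x / \<omega>\<^sup>2" if "x \<in> ?X" for x
      proof -
        have "coth (y x) = 1 / tanh (y x)" by (simp add: coth_def tanh_def)
        also have "\<dots> = - (\<omega> / \<phi> x)" using \<phi>[OF that] \<phi>0[OF that] \<omega> by (simp add: field_simps)
        finally have *: "coth (y x) = - (\<omega> / \<phi> x)" .
        show ?thesis unfolding * kc[OF that] using \<omega>(1) \<phi>0[OF that] by (simp add: field_simps eval_nat_numeral)
      qed
      obtain P' where "interval_domains P'" "agrees P' (\<lambda>x. c / \<omega> ^ 4 * (coth x)\<^sup>2) (\<lambda>x u. - tanh x) (\<lambda>x u. 0)"
        "G_equivalent P P'" "x_dom P' = (\<lambda>x. \<omega> * x + \<delta>) ` ?X"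
        by (rule G_equivalentI[OF dom _ Q, where ?\<epsilon>1.0 = \<omega> and ?\<epsilon>3.0 = \<delta> and k' = "\<lambda>x. c / \<omega> ^ 4 * (coth x)\<^sup>2"
            and \<xi>' = "\<lambda>x u. - tanh x" and \<eta>' = "\<lambda>x u. 0"])
          (use \<omega> \<phi> k' in \<open>simp_all add: y_def\<close>)
      moreover have "0 \<notin> (\<lambda>x. \<omega> * x + \<delta>) ` ?X" using y0 unfolding y_def by fastforce
      moreover have "c / \<omega> ^ 4 \<noteq> 0" using c \<omega> by simp
      ultimately have "listed P'" unfolding listed_def by blast
      then show ?thesis using \<open>G_equivalent P P'\<close> by blast
    next
      case False
      then have sg: "sgn (E x0) = - 1" using E0 by simp
      have y0: "1 - exp (- 2 * y x) \<noteq> 0" and \<phi>: "\<phi> x * (1 - exp (- 2 * y x)) = - \<omega> * (1 + exp (- 2 * y x))"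
        if "x \<in> ?X" for x
      proof -
        have "\<omega> + \<phi> x = - exp (- 2 * y x) * (\<omega> - \<phi> x)"
          using ratio[OF that] sg m0[OF that] by (simp add: field_simps)
        then show eq: "\<phi> x * (1 - exp (- 2 * y x)) = - \<omega> * (1 + exp (- 2 * y x))" by algebra
        \<comment> \<open>At a zero of \<open>y\<close> the relation would read 0 = -2 \<omega>; so
          the pole of coth stays outside the domain.\<close>
        show "1 - exp (- 2 * y x) \<noteq> 0"
        proof
          assume "1 - exp (- 2 * y x) = 0"
          then show False using eq \<omega>(1) pos[of x] by simp
        qed
      qed
      have coth: "- coth (y x) = \<phi> x / \<omega>" if "x \<in> ?X" for x
      proof -
        have "coth (y x) = 1 / tanh (y x)" by (simp add: coth_def tanh_def)
        also have "\<dots> = (1 + exp (- 2 * y x)) / (1 - exp (- 2 * y x))" unfolding tanh by simp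
        also have "\<dots> = - (\<phi> x / \<omega>)" using \<phi>[OF that] y0[OF that] \<omega>(1) by (simp add: field_simps)
        finally show ?thesis by simp
      qed
      have k': "c / \<omega> ^ 4 * (tanh (y x))\<^sup>2 = coef P x / \<omega>\<^sup>2" if "x \<in> ?X" for x
      proof -
        have "tanh (y x) = 1 / coth (y x)" by (simp add: coth_def tanh_def)
        also have "coth (y x) = - (\<phi> x / \<omega>)" using coth[OF that] by simp
        also have "1 / - (\<phi> x / \<omega>) = - (\<omega> / \<phi> x)" by simp
        finally have *: "tanh (y x) = - (\<omega> / \<phi> x)" .
        show ?thesis unfolding * kc[OF that] using \<omega>(1) \<phi>0[OF that] by (simp add: field_simps eval_nat_numeral)
      qed
      obtain P' where "interval_domains P'" "agrees P' (\<lambda>x. c / \<omega> ^ 4 * (tanh x)\<^sup>2) (\<lambda>x u. - coth x) (\<lambda>x u. 0)"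
        "G_equivalent P P'" "x_dom P' = (\<lambda>x. \<omega> * x + \<delta>) ` ?X"
        by (rule G_equivalentI[OF dom _ Q, where ?\<epsilon>1.0 = \<omega> and ?\<epsilon>3.0 = \<delta> and k' = "\<lambda>x. c / \<omega> ^ 4 * (tanh x)\<^sup>2"
            and \<xi>' = "\<lambda>x u. - coth x" and \<eta>' = "\<lambda>x u. 0"])
          (use \<omega> coth k' in \<open>simp_all add: y_def\<close>)
      moreover have "0 \<notin> (\<lambda>x. \<omega> * x + \<delta>) ` ?X" using y0 unfolding y_def by fastforce
      moreover have "c / \<omega> ^ 4 \<noteq> 0" using c \<omega> by simp
      ultimately have "listed P'" unfolding listed_def by blast
      then show ?thesis using \<open>G_equivalent P P'\<close> by blast
    qed
  qed
qed

section \<open>The cases a = 0 and a nonzero combined\<close>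

lemma Dx_cong:
  assumes "open X" "x \<in> X" "\<And>y. y \<in> X \<Longrightarrow> f t y = g s y"
  shows "Dx f t x = Dx g s x"
  unfolding Dx_def
  by (rule deriv_cong_ev[OF eventually_mono[OF eventually_nhds_in_open[OF assms(1,2)] assms(3)] refl])

lemma Dt_const:
  assumes "open T" "t \<in> T" "\<And>s. s \<in> T \<Longrightarrow> g s x = c"
  shows "Dt g t x = 0"
  unfolding Dt_def by (rule deriv_on_open[OF assms(1,2), of _ "\<lambda>s. c"]) (simp_all add: assms(3))

theorem theorem2:
  shows "(\<forall>P :: kq_pair. listed P \<longrightarrow> non_lie_pair P) \<and>
         (\<forall>P :: kq_pair. non_lie_pair P \<longrightarrow> (\<exists>P' :: kq_pair. listed P' \<and> G_equivalent P P'))"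
proof (intro conjI allI impI)
  fix P assume "listed P"
  then show "non_lie_pair P" by (rule listed_non_lie_pair)
next
  fix P assume P: "non_lie_pair P"
  let ?T = "t_dom P" and ?X = "x_dom P" and ?U = "u_dom P" and ?k = "coef P" and ?Q = "oper P"
  have dom: "interval_domains P" and k: "smooth_on ?X ?k" and k0: "\<And>x. x \<in> ?X \<Longrightarrow> ?k x \<noteq> 0"
    and Q1: "\<And>p. p \<in> dom3 P \<Longrightarrow> fst (?Q p) = 1"
    and ncs: "nonclassical_symmetry ?k (dom3 P) ?Q" and non_lie: "\<not> equivalent_to_lie ?k (dom3 P) ?Q"
    using P by (auto simp: non_lie_pair_def)
  have I: "open_interval ?T" "open_interval ?X" "open_interval ?U"
    using dom by (auto simp: interval_domains_def)
  have sQ: "smooth_on (dom3 P) ?Q" using ncs by (simp add: nonclassical_symmetry_def)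
  have o: "open ?T" "open ?X" using I by (auto simp: open_interval_def)
  obtain t0 x0 where t0: "t0 \<in> ?T" and x0: "x0 \<in> ?X" using I by (auto simp: open_interval_def)
  obtain a b m n where s: "smooth2 ?T ?X a" "smooth2 ?T ?X b" "smooth2 ?T ?X m" "smooth2 ?T ?X n"
    and Q: "\<And>t x u. (t, x, u) \<in> dom3 P \<Longrightarrow> ?Q (t, x, u) = (1, a t x * u + b t x,
      - (a t x)\<^sup>2 / 3 * u ^ 3 + (Dx a t x - a t x * b t x) * u\<^sup>2 + m t x * u + n t x)"
    and e3: "\<And>t x. t \<in> ?T \<Longrightarrow> x \<in> ?X \<Longrightarrow> a t x * (9 * ?k x - 2 * (a t x)\<^sup>2) = 0"
    and e2: "\<And>t x. t \<in> ?T \<Longrightarrow> x \<in> ?X \<Longrightarrow>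
      2 * a t x * Dx a t x + 2 * a t x * (Dx a t x - a t x * b t x) - 3 * a t x * ?k x = 0"
    and e1: "\<And>t x. t \<in> ?T \<Longrightarrow> x \<in> ?X \<Longrightarrow> Dx (Dx a) t x - Dt a t x
      - 4 * (Dx (Dx a) t x - (Dx a t x * b t x + a t x * Dx b t x))
      - 2 * (a t x * Dx b t x + b t x * Dx a t x) + 2 * a t x * m t x = 0"
    and e0: "\<And>t x. t \<in> ?T \<Longrightarrow> x \<in> ?X \<Longrightarrow>
      Dx (Dx b) t x - Dt b t x - 2 * Dx m t x - 2 * b t x * Dx b t x + 2 * a t x * n t x = 0"
    and u0: "\<And>t x. t \<in> ?T \<Longrightarrow> x \<in> ?X \<Longrightarrow> Dt n t x - Dx (Dx n) t x + 2 * Dx b t x * n t x = 0"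
    and u1: "\<And>t x. t \<in> ?T \<Longrightarrow> x \<in> ?X \<Longrightarrow> Dt m t x - Dx (Dx m) t x
      + 2 * Dx a t x * n t x + 2 * Dx b t x * m t x - 2 * ?k x * n t x = 0"
    and u2: "\<And>t x. (\<And>t x. t \<in> ?T \<Longrightarrow> x \<in> ?X \<Longrightarrow> a t x = 0) \<Longrightarrow> t \<in> ?T \<Longrightarrow> x \<in> ?X \<Longrightarrow>
      (m t x - 2 * Dx b t x) * ?k x - b t x * deriv ?k x - 2 * ?k x * m t x + 3 * ?k x * n t x = 0"
    and u3: "\<And>t x. (\<And>t x. t \<in> ?T \<Longrightarrow> x \<in> ?X \<Longrightarrow> a t x = 0) \<Longrightarrow> t \<in> ?T \<Longrightarrow> x \<in> ?X \<Longrightarrow>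
      - (m t x - 2 * Dx b t x) * ?k x + b t x * deriv ?k x + 3 * ?k x * m t x = 0"
  proof -
    show thesis by (rule reduction_structure[OF I dom3_def k _ ncs]) (fact Q1, fact that)
  qed
  show "\<exists>P'. listed P' \<and> G_equivalent P P'"
  proof (cases "\<exists>t\<in>?T. \<exists>x\<in>?X. a t x \<noteq> 0")
    case False
    then have a0: "a t x = 0" if "t \<in> ?T" "x \<in> ?X" for t x using that by blast
    have Dxa: "Dx a t x = 0" if "t \<in> ?T" "x \<in> ?X" for t x
      using Dx_cong[OF o(2) that(2), of a t "\<lambda>t x. 0" t] a0[OF that(1)] by (simp add: Dx_def)
    have nm: "n t x = - m t x / 3" if "t \<in> ?T" "x \<in> ?X" for t x
    proof -
      \<comment> \<open>The sum of the u^2 and u^3 coefficients; all terms with b cancel.\<close>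
      have "?k x * (m t x + 3 * n t x) = 0" using u2[OF a0 that] u3[OF a0 that] by algebra
      then show ?thesis using k0[OF that(2)] by simp
    qed
    have m0: "m t x = 0" if t: "t \<in> ?T" and x: "x \<in> ?X" for t x
    proof -
      note sm = s(3) smooth2_deriv(4)[OF o s(3)]
      have Dtn: "Dt n t x = - Dt m t x / 3"
        unfolding Dt_def[of n]
        by (rule deriv_on_open[OF o(1) t, of _ "\<lambda>t. - m t x / 3"])
          (use nm x smooth2_deriv(1)[OF o sm(1) t x] in \<open>auto intro!: derivative_eq_intros\<close>)
      have Dxn: "Dx n t x = - Dx m t x / 3" if "x \<in> ?X" for x
        unfolding Dx_def[of n]
        by (rule deriv_on_open[OF o(2) that, of _ "\<lambda>x. - m t x / 3"])
          (use nm t smooth2_deriv(2)[OF o sm(1) t that] in \<open>auto intro!: derivative_eq_intros\<close>)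
      have "Dx (Dx n) t x = - Dx (Dx m) t x / 3"
        unfolding Dx_def[of "Dx n"]
        by (rule deriv_on_open[OF o(2) x, of _ "\<lambda>x. - Dx m t x / 3"])
          (use Dxn smooth2_deriv(2)[OF o sm(2) t x] in \<open>auto intro!: derivative_eq_intros\<close>)
      \<comment> \<open>With n = -m / 3 and a_x = 0, \<open>u0\<close> says that m satisfies
        \<open>u1\<close> without its term -2 k n, so that k n = 0.\<close>
      then have "2 * ?k x * m t x = 0"
        using Dtn u0[OF t x] u1[OF t x] nm[OF t x] Dxa[OF t x] by algebra
      then show ?thesis using k0[OF x] by simp
    qed
    have n0: "n t x = 0" if "t \<in> ?T" "x \<in> ?X" for t x using nm[OF that] m0[OF that] by simp
    have Qb: "?Q (t, x, u) = (1, b t x, 0)" if "(t, x, u) \<in> dom3 P" for t x u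
      using Q[OF that] that a0 Dxa m0 n0 by (simp add: dom3_def)
    have eb: "2 * Dx b t x * ?k x + b t x * deriv ?k x = 0"
      "Dt b t x = Dx (Dx b) t x - 2 * b t x * Dx b t x" if "t \<in> ?T" "x \<in> ?X" for t x
    proof -
      have "Dx m t x = 0"
        using Dx_cong[OF o(2) that(2), of m t "\<lambda>t x. 0" t] m0[OF that(1)] by (simp add: Dx_def)
      then show "Dt b t x = Dx (Dx b) t x - 2 * b t x * Dx b t x"
        using e0[OF that] a0[OF that] by simp
      show "2 * Dx b t x * ?k x + b t x * deriv ?k x = 0"
        using u3[OF a0 that] m0[OF that] by simp
    qed
    obtain \<phi> c \<kappa> where \<phi>: "\<And>t x. t \<in> ?T \<Longrightarrow> x \<in> ?X \<Longrightarrow> b t x = \<phi> x" "\<And>x. x \<in> ?X \<Longrightarrow> \<phi> x \<noteq> 0"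
      "\<And>x. x \<in> ?X \<Longrightarrow> (\<phi> has_field_derivative (\<phi> x)\<^sup>2 + \<kappa>) (at x)"
      "\<And>x. x \<in> ?X \<Longrightarrow> ?k x = c / (\<phi> x)\<^sup>2" "c \<noteq> 0"
    proof -
      show thesis
        by (rule linear_reduction[OF I dom3_def k _ sQ s(2) _ _ _ non_lie])
          (fact k0, fact Qb, fact eb(1), fact eb(2), fact that)
    qed
    have "?Q (t, x, u) = (1, \<phi> x, 0)" if "(t, x, u) \<in> dom3 P" for t x u
      using Qb[OF that] \<phi>(1) that by (simp add: dom3_def)
    from riccati_normal_form[OF dom k sQ this \<phi>(2-5) non_lie] show ?thesis .
  next
    case True
    then obtain t1 x1 where tx1: "t1 \<in> ?T" "x1 \<in> ?X" and a1: "a t1 x1 \<noteq> 0" by blast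
    have a2: "9 * ?k x = 2 * (a t x)\<^sup>2" if t: "t \<in> ?T" and x: "x \<in> ?X" for t x
    proof -
      \<comment> \<open>By \<open>e3\<close> the quotient a^2 / k takes only the values 0 and 9 / 2,
        so it is constant on the connected box; for \<open>a\<close> itself \<open>e3\<close> gives
        no finite set of values.\<close>
      let ?q = "\<lambda>p. (a (fst p) (snd p))\<^sup>2 / ?k (snd p)"
      have "continuous_on (?T \<times> ?X) (\<lambda>p. a (fst p) (snd p))"
        using smooth_on_continuous[OF s(1)[unfolded smooth2_def]] .
      moreover have "continuous_on (?T \<times> ?X) (\<lambda>p. ?k (snd p))"
        by (rule continuous_on_compose2[OF smooth_on_continuous[OF k] continuous_on_snd[OF continuous_on_id]]) auto
      ultimately have "continuous_on (?T \<times> ?X) ?q"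
        using k0 by (intro continuous_intros) auto
      moreover have "finite (?q ` (?T \<times> ?X))"
      proof (rule finite_subset)
        show "?q ` (?T \<times> ?X) \<subseteq> {0, 9 / 2}"
        proof
          fix z assume "z \<in> ?q ` (?T \<times> ?X)"
          then obtain t x where tx: "t \<in> ?T" "x \<in> ?X" and z: "z = (a t x)\<^sup>2 / ?k x" by auto
          have "a t x = 0 \<or> (a t x)\<^sup>2 = 9 / 2 * ?k x" using e3[OF tx] by auto
          then show "z \<in> {0, 9 / 2}" using z k0[OF tx(2)] by auto
        qed
      qed simp
      moreover have "connected (?T \<times> ?X)"
        using I by (intro connected_Times) (auto simp: open_interval_def is_interval_connected)
      ultimately have "?q constant_on (?T \<times> ?X)"
        using continuous_finite_range_constant by blast
      then have "?q (t, x) = ?q (t1, x1)" using t x tx1 unfolding constant_on_def by (metis mem_Sigma_iff)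
      then have "a t x \<noteq> 0" using a1 k0[OF x] k0[OF tx1(2)] by auto
      then show ?thesis using e3[OF t x] by simp
    qed
    have a0: "a t x \<noteq> 0" if "t \<in> ?T" "x \<in> ?X" for t x using a2[OF that] k0[OF that(2)] by auto
    \<comment> \<open>For fixed x the square of a equals 9 k / 2 and does not depend on t, so a
      takes at most two opposite values and continuity picks one. Then b, m, n inherit independence
      of t from \<open>e2\<close>, \<open>e1\<close>, \<open>e0\<close>, each linear in the next
      unknown.\<close>
    have ac: "a t x = a t0 x" if t: "t \<in> ?T" and x: "x \<in> ?X" for t x
    proof -
      have "continuous_on ?T (\<lambda>t. a t x)"
        using smooth2_deriv(1)[OF o s(1) _ x]
        by (intro continuous_at_imp_continuous_on) (blast intro: DERIV_isCont)
      moreover have "finite ((\<lambda>t. a t x) ` ?T)"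
      proof (rule finite_subset)
        show "(\<lambda>t. a t x) ` ?T \<subseteq> {a t0 x, - a t0 x}"
        proof
          fix z assume "z \<in> (\<lambda>t. a t x) ` ?T"
          then obtain t where "t \<in> ?T" "z = a t x" by auto
          then have "z\<^sup>2 = (a t0 x)\<^sup>2" using a2[OF _ x] a2[OF t0 x] by simp
          then show "z \<in> {a t0 x, - a t0 x}" by (simp add: power2_eq_iff)
        qed
      qed simp
      ultimately have "(\<lambda>t. a t x) constant_on ?T"
        using continuous_finite_range_constant[of ?T] I(1) is_interval_connected
        by (auto simp: open_interval_def)
      then show ?thesis using t t0 unfolding constant_on_def by metis
    qed
    have Dxa: "Dx a t x = Dx a t0 x" if "t \<in> ?T" "x \<in> ?X" for t x
      by (rule Dx_cong[OF o(2) that(2)]) (rule ac[OF that(1)])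
    have bc: "b t x = b t0 x" if t: "t \<in> ?T" and x: "x \<in> ?X" for t x
    proof -
      have "2 * (a t0 x)\<^sup>2 * (b t x - b t0 x) = 0"
        using e2[OF t x] e2[OF t0 x] ac[OF t x] Dxa[OF t x] by algebra
      then show ?thesis using a0[OF t0 x] by simp
    qed
    have Dxb: "Dx b t x = Dx b t0 x" if "t \<in> ?T" "x \<in> ?X" for t x
      by (rule Dx_cong[OF o(2) that(2)]) (rule bc[OF that(1)])
    have Dta: "Dt a t x = 0" and Dtb: "Dt b t x = 0" if "t \<in> ?T" "x \<in> ?X" for t x
      by (rule Dt_const[OF o(1) that(1)], rule ac[OF _ that(2)], assumption)
        (rule Dt_const[OF o(1) that(1)], rule bc[OF _ that(2)], assumption)
    have mc: "m t x = m t0 x" if t: "t \<in> ?T" and x: "x \<in> ?X" for t x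
    proof -
      have "Dx (Dx a) t x = Dx (Dx a) t0 x" by (rule Dx_cong[OF o(2) x]) (rule Dxa[OF t])
      note e1[OF t x, unfolded this ac[OF t x] Dxa[OF t x] bc[OF t x] Dxb[OF t x] Dta[OF t x]]
      then have "2 * a t0 x * m t x = 2 * a t0 x * m t0 x"
        using e1[OF t0 x, unfolded Dta[OF t0 x]] by linarith
      then show ?thesis using a0[OF t0 x] by simp
    qed
    have nc: "n t x = n t0 x" if t: "t \<in> ?T" and x: "x \<in> ?X" for t x
    proof -
      have Dxxb: "Dx (Dx b) t x = Dx (Dx b) t0 x" by (rule Dx_cong[OF o(2) x]) (rule Dxb[OF t])
      have "Dx m t x = Dx m t0 x" by (rule Dx_cong[OF o(2) x]) (rule mc[OF t])
      note e0[OF t x, unfolded this Dxxb ac[OF t x] bc[OF t x] Dxb[OF t x] Dtb[OF t x]]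
      then have "2 * a t0 x * n t x = 2 * a t0 x * n t0 x"
        using e0[OF t0 x, unfolded Dtb[OF t0 x]] by linarith
      then show ?thesis using a0[OF t0 x] by simp
    qed
    have Dtm: "Dt m t x = 0" and Dtn: "Dt n t x = 0" if "t \<in> ?T" "x \<in> ?X" for t x
      by (rule Dt_const[OF o(1) that(1)], rule mc[OF _ that(2)], assumption)
        (rule Dt_const[OF o(1) that(1)], rule nc[OF _ that(2)], assumption)
    have Q0: "?Q (t, x, u) = (1, a t0 x * u + b t0 x,
        - (a t0 x)\<^sup>2 / 3 * u ^ 3 + (Dx a t0 x - a t0 x * b t0 x) * u\<^sup>2 + m t0 x * u + n t0 x)"
      if "(t, x, u) \<in> dom3 P" for t x u
    proof -
      have "t \<in> ?T" "x \<in> ?X" using that by (auto simp: dom3_def)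
      then show ?thesis using Q[OF that] ac bc mc nc Dxa by metis
    qed
    have e1': "Dx (Dx a) t0 x - 4 * (Dx (Dx a) t0 x - (Dx a t0 x * b t0 x + a t0 x * Dx b t0 x))
        - 2 * (a t0 x * Dx b t0 x + b t0 x * Dx a t0 x) + 2 * a t0 x * m t0 x = 0"
      and e0': "Dx (Dx b) t0 x - 2 * Dx m t0 x - 2 * b t0 x * Dx b t0 x + 2 * a t0 x * n t0 x = 0"
      and u1': "- Dx (Dx m) t0 x + 2 * Dx a t0 x * n t0 x + 2 * Dx b t0 x * m t0 x - 2 * ?k x * n t0 x = 0"
      and u0': "- Dx (Dx n) t0 x + 2 * Dx b t0 x * n t0 x = 0" if x: "x \<in> ?X" for x
      using e1[OF t0 x] e0[OF t0 x] u1[OF t0 x] u0[OF t0 x] Dta[OF t0 x] Dtb[OF t0 x] Dtm[OF t0 x] Dtn[OF t0 x]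
      by simp_all
    consider (const) "\<And>x y. x \<in> ?X \<Longrightarrow> y \<in> ?X \<Longrightarrow> a t0 x = a t0 y" "\<And>x. x \<in> ?X \<Longrightarrow> b t0 x = - a t0 x / 3"
        "\<And>x. x \<in> ?X \<Longrightarrow> m t0 x = 0" "\<And>x. x \<in> ?X \<Longrightarrow> n t0 x = 0"
      | (inv) \<delta> where "\<And>x. x \<in> ?X \<Longrightarrow> x + \<delta> \<noteq> 0" "\<And>x. x \<in> ?X \<Longrightarrow> a t0 x = 3 / (x + \<delta>)"
        "\<And>x. x \<in> ?X \<Longrightarrow> b t0 x = - 3 / (x + \<delta>)" "\<And>x. x \<in> ?X \<Longrightarrow> m t0 x = - 3 / (x + \<delta>)\<^sup>2"
        "\<And>x. x \<in> ?X \<Longrightarrow> n t0 x = 0"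
    proof -
      show thesis
        by (rule quasilinear_rigid[OF I(2) smooth2_section[OF o(2) s(1) t0], where k = ?k and b = "b t0"
              and m = "m t0" and n = "n t0"])
          (fact a0[OF t0], fact a2[OF t0], fact e2[OF t0, unfolded Dx_def[abs_def]],
            fact e1'[unfolded Dx_def[abs_def]], fact e0'[unfolded Dx_def[abs_def]],
            fact u1'[unfolded Dx_def[abs_def]], fact u0'[unfolded Dx_def[abs_def]], fact that, fact that)
    qed
    then show ?thesis
    proof cases
      case const
      define \<alpha> where "\<alpha> = a t0 x0"
      have a: "a t0 x = \<alpha>" if "x \<in> ?X" for x using const(1)[OF that x0] by (simp add: \<alpha>_def)
      have \<alpha>0: "\<alpha> \<noteq> 0" using a0[OF t0 x0] by (simp add: \<alpha>_def)
      have Dx0: "Dx a t0 x = 0" if "x \<in> ?X" for x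
        using Dx_cong[OF o(2) that, of a t0 "\<lambda>t x. \<alpha>" t0] a by (simp add: Dx_def)
      \<comment> \<open>Forced by c > 0, k = c^2 / 2 and 9 k = 2 \<alpha>^2; the sign of \<alpha>
        becomes the choice of sign in case 5.\<close>
      define c where "c = 2 / 3 * \<bar>\<alpha>\<bar>"
      have c: "c > 0" using \<alpha>0 by (simp add: c_def)
      have sc: "sgn \<alpha> * (c / 2) = \<alpha> / 3" by (simp add: c_def sgn_if)
      have c2: "c\<^sup>2 = 4 / 9 * \<alpha>\<^sup>2" by (simp add: c_def power_mult_distrib power_divide)
      have Qc: "?Q (t, x, u) = (1, sgn \<alpha> * (c / 2) * (3 * u - 1), - (3 * c\<^sup>2 / 4) * u\<^sup>2 * (u - 1))"
        if tx: "(t, x, u) \<in> dom3 P" for t x u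
      proof -
        have x: "x \<in> ?X" using tx by (simp add: dom3_def)
        have "\<alpha> * u + - \<alpha> / 3 = \<alpha> / 3 * (3 * u - 1)" by (simp add: field_simps)
        moreover have "- \<alpha>\<^sup>2 / 3 * u ^ 3 + (0 - \<alpha> * (- \<alpha> / 3)) * u\<^sup>2 + 0 * u + 0
            = - (3 * (4 / 9 * \<alpha>\<^sup>2) / 4) * u\<^sup>2 * (u - 1)"
          by (simp add: field_simps power2_eq_square power3_eq_cube)
        ultimately show ?thesis
          unfolding Q0[OF tx] sc c2 a[OF x] const(2)[OF x] const(3)[OF x] const(4)[OF x] Dx0[OF x] by simp
      qed
      have kc: "c\<^sup>2 / 2 = ?k x" if "x \<in> ?X" for x
        using a2[OF t0 that] a[OF that] by (simp add: c2)
      obtain P' where "interval_domains P'" "G_equivalent P P'" "agrees P' (\<lambda>x. c\<^sup>2 / 2)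
          (\<lambda>x u. sgn \<alpha> * (c / 2) * (3 * u - 1)) (\<lambda>x u. - (3 * c\<^sup>2 / 4) * u\<^sup>2 * (u - 1))"
        by (rule G_equivalentI[OF dom _ Qc, where ?\<epsilon>1.0 = 1 and ?\<epsilon>3.0 = 0 and k' = "\<lambda>x. c\<^sup>2 / 2"
            and \<xi>' = "\<lambda>x u. sgn \<alpha> * (c / 2) * (3 * u - 1)" and \<eta>' = "\<lambda>x u. - (3 * c\<^sup>2 / 4) * u\<^sup>2 * (u - 1)"])
          (use kc in simp_all)
      moreover have "sgn \<alpha> \<in> {1, - 1}" using \<alpha>0 by (simp add: sgn_if)
      ultimately have "listed P'" unfolding listed_def using c by blast
      then show ?thesis using \<open>G_equivalent P P'\<close> by blast
    next
      case inv
      have Dxi: "Dx a t0 x = - 3 / (x + \<delta>)\<^sup>2" if "x \<in> ?X" for x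
        unfolding Dx_def
        by (rule deriv_on_open[OF o(2) that, of _ "\<lambda>x. 3 / (x + \<delta>)"])
          (use inv(1)[OF that] inv(2) in \<open>auto intro!: derivative_eq_intros simp: power2_eq_square\<close>)
      have Qi: "?Q (t, x, u) = (1, 3 / (x + \<delta>) * (u - 1), - (3 / (x + \<delta>)\<^sup>2) * u * (u - 1)\<^sup>2)"
        if tx: "(t, x, u) \<in> dom3 P" for t x u
      proof -
        have x: "x \<in> ?X" using tx by (simp add: dom3_def)
        define y where "y = x + \<delta>"
        have "y \<noteq> 0" using inv(1)[OF x] by (simp add: y_def)
        then have "3 / y * u + - 3 / y = 3 / y * (u - 1)"
          "- (3 / y)\<^sup>2 / 3 * u ^ 3 + (- 3 / y\<^sup>2 - 3 / y * (- 3 / y)) * u\<^sup>2 + - 3 / y\<^sup>2 * u + 0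
            = - (3 / y\<^sup>2) * u * (u - 1)\<^sup>2"
          by (simp_all add: field_simps power2_eq_square power3_eq_cube)
        then show ?thesis
          unfolding Q0[OF tx] inv(2)[OF x] inv(3)[OF x] inv(4)[OF x] inv(5)[OF x] Dxi[OF x] y_def by simp
      qed
      have ki: "2 / (x + \<delta>)\<^sup>2 = ?k x" if "x \<in> ?X" for x
        using a2[OF t0 that] inv(1,2)[OF that] by (simp add: field_simps)
      obtain P' where "interval_domains P'" "G_equivalent P P'" "agrees P' (\<lambda>x. 2 / x\<^sup>2)
          (\<lambda>x u. 3 / x * (u - 1)) (\<lambda>x u. - (3 / x\<^sup>2) * u * (u - 1)\<^sup>2)" "x_dom P' = (\<lambda>x. 1 * x + \<delta>) ` ?X"
        by (rule G_equivalentI[OF dom _ Qi, where ?\<epsilon>1.0 = 1 and ?\<epsilon>3.0 = \<delta> and k' = "\<lambda>x. 2 / x\<^sup>2"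
            and \<xi>' = "\<lambda>x u. 3 / x * (u - 1)" and \<eta>' = "\<lambda>x u. - (3 / x\<^sup>2) * u * (u - 1)\<^sup>2"])
          (use ki in simp_all)
      moreover have "0 \<notin> (\<lambda>x. 1 * x + \<delta>) ` ?X" using inv(1) by force
      ultimately have "listed P'" unfolding listed_def by simp
      then show ?thesis using \<open>G_equivalent P P'\<close> by blast
    qed
  qed
qed

end
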